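(* Let $L_\pm\subset L$ be a splitting of the loop group $L=L(G)$, $\{J_j\mid j\ge1\}$ a vacuum sequence in $\mathcal L_+$, and suppose that the $2$-cocycle $w(\xi,\eta)=\langle\partial_\lambda\xi,\eta\rangle_{-1}$ on $\mathcal L$ is compatible with the splitting. Let $V(t)=\exp\left(\sum_{j=1}^Nt_jJ_j\right)$ be the vacuum frame. Let $f\in L_-$, and $V(t)f^{-1}=M(t)^{-1}E(t)$ with $M(t)\in L_-$ and $E(t)\in L_+$. Then $$(\ln\tau_f)_{t_jt_k}=\left\langle MJ_jM^{-1},\ \partial_\lambda(MJ_kM^{-1})_+\right\rangle_{-1}.$$
   Context: $G$ is a complex Lie group with Lie algebra $\mathfrak g$ carrying an ad-invariant non-degenerate bilinear form $(\cdot,\cdot)$ (for classical algebras, $\mathrm{tr}(AB)$). $L(G)$ is the group of smooth loops $S^1\to G$ with loop parameter $\lambda$, and $\mathcal L=C^\infty(S^1,\mathfrak g)$. A splitting consists of subgroups $L_\pm$ with Lie algebras $\mathcal L_\pm$ such that $L_+\cap L_-=\{e\}$ and $\mathcal L=\mathcal L_+\oplus\mathcal L_-$; $\xi_\pm$ denotes the $\mathcal L_\pm$ component of $\xi$. $\langle\xi,\eta\rangle_k$ is the coefficient of $\lambda^k$ in $(\xi(\lambda),\eta(\lambda))$. A $2$-cocycle $w$ is compatible with the splitting if it vanishes on $\mathcal L_+$ and on $\mathcal L_-$ (both are isotropic). A vacuum sequence is a linearly independent commuting sequence in $\mathcal L_+$. The factorization of $V(t)f^{-1}$ exists for $t$ in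 a neighborhood of $0\in\mathbb R^N$. $\mu$-function: the left invariant form defined by $w$ is assumed to represent a class in $H^2(L,2\pi i\mathbb Z)$. On the big cell $(L_+L_-)\cap(L_-L_+)$ write uniquely $g=f_+f_-^{-1}=g_-^{-1}g_+$ with $f_\pm,g_\pm\in L_\pm$, and let $\gamma_\pm$ (resp. $\tilde\gamma_\pm$) be paths in $L_\pm$ from $e$ to $f_\pm$ (resp. $g_\pm$). Then $\mu(g)=\exp\left(\int_\Omega w\right)$, where $\Omega$ is any surface in $L$ whose oriented boundary is $\gamma_+*(f_+\gamma_-^{-1})$ followed by the reverse of $\tilde\gamma_-^{-1}*(g_-^{-1}\tilde\gamma_+)$. The tau function of $f\in L_-$ is $\tau_f(t)=\mu(V(t)f^{-1})$, defined for $t$ in a neighborhood of $0\in\mathbb R^N$ on which $V(t)f^{-1}$ lies in the big cell. *)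

theory Defs
  imports "HOL-Analysis.Analysis" "HOL-Homology.Simplices" "HOL-Algebra.Coset"
begin

section \<open>Smooth and holomorphic maps\<close>

primrec times_differentiable_on ::
  "nat \<Rightarrow> 'a::real_normed_vector set \<Rightarrow> ('a \<Rightarrow> 'b::real_normed_vector) \<Rightarrow> bool" where
  "times_differentiable_on 0 S f \<longleftrightarrow> continuous_on S f"
| "times_differentiable_on (Suc k) S f \<longleftrightarrow>
     (\<forall>x\<in>S. f differentiable (at x)) \<and>
     (\<forall>v. times_differentiable_on k S (\<lambda>x. frechet_derivative f (at x) v))"

text \<open>Only used for open \<open>S\<close>.\<close>
definition smooth_on :: "'a::real_normed_vector set \<Rightarrow> ('a \<Rightarrow> 'b::real_normed_vector) \<Rightarrow> bool" where
  "smooth_on S f \<longleftrightarrow> (\<forall>k. times_differentiable_on k S f)"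

text \<open>Here \<open>sc\<close> and \<open>sc'\<close> are the complex scalar multiplications of the two spaces.\<close>
definition holomorphic_map_on ::
  "(complex \<Rightarrow> 'a \<Rightarrow> 'a) \<Rightarrow> (complex \<Rightarrow> 'b \<Rightarrow> 'b) \<Rightarrow>
   'a::real_normed_vector set \<Rightarrow> ('a \<Rightarrow> 'b::real_normed_vector) \<Rightarrow> bool" where
  "holomorphic_map_on sc sc' S f \<longleftrightarrow>
     smooth_on S f \<and>
     (\<forall>x\<in>S. Vector_Spaces.linear sc sc' (frechet_derivative f (at x)))"

abbreviation scale_pair ::
  "complex \<Rightarrow> (complex^'n) \<times> (complex^'n) \<Rightarrow> (complex^'n) \<times> (complex^'n)" where
  "scale_pair c p \<equiv> (c *s fst p, c *s snd p)"


section \<open>Complex Lie groups\<close>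

text \<open>
  A chart is a pair of its domain and its coordinate map. The chart \<open>(edom, echart)\<close> is a chosen
  chart at the identity; the tangent space at the identity, that is the Lie algebra \<open>\<gg>\<close>, is
  written in its coordinates, so that \<open>\<gg>\<close> is \<open>complex^'n\<close> as a vector space.
\<close>
record ('g, 'n::finite) lie_group = "'g monoid" +
  charts :: "('g set \<times> ('g \<Rightarrow> complex^'n)) set"
  edom :: "'g set"
  echart :: "'g \<Rightarrow> complex^'n"

definition complex_atlas ::
  "('g::topological_space set \<times> ('g \<Rightarrow> complex^'n::finite)) set \<Rightarrow> bool" where
  "complex_atlas A \<longleftrightarrow>
     (\<forall>(U, \<phi>)\<in>A. open U \<and> open (\<phi> ` U) \<and> (\<exists>\<psi>. homeomorphism U (\<phi> ` U) \<phi> \<psi>)) \<and>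
     (\<Union>(U, \<phi>)\<in>A. U) = UNIV \<and>
     (\<forall>(U, \<phi>)\<in>A. \<forall>(V, \<psi>)\<in>A.
        holomorphic_map_on (*s) (*s) (\<phi> ` (U \<inter> V)) (\<psi> \<circ> inv_into U \<phi>))"

definition complex_lie_group ::
  "('g::{t2_space,second_countable_topology}, 'n::finite) lie_group \<Rightarrow> bool" where
  "complex_lie_group G \<longleftrightarrow>
     group G \<and> carrier G = UNIV \<and>
     complex_atlas (charts G) \<and>
     continuous_on UNIV (\<lambda>(a, b). a \<otimes>\<^bsub>G\<^esub> b) \<and>
     (\<forall>(U, \<phi>)\<in>charts G. \<forall>(V, \<psi>)\<in>charts G. \<forall>(W, \<rho>)\<in>charts G.
        holomorphic_map_on scale_pair (*s)
          {(x, y). x \<in> \<phi> ` U \<and> y \<in> \<psi> ` V \<and> inv_into U \<phi> x \<otimes>\<^bsub>G\<^esub> inv_into V \<psi> y \<in> W}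
          (\<lambda>(x, y). \<rho> (inv_into U \<phi> x \<otimes>\<^bsub>G\<^esub> inv_into V \<psi> y))) \<and>
     continuous_on UNIV (\<lambda>a. inv\<^bsub>G\<^esub> a) \<and>
     (\<forall>(U, \<phi>)\<in>charts G. \<forall>(W, \<rho>)\<in>charts G.
        holomorphic_map_on (*s) (*s)
          {x \<in> \<phi> ` U. inv\<^bsub>G\<^esub> (inv_into U \<phi> x) \<in> W}
          (\<lambda>x. \<rho> (inv\<^bsub>G\<^esub> (inv_into U \<phi> x)))) \<and>
     (edom G, echart G) \<in> charts G \<and> \<one>\<^bsub>G\<^esub> \<in> edom G"

text \<open>Smooth maps from an open subset of a normed space into the group.\<close>
definition smooth_map_on ::
  "('g::topological_space, 'n::finite) lie_group \<Rightarrow> 'a::real_normed_vector set \<Rightarrow> ('a \<Rightarrow> 'g) \<Rightarrow> bool" where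
  "smooth_map_on G S F \<longleftrightarrow>
     continuous_on S F \<and> (\<forall>(U, \<phi>)\<in>charts G. smooth_on (S \<inter> F -` U) (\<phi> \<circ> F))"

definition Ad :: "('g, 'n::finite) lie_group \<Rightarrow> 'g \<Rightarrow> complex^'n \<Rightarrow> complex^'n" where
  "Ad G g X =
     frechet_derivative
       (\<lambda>v. echart G (g \<otimes>\<^bsub>G\<^esub> inv_into (edom G) (echart G) v \<otimes>\<^bsub>G\<^esub> inv\<^bsub>G\<^esub> g))
       (at (echart G \<one>\<^bsub>G\<^esub>)) X"

text \<open>The Lie bracket is the derivative of \<open>Ad\<close> at the identity.\<close>
definition bracket :: "('g, 'n::finite) lie_group \<Rightarrow> complex^'n \<Rightarrow> complex^'n \<Rightarrow> complex^'n" where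
  "bracket G X Y =
     frechet_derivative (\<lambda>v. Ad G (inv_into (edom G) (echart G) v) Y) (at (echart G \<one>\<^bsub>G\<^esub>)) X"

definition one_parameter_subgroup ::
  "('g::topological_space, 'n::finite) lie_group \<Rightarrow> complex^'n \<Rightarrow> (real \<Rightarrow> 'g) \<Rightarrow> bool" where
  "one_parameter_subgroup G X c \<longleftrightarrow>
     smooth_map_on G UNIV c \<and> (\<forall>s r. c (s + r) = c s \<otimes>\<^bsub>G\<^esub> c r) \<and>
     ((\<lambda>s. echart G (c s)) has_vector_derivative X) (at 0)"

definition lie_exp :: "('g::topological_space, 'n::finite) lie_group \<Rightarrow> complex^'n \<Rightarrow> 'g" where
  "lie_exp G X = (THE c. one_parameter_subgroup G X c) 1"

text \<open>The left logarithmic derivative \<open>c\<^sup>-\<^sup>1 c'\<close> of a curve in the group.\<close>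
definition left_log_deriv ::
  "('g, 'n::finite) lie_group \<Rightarrow> (real \<Rightarrow> 'g) \<Rightarrow> real \<Rightarrow> complex^'n" where
  "left_log_deriv G c s = vector_derivative (\<lambda>r. echart G (inv\<^bsub>G\<^esub> (c s) \<otimes>\<^bsub>G\<^esub> c r)) (at s)"

definition invariant_form ::
  "('g, 'n::finite) lie_group \<Rightarrow> (complex^'n \<Rightarrow> complex^'n \<Rightarrow> complex) \<Rightarrow> bool" where
  "invariant_form G B \<longleftrightarrow>
     (\<forall>X. Vector_Spaces.linear (*s) (*) (B X)) \<and>
     (\<forall>Y. Vector_Spaces.linear (*s) (*) (\<lambda>X. B X Y)) \<and>
     (\<forall>X. (\<forall>Y. B X Y = 0) \<longrightarrow> X = 0) \<and>
     (\<forall>X Y Z. B (bracket G Z X) Y + B X (bracket G Z Y) = 0)"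


section \<open>The loop group and its Lie algebra\<close>

text \<open>
  A map on the circle is represented by its pull-back along \<open>\<theta> \<mapsto> \<lambda> = cis \<theta>\<close>, a function of period
  \<open>2\<pi>\<close> on the real line.
\<close>
definition loop_group ::
  "('g::topological_space, 'n::finite) lie_group \<Rightarrow> (real \<Rightarrow> 'g) monoid" where
  "loop_group G =
     \<lparr>carrier = {\<gamma>. (\<forall>\<theta>. \<gamma> (\<theta> + 2 * pi) = \<gamma> \<theta>) \<and> smooth_map_on G UNIV \<gamma>},
      mult = (\<lambda>\<alpha> \<beta> \<theta>. \<alpha> \<theta> \<otimes>\<^bsub>G\<^esub> \<beta> \<theta>),
      one = (\<lambda>\<theta>. \<one>\<^bsub>G\<^esub>)\<rparr>"

definition loop_algebra :: "(real \<Rightarrow> complex^'n::finite) set" where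
  "loop_algebra = {\<xi>. (\<forall>\<theta>. \<xi> (\<theta> + 2 * pi) = \<xi> \<theta>) \<and> smooth_on UNIV \<xi>}"

definition loop_bracket ::
  "('g, 'n::finite) lie_group \<Rightarrow> (real \<Rightarrow> complex^'n) \<Rightarrow> (real \<Rightarrow> complex^'n) \<Rightarrow> real \<Rightarrow> complex^'n" where
  "loop_bracket G \<xi> \<eta> = (\<lambda>\<theta>. bracket G (\<xi> \<theta>) (\<eta> \<theta>))"

definition loop_exp ::
  "('g::topological_space, 'n::finite) lie_group \<Rightarrow> (real \<Rightarrow> complex^'n) \<Rightarrow> real \<Rightarrow> 'g" where
  "loop_exp G \<xi> = (\<lambda>\<theta>. lie_exp G (\<xi> \<theta>))"

definition loop_Ad ::
  "('g, 'n::finite) lie_group \<Rightarrow> (real \<Rightarrow> 'g) \<Rightarrow> (real \<Rightarrow> complex^'n) \<Rightarrow> real \<Rightarrow> complex^'n" where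
  "loop_Ad G \<gamma> \<xi> = (\<lambda>\<theta>. Ad G (\<gamma> \<theta>) (\<xi> \<theta>))"

text \<open>\<open>\<partial>\<^sub>\<lambda>\<close>: since \<open>\<lambda> = cis \<theta>\<close>, it is \<open>(\<i> \<lambda>)\<^sup>-\<^sup>1 \<partial>\<^sub>\<theta>\<close>.\<close>
definition dlambda :: "(real \<Rightarrow> complex^'n::finite) \<Rightarrow> real \<Rightarrow> complex^'n" where
  "dlambda \<xi> = (\<lambda>\<theta>. (1 / (\<i> * cis \<theta>)) *s vector_derivative \<xi> (at \<theta>))"

text \<open>The coefficient of \<open>\<lambda>\<^sup>k\<close> in the Fourier series of \<open>h\<close>.\<close>
definition laurent_coeff :: "int \<Rightarrow> (real \<Rightarrow> complex) \<Rightarrow> complex" where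
  "laurent_coeff k h = 1 / (2 * pi) * integral {0..2 * pi} (\<lambda>\<theta>. h \<theta> * cis (- (of_int k * \<theta>)))"

definition loop_pairing ::
  "(complex^'n::finite \<Rightarrow> complex^'n \<Rightarrow> complex) \<Rightarrow> int \<Rightarrow>
   (real \<Rightarrow> complex^'n) \<Rightarrow> (real \<Rightarrow> complex^'n) \<Rightarrow> complex" where
  "loop_pairing B k \<xi> \<eta> = laurent_coeff k (\<lambda>\<theta>. B (\<xi> \<theta>) (\<eta> \<theta>))"

definition residue_cocycle ::
  "(complex^'n::finite \<Rightarrow> complex^'n \<Rightarrow> complex) \<Rightarrow>
   (real \<Rightarrow> complex^'n) \<Rightarrow> (real \<Rightarrow> complex^'n) \<Rightarrow> complex" where
  "residue_cocycle B \<xi> \<eta> = loop_pairing B (-1) (dlambda \<xi>) \<eta>"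

definition two_cocycle ::
  "('g, 'n::finite) lie_group \<Rightarrow>
   ((real \<Rightarrow> complex^'n) \<Rightarrow> (real \<Rightarrow> complex^'n) \<Rightarrow> complex) \<Rightarrow> bool" where
  "two_cocycle G w \<longleftrightarrow>
     (\<forall>\<xi>\<in>loop_algebra. \<forall>\<xi>'\<in>loop_algebra. \<forall>\<eta>\<in>loop_algebra. \<forall>c.
        w (\<lambda>\<theta>. c *s \<xi> \<theta> + \<xi>' \<theta>) \<eta> = c * w \<xi> \<eta> + w \<xi>' \<eta>) \<and>
     (\<forall>\<xi>\<in>loop_algebra. \<forall>\<eta>\<in>loop_algebra. w \<xi> \<eta> = - w \<eta> \<xi>) \<and>
     (\<forall>\<xi>\<in>loop_algebra. \<forall>\<eta>\<in>loop_algebra. \<forall>\<zeta>\<in>loop_algebra.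
        w (loop_bracket G \<xi> \<eta>) \<zeta> + w (loop_bracket G \<eta> \<zeta>) \<xi> + w (loop_bracket G \<zeta> \<xi>) \<eta> = 0)"

text \<open>
  Smooth maps from an open set into the loop group: joint smoothness in the parameter and the
  angle, which is smoothness for the Frechet Lie group structure of the loop group.
\<close>
definition smooth_family ::
  "('g::topological_space, 'n::finite) lie_group \<Rightarrow> 'a::real_normed_vector set \<Rightarrow>
   ('a \<Rightarrow> real \<Rightarrow> 'g) \<Rightarrow> bool" where
  "smooth_family G S F \<longleftrightarrow>
     (\<forall>s\<in>S. F s \<in> carrier (loop_group G)) \<and> smooth_map_on G (S \<times> UNIV) (\<lambda>(s, \<theta>). F s \<theta>)"


section \<open>Splittings\<close>

text \<open>Velocities at the identity of the smooth curves in \<open>H\<close>.\<close>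
definition lie_algebra_of ::
  "('g::topological_space, 'n::finite) lie_group \<Rightarrow> (real \<Rightarrow> 'g) set \<Rightarrow> (real \<Rightarrow> complex^'n) set" where
  "lie_algebra_of G H =
     {\<xi>. \<exists>\<epsilon>>0. \<exists>c. smooth_family G {-\<epsilon><..<\<epsilon>} c \<and> (\<forall>s\<in>{-\<epsilon><..<\<epsilon>}. c s \<in> H) \<and>
         c 0 = \<one>\<^bsub>loop_group G\<^esub> \<and>
         \<xi> = (\<lambda>\<theta>. vector_derivative (\<lambda>s. echart G (c s \<theta>)) (at 0))}"

text \<open>
  Subgroups that have a Lie algebra: the velocities form a Lie algebra, and its exponentials lie
  in the subgroup. Real scalars, so that subgroups cut out by reality conditions are included.
\<close>
definition lie_subgroup ::
  "('g::topological_space, 'n::finite) lie_group \<Rightarrow> (real \<Rightarrow> 'g) set \<Rightarrow> bool" where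
  "lie_subgroup G H \<longleftrightarrow>
     subgroup H (loop_group G) \<and>
     (\<forall>\<xi>\<in>lie_algebra_of G H. \<forall>\<eta>\<in>lie_algebra_of G H. \<forall>a b.
        (\<lambda>\<theta>. a *\<^sub>R \<xi> \<theta> + b *\<^sub>R \<eta> \<theta>) \<in> lie_algebra_of G H \<and>
        loop_bracket G \<xi> \<eta> \<in> lie_algebra_of G H) \<and>
     (\<forall>\<xi>\<in>lie_algebra_of G H. loop_exp G \<xi> \<in> H)"

definition splitting ::
  "('g::topological_space, 'n::finite) lie_group \<Rightarrow> (real \<Rightarrow> 'g) set \<Rightarrow> (real \<Rightarrow> 'g) set \<Rightarrow> bool" where
  "splitting G Lp Lm \<longleftrightarrow>
     lie_subgroup G Lp \<and> lie_subgroup G Lm \<and> Lp \<inter> Lm = {\<one>\<^bsub>loop_group G\<^esub>} \<and>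
     lie_algebra_of G Lp \<subseteq> loop_algebra \<and> lie_algebra_of G Lm \<subseteq> loop_algebra \<and>
     (\<forall>\<xi>\<in>loop_algebra. \<exists>!p. fst p \<in> lie_algebra_of G Lp \<and> snd p \<in> lie_algebra_of G Lm \<and>
        \<xi> = (\<lambda>\<theta>. fst p \<theta> + snd p \<theta>))"

definition plus_part ::
  "('g::topological_space, 'n::finite) lie_group \<Rightarrow> (real \<Rightarrow> 'g) set \<Rightarrow> (real \<Rightarrow> 'g) set \<Rightarrow>
   (real \<Rightarrow> complex^'n) \<Rightarrow> real \<Rightarrow> complex^'n" where
  "plus_part G Lp Lm \<xi> =
     fst (THE p. fst p \<in> lie_algebra_of G Lp \<and> snd p \<in> lie_algebra_of G Lm \<and>
        \<xi> = (\<lambda>\<theta>. fst p \<theta> + snd p \<theta>))"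

definition compatible ::
  "('g::topological_space, 'n::finite) lie_group \<Rightarrow>
   ((real \<Rightarrow> complex^'n) \<Rightarrow> (real \<Rightarrow> complex^'n) \<Rightarrow> complex) \<Rightarrow>
   (real \<Rightarrow> 'g) set \<Rightarrow> (real \<Rightarrow> 'g) set \<Rightarrow> bool" where
  "compatible G w Lp Lm \<longleftrightarrow>
     (\<forall>\<xi>\<in>lie_algebra_of G Lp. \<forall>\<eta>\<in>lie_algebra_of G Lp. w \<xi> \<eta> = 0) \<and>
     (\<forall>\<xi>\<in>lie_algebra_of G Lm. \<forall>\<eta>\<in>lie_algebra_of G Lm. w \<xi> \<eta> = 0)"

text \<open>
  The sequence is indexed by \<open>j \<ge> 1\<close>; the value of \<open>J\<close> at \<open>0\<close> is irrelevant. Independence is over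
  the reals, which is implied by independence over the complex numbers.
\<close>
definition vacuum_sequence ::
  "('g::topological_space, 'n::finite) lie_group \<Rightarrow> (real \<Rightarrow> 'g) set \<Rightarrow>
   (nat \<Rightarrow> real \<Rightarrow> complex^'n) \<Rightarrow> bool" where
  "vacuum_sequence G Lp J \<longleftrightarrow>
     (\<forall>j\<ge>1. J j \<in> lie_algebra_of G Lp) \<and>
     (\<forall>i\<ge>1. \<forall>j\<ge>1. loop_bracket G (J i) (J j) = (\<lambda>\<theta>. 0)) \<and>
     (\<forall>A a. finite A \<and> A \<subseteq> {1..} \<and> (\<forall>\<theta>. (\<Sum>j\<in>A. (a j :: real) *\<^sub>R J j \<theta>) = 0) \<longrightarrow> (\<forall>j\<in>A. a j = 0))"


section \<open>Surfaces in the loop group and integration of left invariant 2-forms\<close>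

text \<open>
  Paths and surfaces are smooth singular chains. A path \<open>p\<close> on \<open>[0,1]\<close> is turned into the
  singular simplex \<open>(1-s, s, 0, \<dots>) \<mapsto> p s\<close>, a map \<open>F\<close> on the triangle into the simplex
  \<open>(1-u-v, u, v, 0, \<dots>) \<mapsto> F (u, v)\<close>.
\<close>
definition simplex1 :: "(real \<Rightarrow> 'l) \<Rightarrow> (nat \<Rightarrow> real) \<Rightarrow> 'l" where
  "simplex1 p = (\<lambda>x\<in>standard_simplex 1. p (x 1))"

definition simplex2 :: "(real \<times> real \<Rightarrow> 'l) \<Rightarrow> (nat \<Rightarrow> real) \<Rightarrow> 'l" where
  "simplex2 F = (\<lambda>x\<in>standard_simplex 2. F (x 1, x 2))"

definition triangle :: "(real \<times> real) set" where
  "triangle = {(u, v). 0 \<le> u \<and> 0 \<le> v \<and> u + v \<le> 1}"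

definition triangle_point :: "real \<Rightarrow> real \<Rightarrow> nat \<Rightarrow> real" where
  "triangle_point u v = (\<lambda>i. if i = 0 then 1 - u - v else if i = 1 then u else if i = 2 then v else 0)"

definition smooth_2chain ::
  "('g::topological_space, 'n::finite) lie_group \<Rightarrow> (real \<Rightarrow> 'g) chain \<Rightarrow> bool" where
  "smooth_2chain G C \<longleftrightarrow>
     Poly_Mapping.keys C \<subseteq> {simplex2 F | F. \<exists>S. open S \<and> triangle \<subseteq> S \<and> smooth_family G S F}"

text \<open>
  The left invariant form with value \<open>w\<close> at the identity is \<open>(X, Y) \<mapsto> w (g\<^sup>-\<^sup>1 X, g\<^sup>-\<^sup>1 Y)\<close> at \<open>g\<close>. The
  partial derivatives below are local on the interior of the triangle; the boundary is null.
\<close>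
definition simplex_integral ::
  "('g, 'n::finite) lie_group \<Rightarrow>
   ((real \<Rightarrow> complex^'n) \<Rightarrow> (real \<Rightarrow> complex^'n) \<Rightarrow> complex) \<Rightarrow>
   ((nat \<Rightarrow> real) \<Rightarrow> real \<Rightarrow> 'g) \<Rightarrow> complex" where
  "simplex_integral G w \<sigma> =
     integral triangle (\<lambda>(u, v).
       w (\<lambda>\<theta>. left_log_deriv G (\<lambda>r. \<sigma> (triangle_point r v) \<theta>) u)
         (\<lambda>\<theta>. left_log_deriv G (\<lambda>r. \<sigma> (triangle_point u r) \<theta>) v))"

definition chain_integral ::
  "('g, 'n::finite) lie_group \<Rightarrow>
   ((real \<Rightarrow> complex^'n) \<Rightarrow> (real \<Rightarrow> complex^'n) \<Rightarrow> complex) \<Rightarrow>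
   (real \<Rightarrow> 'g) chain \<Rightarrow> complex" where
  "chain_integral G w C =
     (\<Sum>\<sigma>\<in>Poly_Mapping.keys C. of_int (Poly_Mapping.lookup C \<sigma>) * simplex_integral G w \<sigma>)"

text \<open>The form represents a class in \<open>H\<^sup>2(L, 2\<pi>\<i>\<int>)\<close>: its periods over integral 2-cycles lie in \<open>2\<pi>\<i>\<int>\<close>.\<close>
definition integral_class ::
  "('g::topological_space, 'n::finite) lie_group \<Rightarrow>
   ((real \<Rightarrow> complex^'n) \<Rightarrow> (real \<Rightarrow> complex^'n) \<Rightarrow> complex) \<Rightarrow> bool" where
  "integral_class G w \<longleftrightarrow>
     (\<forall>C. smooth_2chain G C \<and> chain_boundary 2 C = 0 \<longrightarrow>
        (\<exists>m::int. chain_integral G w C = 2 * pi * \<i> * of_int m))"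

text \<open>
  \<open>path_in G H P a b\<close>: \<open>P\<close> is a piecewise smooth path in \<open>H\<close> from \<open>a\<close> to \<open>b\<close>, given as the list of
  its smooth pieces. Concatenation of paths is \<open>@\<close>.
\<close>
primrec path_in ::
  "('g::topological_space, 'n::finite) lie_group \<Rightarrow> (real \<Rightarrow> 'g) set \<Rightarrow>
   (real \<Rightarrow> real \<Rightarrow> 'g) list \<Rightarrow> (real \<Rightarrow> 'g) \<Rightarrow> (real \<Rightarrow> 'g) \<Rightarrow> bool" where
  "path_in G H [] a b \<longleftrightarrow> a \<in> H \<and> a = b"
| "path_in G H (p # P) a b \<longleftrightarrow>
     (\<exists>S. open S \<and> {0..1} \<subseteq> S \<and> smooth_family G S p) \<and>
     (\<forall>s\<in>{0..1}. p s \<in> H) \<and> p 0 = a \<and> path_in G H P (p 1) b"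

definition path_chain :: "(real \<Rightarrow> 'l) list \<Rightarrow> 'l chain" where
  "path_chain P = (\<Sum>p\<leftarrow>P. frag_of (simplex1 p))"


section \<open>The \<open>\<mu>\<close>-function and tau functions\<close>

definition big_cell ::
  "('g::topological_space, 'n::finite) lie_group \<Rightarrow> (real \<Rightarrow> 'g) set \<Rightarrow> (real \<Rightarrow> 'g) set \<Rightarrow>
   (real \<Rightarrow> 'g) set" where
  "big_cell G Lp Lm = (Lp <#>\<^bsub>loop_group G\<^esub> Lm) \<inter> (Lm <#>\<^bsub>loop_group G\<^esub> Lp)"

text \<open>
  \<open>z\<close> is the value \<open>exp (\<integral>\<^sub>\<Omega> w)\<close> for some paths \<open>Pp\<close>, \<open>Pm\<close> from the identity to the factors \<open>fp\<close>,
  \<open>fm\<close>, some paths \<open>Qp\<close>, \<open>Qm\<close> from the identity to the factors \<open>gp\<close>, \<open>gm\<close>, and some surface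
  \<open>\<Omega>\<close> with the prescribed oriented boundary. Reversing a path is a minus sign for chains.
  The function \<open>\<mu>\<close> is defined at \<open>g\<close> when there is exactly one such value.
\<close>
definition mu_value ::
  "('g::topological_space, 'n::finite) lie_group \<Rightarrow>
   ((real \<Rightarrow> complex^'n) \<Rightarrow> (real \<Rightarrow> complex^'n) \<Rightarrow> complex) \<Rightarrow>
   (real \<Rightarrow> 'g) set \<Rightarrow> (real \<Rightarrow> 'g) set \<Rightarrow> (real \<Rightarrow> 'g) \<Rightarrow> complex \<Rightarrow> bool" where
  "mu_value G w Lp Lm g z \<longleftrightarrow>
     (\<exists>fp\<in>Lp. \<exists>fm\<in>Lm. \<exists>gp\<in>Lp. \<exists>gm\<in>Lm. \<exists>Pp Pm Qp Qm \<Omega>.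
        g = fp \<otimes>\<^bsub>loop_group G\<^esub> inv\<^bsub>loop_group G\<^esub> fm \<and>
        g = inv\<^bsub>loop_group G\<^esub> gm \<otimes>\<^bsub>loop_group G\<^esub> gp \<and>
        path_in G Lp Pp \<one>\<^bsub>loop_group G\<^esub> fp \<and> path_in G Lm Pm \<one>\<^bsub>loop_group G\<^esub> fm \<and>
        path_in G Lp Qp \<one>\<^bsub>loop_group G\<^esub> gp \<and> path_in G Lm Qm \<one>\<^bsub>loop_group G\<^esub> gm \<and>
        smooth_2chain G \<Omega> \<and>
        chain_boundary 2 \<Omega> =
          path_chain (Pp @ map (\<lambda>p s. fp \<otimes>\<^bsub>loop_group G\<^esub> inv\<^bsub>loop_group G\<^esub> (p s)) Pm)
          - path_chain (map (\<lambda>q s. inv\<^bsub>loop_group G\<^esub> (q s)) Qm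
                        @ map (\<lambda>q s. inv\<^bsub>loop_group G\<^esub> gm \<otimes>\<^bsub>loop_group G\<^esub> q s) Qp) \<and>
        z = exp (chain_integral G w \<Omega>))"

definition mu ::
  "('g::topological_space, 'n::finite) lie_group \<Rightarrow>
   ((real \<Rightarrow> complex^'n) \<Rightarrow> (real \<Rightarrow> complex^'n) \<Rightarrow> complex) \<Rightarrow>
   (real \<Rightarrow> 'g) set \<Rightarrow> (real \<Rightarrow> 'g) set \<Rightarrow> (real \<Rightarrow> 'g) \<Rightarrow> complex" where
  "mu G w Lp Lm g = (THE z. mu_value G w Lp Lm g z)"

text \<open>
  The times \<open>t\<^sub>1, \<dots>, t\<^sub>N\<close> are the components of a vector indexed by a type with \<open>N\<close> elements; \<open>ix\<close>
  is the bijection from that type to \<open>{1..N}\<close>.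
\<close>
definition vacuum_frame ::
  "('g::topological_space, 'n::finite) lie_group \<Rightarrow> (nat \<Rightarrow> real \<Rightarrow> complex^'n) \<Rightarrow>
   ('N::finite \<Rightarrow> nat) \<Rightarrow> real^'N \<Rightarrow> real \<Rightarrow> 'g" where
  "vacuum_frame G J ix t = loop_exp G (\<lambda>\<theta>. \<Sum>j\<in>UNIV. (t $ j) *\<^sub>R J (ix j) \<theta>)"

definition tau ::
  "('g::topological_space, 'n::finite) lie_group \<Rightarrow>
   ((real \<Rightarrow> complex^'n) \<Rightarrow> (real \<Rightarrow> complex^'n) \<Rightarrow> complex) \<Rightarrow>
   (real \<Rightarrow> 'g) set \<Rightarrow> (real \<Rightarrow> 'g) set \<Rightarrow> (nat \<Rightarrow> real \<Rightarrow> complex^'n) \<Rightarrow>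
   ('N::finite \<Rightarrow> nat) \<Rightarrow> (real \<Rightarrow> 'g) \<Rightarrow> real^'N \<Rightarrow> complex" where
  "tau G w Lp Lm J ix f t =
     mu G w Lp Lm (vacuum_frame G J ix t \<otimes>\<^bsub>loop_group G\<^esub> inv\<^bsub>loop_group G\<^esub> f)"

definition log_branch_on :: "('a::topological_space) set \<Rightarrow> ('a \<Rightarrow> complex) \<Rightarrow> ('a \<Rightarrow> complex) \<Rightarrow> bool" where
  "log_branch_on W \<tau> l \<longleftrightarrow> continuous_on W l \<and> (\<forall>t\<in>W. exp (l t) = \<tau> t)"

definition has_partial_derivative ::
  "(real^'N::finite \<Rightarrow> complex) \<Rightarrow> 'N \<Rightarrow> complex \<Rightarrow> real^'N \<Rightarrow> bool" where
  "has_partial_derivative h j D t \<longleftrightarrow>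
     ((\<lambda>s. h (t + s *\<^sub>R axis j 1)) has_vector_derivative D) (at 0)"

end

theory Submission
  imports Defs
begin

text \<open>
  For \<open>\<zeta>\<close> in the loop algebra and a path \<open>q(r)\<close> in the loop group, the Maurer--Cartan equation and an
  integration by parts give \<open>w(Ad(q\<^sup>-\<^sup>1) \<zeta>, q\<^sup>-\<^sup>1 q') = - d/dr \<langle>\<zeta>, (\<partial>\<^sub>\<lambda>q) q\<^sup>-\<^sup>1\<rangle>\<^sub>-\<^sub>1\<close>. A surface that computes
  \<open>\<mu>(V(t) f\<^sup>-\<^sup>1)\<close> can be moved along a segment in \<open>t\<close> by attaching pieces of the form \<open>h(s) q(r)\<close>, on which
  the left invariant form is therefore integrated explicitly. Since \<open>M\<^sub>t M\<^sup>-\<^sup>1\<close> and \<open>E\<^sub>t E\<^sup>-\<^sup>1\<close> are, up to sign,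
  the two components of \<open>M J M\<^sup>-\<^sup>1\<close>, and \<open>\<langle>\<eta>, (\<partial>\<^sub>\<lambda>E) E\<^sup>-\<^sup>1\<rangle>\<^sub>-\<^sub>1 = 0\<close> for \<open>\<eta>\<close> in \<open>\<L>\<^sub>+\<close> by compatibility, the result
  is that \<open>\<partial>\<^sub>j ln \<tau>\<close> differs by a constant from \<open>\<langle>M J\<^sub>j M\<^sup>-\<^sup>1, (\<partial>\<^sub>\<lambda>E) E\<^sup>-\<^sup>1\<rangle>\<^sub>-\<^sub>1 = \<langle>f J\<^sub>j f\<^sup>-\<^sup>1, E\<^sup>-\<^sup>1 \<partial>\<^sub>\<lambda>E\<rangle>\<^sub>-\<^sub>1\<close>, in
  which only \<open>E\<close> depends on \<open>t\<close>. Its derivative follows from the Maurer--Cartan equation once more.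
\<close>

section \<open>Calculus of smooth maps\<close>

text \<open>\<open>mu\<close> is a description over all admissible paths and surfaces, so nothing is
  known beforehand about the regularity of \<tau> in t. The way out is an exact formula for
  \<tau>(t0 + X) / \<tau>(t0): unique existence of the value at t0 supplies one surface together
  with paths to all four factors, and unique existence at t0 + X identifies the value of the
  extended surface with \<tau>. Surfaces are singular chains whose boundaries must agree as chains,
  not merely up to reparametrization; hence attached rectangles are cut into simplices, and V f^{-1}
  = M^{-1} E is used as an equality of edges. The form is only ad-invariant and the group may be
  disconnected, so every use of Ad-invariance is tied to a path from the identity; such paths come
  with the surface. The exponential map is a description too: one-parameter subgroups of an abstract
  group are constructed by Picard iteration in one chart. First-order calculus is done in the chart
  at the identity, to which logarithmic derivatives translate back.\<close>

lemma times_differentiable_on_cong: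
  assumes "open S" and "\<And>x. x \<in> S \<Longrightarrow> f x = g x" and "times_differentiable_on k S f"
  shows "times_differentiable_on k S g"
  using assms(2,3)
proof (induction k arbitrary: f g)
  case 0
  then show ?case using continuous_on_cong[of S S f g] by simp
next
  case (Suc k)
  have D: "frechet_derivative g (at x) = frechet_derivative f (at x)" "g differentiable (at x)"
    if "x \<in> S" for x
  proof -
    have d: "f differentiable (at x)" using Suc.prems that by simp
    show "frechet_derivative g (at x) = frechet_derivative f (at x)"
      using frechet_derivative_transform_within_open[OF d assms(1) that, of g] Suc.prems by simp
    show "g differentiable (at x)"
      using d assms(1) that Suc.prems(1) unfolding differentiable_def
      by (meson has_derivative_transform_within_open)
  qed
  have "times_differentiable_on k S (\<lambda>x. frechet_derivative g (at x) v)" for v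
    by (rule Suc.IH[of "\<lambda>x. frechet_derivative f (at x) v"]) (use Suc.prems D in auto)
  then show ?case using D by simp
qed

lemma times_differentiable_on_subset:
  "times_differentiable_on k S f \<Longrightarrow> T \<subseteq> S \<Longrightarrow> times_differentiable_on k T f"
  by (induction k arbitrary: f) (auto intro: continuous_on_subset)

lemma times_differentiable_on_SucD:
  "times_differentiable_on (Suc k) S f \<Longrightarrow> times_differentiable_on k S f"
proof (induction k arbitrary: f)
  case 0
  then show ?case
    by (simp add: continuous_at_imp_continuous_on differentiable_imp_continuous_within)
next
  case (Suc k)
  then show ?case by (simp only: times_differentiable_on.simps(2)) blast
qed

lemma times_differentiable_on_local:
  assumes "\<And>x. x \<in> S \<Longrightarrow> \<exists>T. open T \<and> x \<in> T \<and> times_differentiable_on k T f"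
  shows "times_differentiable_on k S f"
  using assms
proof (induction k arbitrary: f)
  case 0
  have "continuous (at x) f" if "x \<in> S" for x
    using 0[OF that] by (auto simp: continuous_on_eq_continuous_at)
  then show ?case by (simp add: continuous_at_imp_continuous_on)
next
  case (Suc k)
  have "f differentiable (at x)" if "x \<in> S" for x using Suc.prems[OF that] by auto
  moreover have "times_differentiable_on k S (\<lambda>x. frechet_derivative f (at x) v)" for v
    by (rule Suc.IH) (use Suc.prems in fastforce)
  ultimately show ?case by simp
qed

text \<open>Lets a proof name the derivative. The recursion in
  \<open>times_differentiable_on\<close> runs through \<open>frechet_derivative\<close>, which on an
  open set is forced to be the given f'.\<close>

lemma times_differentiable_on_SucI:
  assumes "open S" and "\<And>x. x \<in> S \<Longrightarrow> (f has_derivative f' x) (at x)"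
    and "\<And>v. times_differentiable_on k S (\<lambda>x. f' x v)"
  shows "times_differentiable_on (Suc k) S f"
proof -
  have "frechet_derivative f (at x) = f' x" if "x \<in> S" for x
    using assms(2)[OF that] frechet_derivative_at by metis
  then have "times_differentiable_on k S (\<lambda>x. frechet_derivative f (at x) v)" for v
    by (intro times_differentiable_on_cong[OF assms(1) _ assms(3)[of v]]) simp
  then show ?thesis using assms(2) by (auto simp: differentiable_def)
qed

lemma times_differentiable_on_SucE:
  assumes "times_differentiable_on (Suc k) S f" and "x \<in> S"
  shows "(f has_derivative frechet_derivative f (at x)) (at x)"
  using assms by (simp add: frechet_derivative_works)

lemma times_differentiable_on_const: "open S \<Longrightarrow> times_differentiable_on k S (\<lambda>x. c)"
proof (induction k arbitrary: c)
  case (Suc k)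
  show ?case
    by (rule times_differentiable_on_SucI[where f' = "\<lambda>x v. 0"]) (use Suc in auto)
qed simp

lemma times_differentiable_on_bounded_linear:
  assumes "open S" and "bounded_linear h"
  shows "times_differentiable_on k S h"
proof (cases k)
  case 0
  then show ?thesis using assms(2) by (simp add: linear_continuous_on)
next
  case (Suc k')
  show ?thesis unfolding Suc
    by (rule times_differentiable_on_SucI[where f' = "\<lambda>x. h"])
      (use assms in \<open>auto intro: bounded_linear_imp_has_derivative times_differentiable_on_const\<close>)
qed

lemma times_differentiable_on_add:
  assumes "open S" and "times_differentiable_on k S f" and "times_differentiable_on k S g"
  shows "times_differentiable_on k S (\<lambda>x. f x + g x)"
  using assms(2,3)
proof (induction k arbitrary: f g)
  case 0
  then show ?case by (auto intro: continuous_on_add)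
next
  case (Suc k)
  have "times_differentiable_on k S (\<lambda>x. frechet_derivative f (at x) v)"
    "times_differentiable_on k S (\<lambda>x. frechet_derivative g (at x) v)" for v
    using Suc.prems by simp_all
  then show ?case
    by (intro times_differentiable_on_SucI[OF assms(1), where
          f' = "\<lambda>x v. frechet_derivative f (at x) v + frechet_derivative g (at x) v"]
          has_derivative_add times_differentiable_on_SucE[OF Suc.prems(1)]
          times_differentiable_on_SucE[OF Suc.prems(2)] Suc.IH)
qed

lemma times_differentiable_on_sum:
  assumes "open S" and "\<And>i. i \<in> A \<Longrightarrow> times_differentiable_on k S (f i)"
  shows "times_differentiable_on k S (\<lambda>x. \<Sum>i\<in>A. f i x)"
  using assms(2)
  by (induction A rule: infinite_finite_induct)
    (auto intro: times_differentiable_on_const times_differentiable_on_add assms(1))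

lemma times_differentiable_on_bilinear:
  assumes "open S" and "bounded_bilinear p"
    and "times_differentiable_on k S f" and "times_differentiable_on k S g"
  shows "times_differentiable_on k S (\<lambda>x. p (f x) (g x))"
  using assms(3,4)
proof (induction k arbitrary: f g)
  case 0
  then show ?case using bounded_bilinear.continuous_on[OF assms(2)] by auto
next
  case (Suc k)
  have "times_differentiable_on k S (\<lambda>x. frechet_derivative f (at x) v)"
    "times_differentiable_on k S (\<lambda>x. frechet_derivative g (at x) v)" for v
    using Suc.prems by simp_all
  then show ?case
    by (intro times_differentiable_on_SucI[OF assms(1), where
          f' = "\<lambda>x v. p (f x) (frechet_derivative g (at x) v) + p (frechet_derivative f (at x) v) (g x)"]
          bounded_bilinear.FDERIV[OF assms(2)] times_differentiable_on_SucE[OF Suc.prems(1)]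
          times_differentiable_on_SucE[OF Suc.prems(2)] times_differentiable_on_add Suc.IH assms(1)
          times_differentiable_on_SucD[OF Suc.prems(1)] times_differentiable_on_SucD[OF Suc.prems(2)])
qed

lemma times_differentiable_on_Pair:
  assumes "open S" and "times_differentiable_on k S f" and "times_differentiable_on k S g"
  shows "times_differentiable_on k S (\<lambda>x. (f x, g x))"
  using assms(2,3)
proof (induction k arbitrary: f g)
  case 0
  then show ?case by (auto intro: continuous_on_Pair)
next
  case (Suc k)
  have "times_differentiable_on k S (\<lambda>x. frechet_derivative f (at x) v)"
    "times_differentiable_on k S (\<lambda>x. frechet_derivative g (at x) v)" for v
    using Suc.prems by simp_all
  then show ?case
    by (intro times_differentiable_on_SucI[OF assms(1), where
          f' = "\<lambda>x v. (frechet_derivative f (at x) v, frechet_derivative g (at x) v)"]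
          has_derivative_Pair times_differentiable_on_SucE[OF Suc.prems(1)]
          times_differentiable_on_SucE[OF Suc.prems(2)] Suc.IH)
qed

text \<open>The recursion for higher derivatives differentiates in a fixed direction v only. A
  derivative taken in a direction that moves with the point is split by this expansion into fixed
  basis directions with varying coefficients.\<close>

lemma linear_euclidean_expansion:
  fixes h :: "'a::euclidean_space \<Rightarrow> 'b::real_normed_vector"
  assumes "linear h"
  shows "h v = (\<Sum>i\<in>Basis. (v \<bullet> i) *\<^sub>R h i)"
proof -
  have "h v = h (\<Sum>i\<in>Basis. (v \<bullet> i) *\<^sub>R i)" by (simp add: euclidean_representation)
  also have "\<dots> = (\<Sum>i\<in>Basis. (v \<bullet> i) *\<^sub>R h i)"
    by (simp add: linear_sum[OF assms] linear_scale[OF assms])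
  finally show ?thesis .
qed

lemma times_differentiable_on_compose:
  fixes f :: "'b::euclidean_space \<Rightarrow> 'c::real_normed_vector"
  assumes "open S" and "times_differentiable_on k T f" and "times_differentiable_on k S g"
    and "g ` S \<subseteq> T"
  shows "times_differentiable_on k S (\<lambda>x. f (g x))"
  using assms(2,3)
proof (induction k arbitrary: f)
  case 0
  then show ?case using assms(4) by (auto intro: continuous_on_compose2)
next
  case (Suc k)
  have g: "(g has_derivative frechet_derivative g (at x)) (at x)" if "x \<in> S" for x
    using times_differentiable_on_SucE[OF Suc.prems(2) that] .
  have f: "(f has_derivative frechet_derivative f (at (g x))) (at (g x))" if "x \<in> S" for x
    using times_differentiable_on_SucE[OF Suc.prems(1), of "g x"] assms(4) that by blast
  have "((\<lambda>x. f (g x)) has_derivative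
      (\<lambda>v. \<Sum>i\<in>Basis. (frechet_derivative g (at x) v \<bullet> i) *\<^sub>R frechet_derivative f (at (g x)) i)) (at x)"
    if "x \<in> S" for x
    using has_derivative_compose[OF g[OF that] f[OF that]]
    by (subst (asm) linear_euclidean_expansion[OF has_derivative_linear[OF f[OF that]]])
  moreover have "times_differentiable_on k S
      (\<lambda>x. \<Sum>i\<in>Basis. (frechet_derivative g (at x) v \<bullet> i) *\<^sub>R frechet_derivative f (at (g x)) i)" for v
  proof (intro times_differentiable_on_sum assms(1)
      times_differentiable_on_bilinear[OF _ bounded_bilinear_scaleR]
      times_differentiable_on_bilinear[OF _ bounded_bilinear_inner] times_differentiable_on_const Suc.IH)
    show "times_differentiable_on k S (\<lambda>x. frechet_derivative g (at x) v)"
      using Suc.prems(2) by simp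
    show "times_differentiable_on k T (\<lambda>y. frechet_derivative f (at y) i)" for i
      using Suc.prems(1) by simp
    show "times_differentiable_on k S g" using Suc.prems(2) by (rule times_differentiable_on_SucD)
  qed
  ultimately show ?case by (intro times_differentiable_on_SucI[OF assms(1)])
qed

section \<open>Closure properties of smooth maps\<close>

lemma smooth_on_cong: "open S \<Longrightarrow> (\<And>x. x \<in> S \<Longrightarrow> f x = g x) \<Longrightarrow> smooth_on S f \<Longrightarrow> smooth_on S g"
  unfolding smooth_on_def using times_differentiable_on_cong by blast

lemma smooth_on_subset: "smooth_on S f \<Longrightarrow> T \<subseteq> S \<Longrightarrow> smooth_on T f"
  unfolding smooth_on_def using times_differentiable_on_subset by blast

lemma smooth_on_local:
  assumes "\<And>x. x \<in> S \<Longrightarrow> \<exists>T. open T \<and> x \<in> T \<and> smooth_on T f"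
  shows "smooth_on S f"
  unfolding smooth_on_def
proof
  show "times_differentiable_on k S f" for k
    by (rule times_differentiable_on_local) (use assms in \<open>auto simp: smooth_on_def\<close>)
qed

lemma smooth_on_const [intro]: "open S \<Longrightarrow> smooth_on S (\<lambda>x. c)"
  by (simp add: smooth_on_def times_differentiable_on_const)

lemma smooth_on_bounded_linear: "open S \<Longrightarrow> bounded_linear h \<Longrightarrow> smooth_on S h"
  by (simp add: smooth_on_def times_differentiable_on_bounded_linear)

lemma smooth_on_id [intro]: "open S \<Longrightarrow> smooth_on S (\<lambda>x. x)"
  by (intro smooth_on_bounded_linear bounded_linear_ident)

lemma smooth_on_add: "open S \<Longrightarrow> smooth_on S f \<Longrightarrow> smooth_on S g \<Longrightarrow> smooth_on S (\<lambda>x. f x + g x)"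
  by (simp add: smooth_on_def times_differentiable_on_add)

lemma smooth_on_sum:
  "open S \<Longrightarrow> (\<And>i. i \<in> A \<Longrightarrow> smooth_on S (f i)) \<Longrightarrow> smooth_on S (\<lambda>x. \<Sum>i\<in>A. f i x)"
  by (simp add: smooth_on_def times_differentiable_on_sum)

lemma smooth_on_bilinear:
  "open S \<Longrightarrow> bounded_bilinear p \<Longrightarrow> smooth_on S f \<Longrightarrow> smooth_on S g \<Longrightarrow> smooth_on S (\<lambda>x. p (f x) (g x))"
  by (simp add: smooth_on_def times_differentiable_on_bilinear)

lemma smooth_on_Pair:
  "open S \<Longrightarrow> smooth_on S f \<Longrightarrow> smooth_on S g \<Longrightarrow> smooth_on S (\<lambda>x. (f x, g x))"
  by (simp add: smooth_on_def times_differentiable_on_Pair)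

lemma smooth_on_compose:
  fixes f :: "'b::euclidean_space \<Rightarrow> 'c::real_normed_vector"
  shows "open S \<Longrightarrow> smooth_on T f \<Longrightarrow> smooth_on S g \<Longrightarrow> g ` S \<subseteq> T \<Longrightarrow> smooth_on S (\<lambda>x. f (g x))"
  unfolding smooth_on_def using times_differentiable_on_compose by blast

lemma smooth_on_has_derivative:
  assumes "smooth_on S f" and "x \<in> S"
  shows "(f has_derivative frechet_derivative f (at x)) (at x)"
  using assms times_differentiable_on_SucE[of 0 S f x] by (simp only: smooth_on_def)

lemma smooth_on_continuous_on: "smooth_on S f \<Longrightarrow> continuous_on S f"
  unfolding smooth_on_def using times_differentiable_on.simps(1) by blast

lemma smooth_on_derivative: "smooth_on S f \<Longrightarrow> smooth_on S (\<lambda>x. frechet_derivative f (at x) v)"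
  unfolding smooth_on_def using times_differentiable_on.simps(2) by blast

text \<open>For maps that are defined as derivatives in part of the variables: \<open>Ad\<close>,
  \<open>llog\<close> and the left invariant vector field in the chart all have this shape.\<close>

lemma smooth_on_derivative_compose:
  fixes f :: "'b::euclidean_space \<Rightarrow> 'c::real_normed_vector"
  assumes "open S" and "smooth_on T f" and "smooth_on S g" and "smooth_on S v" and "g ` S \<subseteq> T"
  shows "smooth_on S (\<lambda>x. frechet_derivative f (at (g x)) (v x))"
proof -
  have "smooth_on S (\<lambda>x. \<Sum>i\<in>Basis. (v x \<bullet> i) *\<^sub>R frechet_derivative f (at (g x)) i)"
  proof (intro smooth_on_sum smooth_on_bilinear[OF _ bounded_bilinear_scaleR]
      smooth_on_bilinear[OF _ bounded_bilinear_inner] smooth_on_const assms)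
    show "smooth_on S (\<lambda>x. frechet_derivative f (at (g x)) i)" for i
      by (rule smooth_on_compose[OF assms(1) smooth_on_derivative[OF assms(2)] assms(3,5)])
  qed
  then show ?thesis
  proof (rule smooth_on_cong[OF assms(1), rotated])
    fix x assume "x \<in> S"
    then have "linear (frechet_derivative f (at (g x)))"
      using smooth_on_has_derivative[OF assms(2), of "g x"] assms(5) has_derivative_linear by blast
    then show "(\<Sum>i\<in>Basis. (v x \<bullet> i) *\<^sub>R frechet_derivative f (at (g x)) i)
        = frechet_derivative f (at (g x)) (v x)"
      by (rule linear_euclidean_expansion[symmetric])
  qed
qed

lemma smooth_on_fst: "open S \<Longrightarrow> smooth_on S g \<Longrightarrow> smooth_on S (\<lambda>x. fst (g x))"
  for g :: "'a::real_normed_vector \<Rightarrow> 'b::euclidean_space \<times> 'c::euclidean_space"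
  by (rule smooth_on_compose[OF _ smooth_on_bounded_linear[OF open_UNIV bounded_linear_fst]]) auto

lemma smooth_on_snd: "open S \<Longrightarrow> smooth_on S g \<Longrightarrow> smooth_on S (\<lambda>x. snd (g x))"
  for g :: "'a::real_normed_vector \<Rightarrow> 'b::euclidean_space \<times> 'c::euclidean_space"
  by (rule smooth_on_compose[OF _ smooth_on_bounded_linear[OF open_UNIV bounded_linear_snd]]) auto

text \<open>Differentiate \<open>f (r, \<theta>) = f (r, 0) + \<integral> \<partial>\<^sub>\<theta>f\<close> in \<open>r\<close> under the integral sign, and then in \<open>\<theta>\<close>.\<close>
lemma mixed_derivatives_commute:
  fixes f :: "real \<times> real \<Rightarrow> 'b::euclidean_space"
  assumes "open S" and "(0, 0) \<in> S"
    and f1: "\<And>x. x \<in> S \<Longrightarrow> ((\<lambda>r. f (r, snd x)) has_vector_derivative f1 x) (at (fst x))"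
    and f2: "\<And>x. x \<in> S \<Longrightarrow> ((\<lambda>r. f (fst x, r)) has_vector_derivative f2 x) (at (snd x))"
    and f12: "\<And>x. x \<in> S \<Longrightarrow> ((\<lambda>r. f1 (fst x, r)) has_vector_derivative f12 x) (at (snd x))"
    and f21: "\<And>x. x \<in> S \<Longrightarrow> ((\<lambda>r. f2 (r, snd x)) has_vector_derivative f21 x) (at (fst x))"
    and cont: "continuous_on S f21"
  shows "f12 (0, 0) = f21 (0, 0)"
proof -
  obtain e where e: "e > 0" "{-e..e} \<times> {-e..e} \<subseteq> S"
  proof -
    obtain A B where AB: "open A" "open B" "(0::real) \<in> A" "(0::real) \<in> B" "A \<times> B \<subseteq> S"
      using open_prod_elim[OF assms(1,2)] by (metis mem_Sigma_iff)
    obtain a where a: "a > 0" "cball 0 a \<subseteq> A" using AB open_contains_cball by blast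
    obtain b where b: "b > 0" "cball 0 b \<subseteq> B" using AB open_contains_cball by blast
    have "{- min a b..min a b} \<subseteq> cball 0 a" "{- min a b..min a b} \<subseteq> cball 0 b"
      by (auto simp: dist_real_def)
    then have "{- min a b..min a b} \<times> {- min a b..min a b} \<subseteq> S"
      using a b AB by blast
    then show ?thesis using that[of "min a b"] a b by auto
  qed
  have inS: "(r, s) \<in> S" if "\<bar>r\<bar> \<le> e" "\<bar>s\<bar> \<le> e" for r s
    using e(2) that by (auto simp: abs_le_iff)
  have contf2: "continuous_on {-e..e} (\<lambda>s. f21 (r, s))" if "\<bar>r\<bar> \<le> e" for r
    by (rule continuous_on_compose2[OF cont]) (auto intro!: continuous_intros inS that)
  have ftc: "f (r, t) - f (r, 0) = integral {0..t} (\<lambda>s. f2 (r, s))"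
    "(\<lambda>s. f2 (r, s)) integrable_on {0..t}" if "r \<in> {-e..e}" "t \<in> {0..e}" for r t
  proof -
    have "((\<lambda>s. f2 (r, s)) has_integral (f (r, t) - f (r, 0))) {0..t}"
      using f2[OF inS] that by (intro fundamental_theorem_of_calculus) (auto intro: has_vector_derivative_at_within)
    then show "f (r, t) - f (r, 0) = integral {0..t} (\<lambda>s. f2 (r, s))"
      "(\<lambda>s. f2 (r, s)) integrable_on {0..t}" by (auto simp: integral_unique has_integral_integrable)
  qed
  have key: "f1 (0, t) - f1 (0, 0) = integral {0..t} (\<lambda>s. f21 (0, s))" if t: "t \<in> {0..e}" for t
  proof -
    have "((\<lambda>r. integral (cbox 0 t) (\<lambda>s. f2 (r, s))) has_vector_derivative
        integral (cbox 0 t) (\<lambda>s. f21 (0, s))) (at 0 within {-e..e})"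
    proof (rule leibniz_rule_vector_derivative)
      show "((\<lambda>r. f2 (r, s)) has_vector_derivative f21 (r, s)) (at r within {-e..e})"
        if "r \<in> {-e..e}" "s \<in> cbox 0 t" for r s
        using f21[OF inS, of r s] that t by (auto intro: has_vector_derivative_at_within)
      show "(\<lambda>s. f2 (r, s)) integrable_on cbox 0 t" if "r \<in> {-e..e}" for r
        using ftc(2)[of r t] that t by auto
      show "continuous_on ({-e..e} \<times> cbox 0 t) (\<lambda>(r, s). f21 (r, s))"
        using e(2) t by (auto simp: case_prod_eta intro!: continuous_on_subset[OF cont])
    qed (use e in auto)
    then have "((\<lambda>r. f (r, t) - f (r, 0)) has_vector_derivative
        integral {0..t} (\<lambda>s. f21 (0, s))) (at 0 within {-e..e})"
      using has_vector_derivative_transform[of 0 "{-e..e}" "\<lambda>r. f (r, t) - f (r, 0)"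
          "\<lambda>r. integral {0..t} (\<lambda>s. f2 (r, s))", OF _ ftc(1)[OF _ t]] e
      by simp
    moreover have "((\<lambda>r. f (r, t) - f (r, 0)) has_vector_derivative f1 (0, t) - f1 (0, 0)) (at 0 within {-e..e})"
    proof (rule has_vector_derivative_diff)
      show "((\<lambda>r. f (r, t)) has_vector_derivative f1 (0, t)) (at 0 within {-e..e})"
        using f1[OF inS, of 0 t] t e by (simp add: has_vector_derivative_at_within)
      show "((\<lambda>r. f (r, 0)) has_vector_derivative f1 (0, 0)) (at 0 within {-e..e})"
        using f1[OF inS, of 0 0] e by (simp add: has_vector_derivative_at_within)
    qed
    ultimately show ?thesis
      using vector_derivative_unique_within_closed_interval[of "-e" e 0 "\<lambda>r. f (r, t) - f (r, 0)"
          "f1 (0, t) - f1 (0, 0)"] e(1) by simp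
  qed
  \<comment> \<open>The differentiation in t takes place within [0, e]; a one-sided derivative still
    determines \<open>f12 (0, 0)\<close>.\<close>
  have "((\<lambda>t. f1 (0, 0) + integral {0..t} (\<lambda>s. f21 (0, s))) has_vector_derivative 0 + f21 (0, 0)) (at 0 within {0..e})"
    using e contf2[of 0]
    by (intro has_vector_derivative_add has_vector_derivative_const integral_has_vector_derivative)
      (auto intro: continuous_on_subset)
  then have "((\<lambda>t. f1 (0, t)) has_vector_derivative f21 (0, 0)) (at 0 within {0..e})"
    unfolding add_0_left
  proof (rule has_vector_derivative_transform[rotated 2])
    show "f1 (0, t) = f1 (0, 0) + integral {0..t} (\<lambda>s. f21 (0, s))" if "t \<in> {0..e}" for t
      using key[OF that] by (simp only: algebra_simps)
  qed (use e in simp)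
  moreover have "((\<lambda>t. f1 (0, t)) has_vector_derivative f12 (0, 0)) (at 0 within {0..e})"
    using f12[OF inS, of 0 0] e by (simp add: has_vector_derivative_at_within)
  ultimately show ?thesis
    using vector_derivative_unique_within_closed_interval[of 0 e 0 "\<lambda>t. f1 (0, t)"] e(1) by simp
qed

text \<open>Smoothness gives continuity of each partial derivative, not of an operator norm, so
  \<open>onorm\<close> is bounded by the sum of bounds over the basis. Convexity of C is what the
  mean value inequality asks for.\<close>

lemma smooth_on_lipschitz_on_compact:
  fixes F :: "'a::euclidean_space \<Rightarrow> 'b::real_normed_vector"
  assumes "smooth_on S F" and "compact C" and "convex C" and "C \<subseteq> S"
  obtains K where "K \<ge> 0" and "\<And>x y. x \<in> C \<Longrightarrow> y \<in> C \<Longrightarrow> norm (F x - F y) \<le> K * norm (x - y)"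
proof -
  have "\<exists>b\<ge>0. \<forall>x\<in>C. norm (frechet_derivative F (at x) i) \<le> b" for i
  proof -
    have "continuous_on C (\<lambda>x. frechet_derivative F (at x) i)"
      using smooth_on_continuous_on[OF smooth_on_derivative[OF assms(1)]] assms(4) continuous_on_subset by blast
    then have "bounded ((\<lambda>x. frechet_derivative F (at x) i) ` C)"
      using assms(2) compact_continuous_image compact_imp_bounded by blast
    then show ?thesis unfolding bounded_pos by (auto intro: less_imp_le)
  qed
  then obtain b where b: "\<And>i. b i \<ge> 0" "\<And>i x. x \<in> C \<Longrightarrow> norm (frechet_derivative F (at x) i) \<le> b i"
    by metis
  have on: "onorm (frechet_derivative F (at x)) \<le> (\<Sum>i\<in>Basis. b i)" if "x \<in> C" for x
  proof (rule onorm_bound)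
    fix v :: 'a
    have "linear (frechet_derivative F (at x))"
      using smooth_on_has_derivative[OF assms(1)] that assms(4) has_derivative_linear by blast
    then have "norm (frechet_derivative F (at x) v) \<le> (\<Sum>i\<in>Basis. norm ((v \<bullet> i) *\<^sub>R frechet_derivative F (at x) i))"
      using norm_sum[of "\<lambda>i. (v \<bullet> i) *\<^sub>R frechet_derivative F (at x) i" Basis]
        linear_euclidean_expansion[of "frechet_derivative F (at x)" v] by simp
    also have "\<dots> \<le> (\<Sum>i\<in>Basis. norm v * b i)"
      using b that by (intro sum_mono) (auto intro!: mult_mono simp: Basis_le_norm)
    finally show "norm (frechet_derivative F (at x) v) \<le> (\<Sum>i\<in>Basis. b i) * norm v"
      by (simp add: sum_distrib_left mult.commute)
  qed (simp add: b sum_nonneg)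
  show thesis
  proof (rule that)
    show "(\<Sum>i\<in>Basis. b i) \<ge> 0" by (simp add: b sum_nonneg)
    show "norm (F x - F y) \<le> (\<Sum>i\<in>Basis. b i) * norm (x - y)" if "x \<in> C" "y \<in> C" for x y
      by (rule differentiable_bound[OF assms(3) _ on that])
        (use smooth_on_has_derivative[OF assms(1)] assms(4) in \<open>blast intro: has_derivative_at_withinI\<close>)
  qed
qed

text \<open>Picard iteration for the vector field composed with the projection to a closed ball.\<close>
lemma ode_local_existence:
  fixes F :: "'a::euclidean_space \<Rightarrow> 'a"
  assumes "open S" and "smooth_on S F" and "x0 \<in> S"
  obtains d x where "d > 0"
    and "\<And>s. s \<in> {0<..<d} \<Longrightarrow> x s \<in> S \<and> (x has_vector_derivative F (x s)) (at s)"
proof -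
  obtain r where r: "r > 0" "cball x0 r \<subseteq> S" using assms(1,3) open_contains_cball by blast
  define C where "C = cball x0 r"
  have C: "compact C" "convex C" "closed C" "C \<noteq> {}" "C \<subseteq> S" using r by (auto simp: C_def)
  obtain K where K: "K \<ge> 0" "\<And>x y. x \<in> C \<Longrightarrow> y \<in> C \<Longrightarrow> norm (F x - F y) \<le> K * norm (x - y)"
    using smooth_on_lipschitz_on_compact[OF assms(2) C(1,2,5)] by blast
  \<comment> \<open>Projection to a closed convex set is 1-Lipschitz, so H has the constant K on the
    whole space and the iteration cannot leave its domain. H agrees with F as long as the curve
    stays in the ball.\<close>
  define H where "H = (\<lambda>x. F (closest_point C x))"
  have cp: "closest_point C x \<in> C" for x using closest_point_in_set C by blast
  have HK: "norm (H x - H y) \<le> K * norm (x - y)" for x y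
  proof -
    have "norm (H x - H y) \<le> K * norm (closest_point C x - closest_point C y)"
      unfolding H_def by (rule K) (rule cp)+
    also have "\<dots> \<le> K * norm (x - y)"
      using closest_point_lipschitz[OF C(2-4)] K(1) by (intro mult_left_mono) (auto simp: dist_norm)
    finally show ?thesis .
  qed
  have Hcont: "continuous_on UNIV H"
    unfolding H_def using smooth_on_continuous_on[OF assms(2)] continuous_on_closest_point[OF C(2-4)] cp C(5)
    by (auto intro!: continuous_on_compose2[of S F])
  obtain M where M: "M > 0" "\<And>x. norm (H x) \<le> M"
  proof -
    have "bounded (F ` C)"
      using smooth_on_continuous_on[OF assms(2)] C compact_continuous_image compact_imp_bounded
        continuous_on_subset by metis
    then obtain M where "M > 0" "\<forall>y\<in>F ` C. norm y \<le> M" unfolding bounded_pos by blast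
    then show ?thesis using that[of M] cp by (auto simp: H_def)
  qed
  \<comment> \<open>The first bound keeps the curve within distance r of x0, the second makes the
    iteration a contraction with factor 1/2; K + 1 avoids division by zero.\<close>
  define d where "d = min (r / M) (1 / (2 * (K + 1)))"
  have d: "d > 0" "d * M \<le> r" "K * d \<le> 1/2"
  proof -
    show "d > 0" using r M K by (simp add: d_def)
    have "d * M \<le> r / M * M" using M by (intro mult_right_mono) (auto simp: d_def)
    then show "d * M \<le> r" using M by simp
    have "K * d \<le> K * (1 / (2 * (K + 1)))" using K by (intro mult_left_mono) (auto simp: d_def)
    also have "\<dots> \<le> 1/2" using K by (simp add: field_simps)
    finally show "K * d \<le> 1/2" .
  qed
  \<comment> \<open>Clamping the time to [0, d] lets the iteration act on bounded continuous
    functions on the whole line, a complete metric space.\<close>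
  define cl where "cl = (\<lambda>s::real. max 0 (min d s))"
  have cl: "cl s \<in> {0..d}" for s using d(1) by (auto simp: cl_def)
  have Hx: "continuous_on A (\<lambda>r. H (apply_bcontfun x r))" for A and x :: "real \<Rightarrow>\<^sub>C 'a"
    by (rule continuous_on_compose2[OF Hcont]) auto
  have Hi: "(\<lambda>r. H (apply_bcontfun x r)) integrable_on {0..s}" for s and x :: "real \<Rightarrow>\<^sub>C 'a"
    by (intro integrable_continuous_interval Hx)
  define Q where "Q = (\<lambda>(x :: real \<Rightarrow>\<^sub>C 'a) s. x0 + integral {0..cl s} (\<lambda>r. H (apply_bcontfun x r)))"
  have Qb: "norm (Q x s - x0) \<le> d * M" for x s
  proof -
    have "norm (Q x s - x0) \<le> M * (cl s - 0)"
      unfolding Q_def using cl[of s] M(2) Hx by (simp add: integral_bound[of 0 "cl s", simplified])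
    also have "\<dots> \<le> M * d" using cl[of s] M(1) by simp
    finally show ?thesis by (simp add: mult.commute)
  qed
  have Q: "Q x \<in> bcontfun" for x
  proof (rule bcontfun_normI)
    have "continuous_on UNIV (\<lambda>s. integral {0..cl s} (\<lambda>r. H (apply_bcontfun x r)))"
      by (rule continuous_on_compose2[OF indefinite_integral_continuous_1[OF Hi, of d]])
        (use cl in \<open>auto simp: cl_def intro!: continuous_intros\<close>)
    then show "continuous_on UNIV (Q x)" unfolding Q_def by (intro continuous_intros)
    show "norm (Q x s) \<le> norm x0 + d * M" for s
      using Qb[of x s] norm_triangle_ineq4[of "Q x s - x0" "- x0"] by simp
  qed
  define P where "P = (\<lambda>x. Bcontfun (Q x))"
  have P: "apply_bcontfun (P x) = Q x" for x unfolding P_def using Q by (simp add: Bcontfun_inverse)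
  have "dist (P x) (P y) \<le> 1/2 * dist x y" for x y
  proof (rule dist_bound, unfold P)
    fix s
    have "Q x s - Q y s = integral {0..cl s} (\<lambda>r. H (apply_bcontfun x r) - H (apply_bcontfun y r))"
      unfolding Q_def by (simp add: integral_diff Hi)
    also have "norm \<dots> \<le> K * dist x y * (cl s - 0)"
    proof (rule integral_bound)
      fix t
      have "norm (H (apply_bcontfun x t) - H (apply_bcontfun y t)) \<le> K * norm (apply_bcontfun x t - apply_bcontfun y t)"
        by (rule HK)
      also have "\<dots> \<le> K * dist x y"
        using dist_bounded[of x t y] K(1) by (intro mult_left_mono) (auto simp: dist_norm)
      finally show "norm (H (apply_bcontfun x t) - H (apply_bcontfun y t)) \<le> K * dist x y" .
    qed (use cl in \<open>auto intro!: continuous_intros Hx\<close>)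
    also have "\<dots> \<le> K * dist x y * d" using cl[of s] K(1) by (intro mult_left_mono) auto
    also have "\<dots> = (K * d) * dist x y" by simp
    also have "\<dots> \<le> 1/2 * dist x y" using d(3) by (intro mult_right_mono) auto
    finally show "dist (Q x s) (Q y s) \<le> 1/2 * dist x y" by (simp add: dist_norm)
  qed
  then obtain x where x: "P x = x" using banach_fix_type[of "1/2" P] by auto
  then have xQ: "apply_bcontfun x = Q x" using P by metis
  show thesis
  proof (rule that[OF d(1), of "Q x"])
    fix s assume s: "s \<in> {0<..<d}"
    have "((\<lambda>u. integral {0..u} (\<lambda>r. H (apply_bcontfun x r))) has_vector_derivative H (apply_bcontfun x s)) (at s within {0..d})"
      using integral_has_vector_derivative[OF Hx, of s 0 d x] s by simp
    then have "((\<lambda>u. integral {0..u} (\<lambda>r. H (apply_bcontfun x r))) has_vector_derivative H (apply_bcontfun x s)) (at s)"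
      using s at_within_Icc_at[of 0 s d] by simp
    then have "((\<lambda>u. x0 + integral {0..u} (\<lambda>r. H (apply_bcontfun x r))) has_vector_derivative 0 + H (apply_bcontfun x s)) (at s)"
      by (intro has_vector_derivative_add has_vector_derivative_const)
    then have "(Q x has_vector_derivative 0 + H (apply_bcontfun x s)) (at s)"
      by (rule has_vector_derivative_transform_within_open[where S = "{0<..<d}"])
        (use s in \<open>auto simp: Q_def cl_def\<close>)
    moreover have inC: "Q x s \<in> C"
      using Qb[of x s] d(2) by (simp add: C_def dist_norm norm_minus_commute)
    moreover have "H (apply_bcontfun x s) = F (Q x s)"
      using closest_point_self[OF inC] by (simp add: H_def xQ)
    ultimately show "Q x s \<in> S \<and> (Q x has_vector_derivative F (Q x s)) (at s)"
      using C(5) by auto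
  qed
qed

lemma smooth_on_has_vector_derivative:
  assumes "smooth_on S x" and "s \<in> S"
  shows "(x has_vector_derivative frechet_derivative x (at s) 1) (at s)"
proof -
  have D: "(x has_derivative frechet_derivative x (at s)) (at s)"
    using smooth_on_has_derivative assms by blast
  moreover have "frechet_derivative x (at s) = (\<lambda>r. r *\<^sub>R frechet_derivative x (at s) 1)"
  proof
    show "frechet_derivative x (at s) r = r *\<^sub>R frechet_derivative x (at s) 1" for r
      using linear_scale[OF has_derivative_linear[OF D], of r 1] by (simp only: real_scaleR_def mult_1_right)
  qed
  ultimately show ?thesis unfolding has_vector_derivative_def by (rule has_derivative_eq_rhs)
qed

text \<open>Bootstrap: if x is k times differentiable, so is its derivative F (x s), and x gains one
  order.\<close>

lemma smooth_on_ode_solution: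
  fixes F :: "'a::euclidean_space \<Rightarrow> 'a"
  assumes "open T" and "smooth_on S F"
    and "\<And>s. s \<in> T \<Longrightarrow> x s \<in> S \<and> (x has_vector_derivative F (x s)) (at s)"
  shows "smooth_on T x"
  unfolding smooth_on_def
proof
  show "times_differentiable_on k T x" for k
  proof (induction k)
    case 0
    then show ?case
      using assms(3) has_vector_derivative_continuous by (fastforce intro: continuous_at_imp_continuous_on)
  next
    case (Suc k)
    have "times_differentiable_on k T (\<lambda>s. F (x s))"
      by (rule times_differentiable_on_compose[OF assms(1) _ Suc, of S])
        (use assms(2,3) in \<open>auto simp: smooth_on_def\<close>)
    then have "times_differentiable_on k T (\<lambda>s. v *\<^sub>R F (x s))" for v
      by (intro times_differentiable_on_bilinear[OF assms(1) bounded_bilinear_scaleR]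
          times_differentiable_on_const assms(1))
    then show ?case
      by (intro times_differentiable_on_SucI[OF assms(1), where f' = "\<lambda>s v. v *\<^sub>R F (x s)"])
        (use assms(3) in \<open>auto simp: has_vector_derivative_def\<close>)
  qed
qed

section \<open>Calculus on a Lie group\<close>

lemma linear_real_eq: "linear h \<Longrightarrow> h r = r *\<^sub>R h 1" for h :: "real \<Rightarrow> 'b::real_normed_vector"
  using linear_scale[of h r 1] by (simp only: real_scaleR_def mult_1_right)

text \<open>The left and right logarithmic derivatives \<open>F\<^sup>-\<^sup>1 dF\<close> and \<open>dF F\<^sup>-\<^sup>1\<close>.\<close>
definition llog ::
  "('g, 'n::finite) lie_group \<Rightarrow> ('a::real_normed_vector \<Rightarrow> 'g) \<Rightarrow> 'a \<Rightarrow> 'a \<Rightarrow> complex^'n" where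
  "llog G F x = frechet_derivative (\<lambda>y. echart G (inv\<^bsub>G\<^esub> (F x) \<otimes>\<^bsub>G\<^esub> F y)) (at x)"

definition rlog ::
  "('g, 'n::finite) lie_group \<Rightarrow> ('a::real_normed_vector \<Rightarrow> 'g) \<Rightarrow> 'a \<Rightarrow> 'a \<Rightarrow> complex^'n" where
  "rlog G F x = frechet_derivative (\<lambda>y. echart G (F y \<otimes>\<^bsub>G\<^esub> inv\<^bsub>G\<^esub> (F x))) (at x)"

locale lie =
  fixes G :: "('g::{t2_space,second_countable_topology}, 'n::finite) lie_group" (structure)
  assumes lie: "complex_lie_group G"
begin

abbreviation "ch \<equiv> echart G"
abbreviation "ich \<equiv> inv_into (edom G) (echart G)"
abbreviation "e0 \<equiv> echart G \<one>"

lemma group: "group G" and carrier [simp]: "carrier G = UNIV"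
  using lie unfolding complex_lie_group_def by auto

lemma mult_assoc: "a \<otimes> b \<otimes> c = a \<otimes> (b \<otimes> c)"
  and mult_one [simp]: "\<one> \<otimes> a = a" "a \<otimes> \<one> = a"
  and mult_inv [simp]: "inv a \<otimes> a = \<one>" "a \<otimes> inv a = \<one>"
  and inv_inv [simp]: "inv (inv a) = a"
  and inv_mult: "inv (a \<otimes> b) = inv b \<otimes> inv a"
  and inv_one [simp]: "inv \<one> = \<one>"
proof -
  interpret group G by (rule group)
  show "a \<otimes> b \<otimes> c = a \<otimes> (b \<otimes> c)" "\<one> \<otimes> a = a" "a \<otimes> \<one> = a" "inv a \<otimes> a = \<one>" "a \<otimes> inv a = \<one>"
    "inv (inv a) = a" "inv (a \<otimes> b) = inv b \<otimes> inv a" "inv \<one> = \<one>"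
    by (auto simp: m_assoc inv_mult_group)
qed

lemma mult_inv_cancel [simp]: "inv a \<otimes> (a \<otimes> b) = b" "a \<otimes> (inv a \<otimes> b) = b"
  by (simp_all flip: mult_assoc)

lemma mult_left_cancel [simp]: "a \<otimes> b = a \<otimes> c \<longleftrightarrow> b = c"
  by (metis mult_inv_cancel(1))

lemma chart:
  assumes "(U, \<phi>) \<in> charts G"
  shows "open U" and "open (\<phi> ` U)" and "inj_on \<phi> U" and "continuous_on U \<phi>"
    and "continuous_on (\<phi> ` U) (inv_into U \<phi>)"
proof -
  have A: "complex_atlas (charts G)" using lie unfolding complex_lie_group_def by blast
  then show "open U" "open (\<phi> ` U)" using assms unfolding complex_atlas_def by auto
  obtain \<psi> where h: "homeomorphism U (\<phi> ` U) \<phi> \<psi>"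
    using A assms unfolding complex_atlas_def by auto
  show inj: "inj_on \<phi> U" using h unfolding homeomorphism_def by (metis inj_onI)
  show "continuous_on U \<phi>" using h by (simp add: homeomorphism_def)
  have "inv_into U \<phi> y = \<psi> y" if "y \<in> \<phi> ` U" for y
    using that h inj by (auto simp: homeomorphism_def)
  then show "continuous_on (\<phi> ` U) (inv_into U \<phi>)"
    using h continuous_on_cong unfolding homeomorphism_def by metis
qed

lemma chart_cover: obtains U \<phi> where "(U, \<phi>) \<in> charts G" and "a \<in> U"
proof -
  have "a \<in> (\<Union>(U, \<phi>)\<in>charts G. U)"
    using lie unfolding complex_lie_group_def complex_atlas_def by simp
  then show thesis using that by auto
qed

lemma chart_transition:
  assumes "(U, \<phi>) \<in> charts G" and "(V, \<psi>) \<in> charts G"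
  shows "smooth_on (\<phi> ` (U \<inter> V)) (\<psi> \<circ> inv_into U \<phi>)"
proof -
  have "\<forall>(U, \<phi>)\<in>charts G. \<forall>(V, \<psi>)\<in>charts G.
      holomorphic_map_on (*s) (*s) (\<phi> ` (U \<inter> V)) (\<psi> \<circ> inv_into U \<phi>)"
    using lie unfolding complex_lie_group_def complex_atlas_def by blast
  from bspec[OF bspec[OF this assms(1), simplified] assms(2)]
  show ?thesis by (simp add: holomorphic_map_on_def)
qed

lemma smooth_mult_in_charts:
  assumes "(U, \<phi>) \<in> charts G" and "(V, \<psi>) \<in> charts G" and "(W, \<rho>) \<in> charts G"
  shows "smooth_on {(x, y). x \<in> \<phi> ` U \<and> y \<in> \<psi> ` V \<and> inv_into U \<phi> x \<otimes> inv_into V \<psi> y \<in> W}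
           (\<lambda>(x, y). \<rho> (inv_into U \<phi> x \<otimes> inv_into V \<psi> y))"
proof -
  have "\<forall>(U, \<phi>)\<in>charts G. \<forall>(V, \<psi>)\<in>charts G. \<forall>(W, \<rho>)\<in>charts G.
        holomorphic_map_on scale_pair (*s)
          {(x, y). x \<in> \<phi> ` U \<and> y \<in> \<psi> ` V \<and> inv_into U \<phi> x \<otimes> inv_into V \<psi> y \<in> W}
          (\<lambda>(x, y). \<rho> (inv_into U \<phi> x \<otimes> inv_into V \<psi> y))"
    using lie unfolding complex_lie_group_def by blast
  from bspec[OF bspec[OF bspec[OF this assms(1), simplified] assms(2), simplified] assms(3)]
  show ?thesis by (simp add: holomorphic_map_on_def)
qed

lemma smooth_inv_in_charts:
  assumes "(U, \<phi>) \<in> charts G" and "(W, \<rho>) \<in> charts G"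
  shows "smooth_on {x \<in> \<phi> ` U. inv (inv_into U \<phi> x) \<in> W} (\<lambda>x. \<rho> (inv (inv_into U \<phi> x)))"
proof -
  have "\<forall>(U, \<phi>)\<in>charts G. \<forall>(W, \<rho>)\<in>charts G.
        holomorphic_map_on (*s) (*s) {x \<in> \<phi> ` U. inv (inv_into U \<phi> x) \<in> W} (\<lambda>x. \<rho> (inv (inv_into U \<phi> x)))"
    using lie unfolding complex_lie_group_def by blast
  from bspec[OF bspec[OF this assms(1), simplified] assms(2)]
  show ?thesis by (simp add: holomorphic_map_on_def)
qed

lemma continuous_mult: "continuous_on S F \<Longrightarrow> continuous_on S H \<Longrightarrow> continuous_on S (\<lambda>x. F x \<otimes> H x)"
proof -
  assume *: "continuous_on S F" "continuous_on S H"
  have "continuous_on UNIV (\<lambda>(a, b). a \<otimes> b)" using lie unfolding complex_lie_group_def by blast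
  from continuous_on_compose2[OF this continuous_on_Pair[OF *]] show ?thesis by simp
qed

lemma continuous_inv: "continuous_on S F \<Longrightarrow> continuous_on S (\<lambda>x. inv (F x))"
proof -
  assume *: "continuous_on S F"
  have "continuous_on UNIV (\<lambda>a. inv a)" using lie unfolding complex_lie_group_def by blast
  from continuous_on_compose2[OF this *] show ?thesis by simp
qed

lemma echart: "(edom G, ch) \<in> charts G" and one_in_edom [simp]: "\<one> \<in> edom G"
  using lie unfolding complex_lie_group_def by auto

lemma edom: "open (edom G)" "open (ch ` edom G)" "inj_on ch (edom G)" "continuous_on (edom G) ch"
  "continuous_on (ch ` edom G) ich"
  using chart[OF echart] by auto

lemma ich_ch [simp]: "a \<in> edom G \<Longrightarrow> ich (ch a) = a"
  using edom(3) by simp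

lemma e0_in [simp]: "e0 \<in> ch ` edom G" by simp

section \<open>Smooth maps into the group\<close>

lemma smooth_map_on_continuous: "smooth_map_on G S F \<Longrightarrow> continuous_on S F"
  by (simp add: smooth_map_on_def)

lemma open_vimage_Int: "open S \<Longrightarrow> continuous_on S F \<Longrightarrow> open U \<Longrightarrow> open (S \<inter> F -` U)"
  for F :: "'a::topological_space \<Rightarrow> 'b::topological_space"
  using continuous_open_preimage by blast

lemma smooth_map_on_subset:
  assumes "smooth_map_on G S F" and "T \<subseteq> S"
  shows "smooth_map_on G T F"
  using assms unfolding smooth_map_on_def
  by (fastforce intro: continuous_on_subset smooth_on_subset)

lemma smooth_map_on_cong:
  assumes "open S" and "\<And>x. x \<in> S \<Longrightarrow> F x = H x" and "smooth_map_on G S F"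
  shows "smooth_map_on G S H"
proof -
  have "S \<inter> F -` U = S \<inter> H -` U" for U using assms(2) by auto
  moreover have "continuous_on S H"
    using assms(2,3) continuous_on_cong[of S S F H] by (auto simp: smooth_map_on_def)
  moreover have "smooth_on (S \<inter> F -` U) (\<phi> \<circ> H)" if "(U, \<phi>) \<in> charts G" for U \<phi>
  proof (rule smooth_on_cong)
    show "open (S \<inter> F -` U)"
      using open_vimage_Int[OF assms(1) smooth_map_on_continuous[OF assms(3)]] chart(1)[OF that] by blast
    show "smooth_on (S \<inter> F -` U) (\<phi> \<circ> F)" using assms(3) that by (auto simp: smooth_map_on_def)
  qed (use assms(2) in auto)
  ultimately show ?thesis by (auto simp: smooth_map_on_def)
qed

lemma smooth_map_on_local:
  assumes "\<And>x. x \<in> S \<Longrightarrow> \<exists>T. open T \<and> x \<in> T \<and> smooth_map_on G T F"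
  shows "smooth_map_on G S F"
  unfolding smooth_map_on_def
proof (intro conjI ballI, goal_cases)
  case 1
  have "continuous (at x) F" if "x \<in> S" for x
    using assms[OF that] by (auto simp: continuous_on_eq_continuous_at smooth_map_on_def)
  then show ?case by (simp add: continuous_at_imp_continuous_on)
next
  case (2 c)
  obtain U \<phi> where c: "c = (U, \<phi>)" by (cases c)
  have "\<exists>T. open T \<and> x \<in> T \<and> smooth_on T (\<phi> \<circ> F)" if x: "x \<in> S \<inter> F -` U" for x
  proof -
    obtain T where T: "open T" "x \<in> T" "smooth_map_on G T F" using assms x by blast
    then have "open (T \<inter> F -` U)" "smooth_on (T \<inter> F -` U) (\<phi> \<circ> F)"
      using open_vimage_Int[OF T(1) smooth_map_on_continuous[OF T(3)]] chart(1) 2 c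
      by (auto simp: smooth_map_on_def)
    then show ?thesis using T x by blast
  qed
  then have "smooth_on (S \<inter> F -` U) (\<phi> \<circ> F)" by (rule smooth_on_local)
  then show ?case using c by simp
qed

lemma smooth_map_on_chartI:
  fixes F :: "'a::real_normed_vector \<Rightarrow> 'g"
  assumes "open S" and "(U, \<phi>) \<in> charts G" and "F ` S \<subseteq> U" and "smooth_on S (\<lambda>x. \<phi> (F x))"
  shows "smooth_map_on G S F"
proof -
  have eq: "inv_into U \<phi> (\<phi> (F x)) = F x" if "x \<in> S" for x
    using assms(3) chart(3)[OF assms(2)] that by auto
  have "continuous_on S (\<lambda>x. inv_into U \<phi> (\<phi> (F x)))"
    by (rule continuous_on_compose2[OF chart(5)[OF assms(2)] smooth_on_continuous_on[OF assms(4)]])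
      (use assms(3) in auto)
  then have cont: "continuous_on S F" by (rule continuous_on_eq) (rule eq)
  have "smooth_on (S \<inter> F -` V) (\<psi> \<circ> F)" if V: "(V, \<psi>) \<in> charts G" for V \<psi>
  proof -
    have op: "open (S \<inter> F -` V)" using open_vimage_Int[OF assms(1) cont chart(1)[OF V]] .
    have "smooth_on (S \<inter> F -` V) (\<lambda>x. (\<psi> \<circ> inv_into U \<phi>) (\<phi> (F x)))"
      by (rule smooth_on_compose[OF op chart_transition[OF assms(2) V]])
        (use assms(3) smooth_on_subset[OF assms(4)] in auto)
    then show ?thesis by (rule smooth_on_cong[OF op, rotated]) (use eq in auto)
  qed
  with cont show ?thesis by (auto simp: smooth_map_on_def)
qed

lemma smooth_map_on_chartD:
  assumes "smooth_map_on G S F" and "(U, \<phi>) \<in> charts G" and "F ` S \<subseteq> U"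
  shows "smooth_on S (\<lambda>x. \<phi> (F x))"
proof -
  have "smooth_on (S \<inter> F -` U) (\<phi> \<circ> F)" using assms by (auto simp: smooth_map_on_def)
  moreover have "S \<inter> F -` U = S" using assms(3) by auto
  ultimately show ?thesis by (simp add: o_def)
qed

lemma smooth_map_on_mult:
  assumes S: "open S" and F: "smooth_map_on G S F" and H: "smooth_map_on G S H"
  shows "smooth_map_on G S (\<lambda>x. F x \<otimes> H x)"
proof (rule smooth_map_on_local)
  fix x assume x: "x \<in> S"
  obtain U \<phi> where U: "(U, \<phi>) \<in> charts G" "F x \<in> U" by (rule chart_cover)
  obtain V \<psi> where V: "(V, \<psi>) \<in> charts G" "H x \<in> V" by (rule chart_cover)
  obtain W \<rho> where W: "(W, \<rho>) \<in> charts G" "F x \<otimes> H x \<in> W" by (rule chart_cover)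
  define T where "T = (S \<inter> F -` U) \<inter> (S \<inter> H -` V) \<inter> (S \<inter> (\<lambda>x. F x \<otimes> H x) -` W)"
  have T: "open T" "x \<in> T" "T \<subseteq> S" "F ` T \<subseteq> U" "H ` T \<subseteq> V" "(\<lambda>x. F x \<otimes> H x) ` T \<subseteq> W"
    using U V W x open_vimage_Int[OF S smooth_map_on_continuous[OF F] chart(1)[OF U(1)]]
      open_vimage_Int[OF S smooth_map_on_continuous[OF H] chart(1)[OF V(1)]]
      open_vimage_Int[OF S continuous_mult[OF smooth_map_on_continuous[OF F] smooth_map_on_continuous[OF H]]
        chart(1)[OF W(1)]] unfolding T_def by (blast intro: open_Int)+
  have sm: "smooth_on T (\<lambda>x. (\<phi> (F x), \<psi> (H x)))"
    by (intro smooth_on_Pair T smooth_map_on_chartD[OF smooth_map_on_subset[OF F T(3)] U(1)]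
        smooth_map_on_chartD[OF smooth_map_on_subset[OF H T(3)] V(1)])
  have eq: "inv_into U \<phi> (\<phi> (F x)) = F x" "inv_into V \<psi> (\<psi> (H x)) = H x" if "x \<in> T" for x
    using T that chart(3)[OF U(1)] chart(3)[OF V(1)] by auto
  have "smooth_on T (\<lambda>x. (\<lambda>(a, b). \<rho> (inv_into U \<phi> a \<otimes> inv_into V \<psi> b)) (\<phi> (F x), \<psi> (H x)))"
    by (rule smooth_on_compose[OF T(1) smooth_mult_in_charts[OF U(1) V(1) W(1)] sm])
      (use T eq in auto)
  then have "smooth_on T (\<lambda>x. \<rho> (F x \<otimes> H x))"
    by (rule smooth_on_cong[OF T(1), rotated]) (simp add: eq)
  then show "\<exists>T. open T \<and> x \<in> T \<and> smooth_map_on G T (\<lambda>x. F x \<otimes> H x)"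
    using smooth_map_on_chartI[OF T(1) W(1) T(6)] T by blast
qed

lemma smooth_map_on_inv:
  assumes S: "open S" and F: "smooth_map_on G S F"
  shows "smooth_map_on G S (\<lambda>x. inv (F x))"
proof (rule smooth_map_on_local)
  fix x assume x: "x \<in> S"
  obtain U \<phi> where U: "(U, \<phi>) \<in> charts G" "F x \<in> U" by (rule chart_cover)
  obtain W \<rho> where W: "(W, \<rho>) \<in> charts G" "inv (F x) \<in> W" by (rule chart_cover)
  define T where "T = (S \<inter> F -` U) \<inter> (S \<inter> (\<lambda>x. inv (F x)) -` W)"
  have T: "open T" "x \<in> T" "T \<subseteq> S" "F ` T \<subseteq> U" "(\<lambda>x. inv (F x)) ` T \<subseteq> W"
    using U W x open_vimage_Int[OF S smooth_map_on_continuous[OF F] chart(1)[OF U(1)]]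
      open_vimage_Int[OF S continuous_inv[OF smooth_map_on_continuous[OF F]] chart(1)[OF W(1)]]
    unfolding T_def by (blast intro: open_Int)+
  have sm: "smooth_on T (\<lambda>x. \<phi> (F x))"
    by (intro T smooth_map_on_chartD[OF smooth_map_on_subset[OF F T(3)] U(1)])
  have eq: "inv_into U \<phi> (\<phi> (F x)) = F x" if "x \<in> T" for x
    using T that chart(3)[OF U(1)] by auto
  have "smooth_on T (\<lambda>x. \<rho> (inv (inv_into U \<phi> (\<phi> (F x)))))"
    by (rule smooth_on_compose[OF T(1) smooth_inv_in_charts[OF U(1) W(1)] sm]) (use T eq in auto)
  then have "smooth_on T (\<lambda>x. \<rho> (inv (F x)))"
    by (rule smooth_on_cong[OF T(1), rotated]) (simp add: eq)
  then show "\<exists>T. open T \<and> x \<in> T \<and> smooth_map_on G T (\<lambda>x. inv (F x))"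
    using smooth_map_on_chartI[OF T(1) W(1) T(5)] T by blast
qed

lemma smooth_map_on_const [intro]: "open S \<Longrightarrow> smooth_map_on G S (\<lambda>x. a)"
proof -
  assume S: "open S"
  obtain U \<phi> where "(U, \<phi>) \<in> charts G" "a \<in> U" by (rule chart_cover)
  then show ?thesis using smooth_map_on_chartI[OF S, of U \<phi> "\<lambda>x. a"] S by blast
qed

lemma smooth_map_on_compose:
  fixes k :: "'a::real_normed_vector \<Rightarrow> 'b::euclidean_space"
  assumes S: "open S" and F: "smooth_map_on G T F" and k: "smooth_on S k" and "k ` S \<subseteq> T" and "open T"
  shows "smooth_map_on G S (\<lambda>x. F (k x))"
proof (rule smooth_map_on_local)
  fix x assume x: "x \<in> S"
  obtain U \<phi> where U: "(U, \<phi>) \<in> charts G" "F (k x) \<in> U" by (rule chart_cover)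
  have T: "open (T \<inter> F -` U)" using F U chart(1) assms(5) open_vimage_Int smooth_map_on_continuous by blast
  define R where "R = S \<inter> k -` (T \<inter> F -` U)"
  have R: "open R" "x \<in> R" "R \<subseteq> S"
    unfolding R_def using open_vimage_Int[OF S smooth_on_continuous_on[OF k] T] x U assms(4) by auto
  have "smooth_on (T \<inter> F -` U) (\<phi> \<circ> F)" using F U by (auto simp: smooth_map_on_def)
  then have "smooth_on R (\<lambda>x. (\<phi> \<circ> F) (k x))"
    by (rule smooth_on_compose[OF R(1)]) (use smooth_on_subset[OF k R(3)] in \<open>auto simp: R_def\<close>)
  then have "smooth_map_on G R (\<lambda>x. F (k x))"
    by (intro smooth_map_on_chartI[OF R(1) U(1)]) (auto simp: R_def o_def)
  then show "\<exists>T. open T \<and> x \<in> T \<and> smooth_map_on G T (\<lambda>x. F (k x))" using R by blast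
qed

lemma smooth_map_on_ich: "smooth_map_on G (ch ` edom G) ich"
proof (rule smooth_map_on_chartI[OF edom(2) echart])
  show "ich ` ch ` edom G \<subseteq> edom G" by auto
  show "smooth_on (ch ` edom G) (\<lambda>x. ch (ich x))"
    by (rule smooth_on_cong[OF edom(2) _ smooth_on_id[OF edom(2)]]) (auto simp: f_inv_into_f)
qed

text \<open>Logarithmic derivatives are derivatives of maps that pass through the identity; near
  such a point the chosen chart alone is enough.\<close>

lemma smooth_near_one:
  assumes "open S" and "smooth_map_on G S F" and "x \<in> S" and "F x = \<one>"
  obtains T where "open T" and "x \<in> T" and "T \<subseteq> S" and "F ` T \<subseteq> edom G" and "smooth_on T (\<lambda>y. ch (F y))"
proof -
  define T where "T = S \<inter> F -` edom G"
  have T: "open T" "x \<in> T" "T \<subseteq> S" "F ` T \<subseteq> edom G"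
    unfolding T_def
    using open_vimage_Int[OF assms(1) smooth_map_on_continuous[OF assms(2)] edom(1)] assms by auto
  then show thesis
    using that smooth_map_on_chartD[OF smooth_map_on_subset[OF assms(2) T(3)] echart T(4)] by blast
qed

lemma has_derivative_near_one:
  assumes "open S" and "smooth_map_on G S F" and "x \<in> S" and "F x = \<one>"
  shows "((\<lambda>y. ch (F y)) has_derivative frechet_derivative (\<lambda>y. ch (F y)) (at x)) (at x)"
  using smooth_near_one[OF assms] smooth_on_has_derivative by metis

lemma derivative_through_chart:
  assumes "open S" and "smooth_map_on G S F" and "x \<in> S" and "F x = \<one>"
    and \<kappa>: "((\<lambda>a. \<kappa> (ich a)) has_derivative D) (at e0)"
  shows "((\<lambda>y. \<kappa> (F y)) has_derivative (\<lambda>v. D (frechet_derivative (\<lambda>y. ch (F y)) (at x) v))) (at x)"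
proof -
  obtain T where T: "open T" "x \<in> T" "T \<subseteq> S" "F ` T \<subseteq> edom G" "smooth_on T (\<lambda>y. ch (F y))"
    using smooth_near_one[OF assms(1-4)] by blast
  have "((\<lambda>y. \<kappa> (ich (ch (F y)))) has_derivative (\<lambda>v. D (frechet_derivative (\<lambda>y. ch (F y)) (at x) v))) (at x)"
    using has_derivative_compose[OF has_derivative_near_one[OF assms(1-4)], of "\<lambda>a. \<kappa> (ich a)" D] \<kappa> assms(4)
    by simp
  then show ?thesis
    by (rule has_derivative_transform_within_open[OF _ T(1,2)]) (use T in auto)
qed

text \<open>In the chart the multiplication is the identity on each of the two axes through
  \<open>(e0, e0)\<close>, so by linearity its derivative there is addition.\<close>

lemma derivative_mult_near_one:
  assumes S: "open S" and F: "smooth_map_on G S F" and H: "smooth_map_on G S H"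
    and x: "x \<in> S" "F x = \<one>" "H x = \<one>"
  shows "((\<lambda>y. ch (F y \<otimes> H y)) has_derivative
           (\<lambda>v. frechet_derivative (\<lambda>y. ch (F y)) (at x) v + frechet_derivative (\<lambda>y. ch (H y)) (at x) v)) (at x)"
proof -
  define \<mu> where "\<mu> = (\<lambda>(a, b). ch (ich a \<otimes> ich b))"
  define Z where "Z = {(a, b). a \<in> ch ` edom G \<and> b \<in> ch ` edom G \<and> ich a \<otimes> ich b \<in> edom G}"
  have "smooth_on Z \<mu>" unfolding Z_def \<mu>_def by (rule smooth_mult_in_charts[OF echart echart echart])
  moreover have "(e0, e0) \<in> Z" unfolding Z_def by simp
  ultimately obtain D where D: "(\<mu> has_derivative D) (at (e0, e0))"
    using smooth_on_has_derivative by blast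
  have "((\<lambda>a. \<mu> (a, e0)) has_derivative (\<lambda>v. D (v, 0))) (at e0)"
    by (rule has_derivative_compose[of "\<lambda>a. (a, e0)" "\<lambda>v. (v, 0)" e0 UNIV \<mu> D])
      (use D in \<open>auto intro!: derivative_eq_intros\<close>)
  moreover have "((\<lambda>a. \<mu> (a, e0)) has_derivative (\<lambda>v. v)) (at e0)"
    by (rule has_derivative_transform_within_open[OF has_derivative_ident edom(2)])
      (auto simp: \<mu>_def f_inv_into_f)
  ultimately have D1: "D (v, 0) = v" for v using has_derivative_unique by metis
  have "((\<lambda>a. \<mu> (e0, a)) has_derivative (\<lambda>v. D (0, v))) (at e0)"
    by (rule has_derivative_compose[of "\<lambda>a. (e0, a)" "\<lambda>v. (0, v)" e0 UNIV \<mu> D])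
      (use D in \<open>auto intro!: derivative_eq_intros\<close>)
  moreover have "((\<lambda>a. \<mu> (e0, a)) has_derivative (\<lambda>v. v)) (at e0)"
    by (rule has_derivative_transform_within_open[OF has_derivative_ident edom(2)])
      (auto simp: \<mu>_def f_inv_into_f)
  ultimately have D2: "D (0, v) = v" for v using has_derivative_unique by metis
  have "linear D" using D has_derivative_linear by blast
  then have "D (u, v) = u + v" for u v
    using linear_add[of D "(u, 0)" "(0, v)"] D1 D2 by simp
  then have D: "(\<mu> has_derivative (\<lambda>(u, v). u + v)) (at (e0, e0))"
    using D by (auto simp: case_prod_unfold elim!: has_derivative_eq_rhs)
  obtain T where T: "open T" "x \<in> T" "T \<subseteq> S" "F ` T \<subseteq> edom G" "smooth_on T (\<lambda>y. ch (F y))"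
    using smooth_near_one[OF S F x(1,2)] by blast
  obtain T' where T': "open T'" "x \<in> T'" "T' \<subseteq> S" "H ` T' \<subseteq> edom G" "smooth_on T' (\<lambda>y. ch (H y))"
    using smooth_near_one[OF S H x(1,3)] by blast
  have "((\<lambda>y. \<mu> (ch (F y), ch (H y))) has_derivative (\<lambda>v. (\<lambda>(u, v). u + v)
      (frechet_derivative (\<lambda>y. ch (F y)) (at x) v, frechet_derivative (\<lambda>y. ch (H y)) (at x) v))) (at x)"
    by (rule has_derivative_compose[of "\<lambda>y. (ch (F y), ch (H y))"])
      (use D x has_derivative_Pair[OF has_derivative_near_one[OF S F x(1,2)] has_derivative_near_one[OF S H x(1,3)]] in auto)
  then have "((\<lambda>y. \<mu> (ch (F y), ch (H y))) has_derivative
      (\<lambda>v. frechet_derivative (\<lambda>y. ch (F y)) (at x) v + frechet_derivative (\<lambda>y. ch (H y)) (at x) v)) (at x)"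
    by simp
  then show ?thesis
    by (rule has_derivative_transform_within_open[of _ _ _ _ "T \<inter> T'"]) (use T T' in \<open>auto simp: \<mu>_def image_subset_iff\<close>)
qed

text \<open>F y times its inverse is constant, so the two derivatives at the identity add up to
  zero.\<close>

lemma derivative_inv_near_one:
  assumes S: "open S" and F: "smooth_map_on G S F" and x: "x \<in> S" "F x = \<one>"
  shows "((\<lambda>y. ch (inv (F y))) has_derivative (\<lambda>v. - frechet_derivative (\<lambda>y. ch (F y)) (at x) v)) (at x)"
proof -
  have F': "smooth_map_on G S (\<lambda>y. inv (F y))" "inv (F x) = \<one>" using smooth_map_on_inv[OF S F] x by auto
  have "((\<lambda>y. e0) has_derivative (\<lambda>v. frechet_derivative (\<lambda>y. ch (F y)) (at x) v +
      frechet_derivative (\<lambda>y. ch (inv (F y))) (at x) v)) (at x)"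
    using derivative_mult_near_one[OF S F F'(1) x F'(2)] by simp
  then have "frechet_derivative (\<lambda>y. ch (F y)) (at x) v + frechet_derivative (\<lambda>y. ch (inv (F y))) (at x) v = 0" for v
    using has_derivative_unique[OF _ has_derivative_const[of e0 "at x"]] by meson
  then have "frechet_derivative (\<lambda>y. ch (inv (F y))) (at x) = (\<lambda>v. - frechet_derivative (\<lambda>y. ch (F y)) (at x) v)"
    by (auto simp: fun_eq_iff eq_neg_iff_add_eq_0 add.commute)
  then show ?thesis using has_derivative_near_one[OF S F'(1) x(1) F'(2)] by simp
qed

section \<open>The adjoint representation\<close>

lemma smooth_conjugation:
  fixes F :: "'a::euclidean_space \<Rightarrow> 'g"
  assumes "open S" and "smooth_map_on G S F"
  obtains Z where "open Z" and "\<And>x. x \<in> S \<Longrightarrow> (x, e0) \<in> Z"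
    and "smooth_on Z (\<lambda>(x, a). ch (F x \<otimes> ich a \<otimes> inv (F x)))"
proof -
  define C where "C = (\<lambda>p. F (fst p) \<otimes> ich (snd p) \<otimes> inv (F (fst p)))"
  have op: "open (S \<times> ch ` edom G)" using assms(1) edom(2) by (rule open_Times)
  have "smooth_map_on G (S \<times> ch ` edom G) (\<lambda>p. F (fst p))"
    by (rule smooth_map_on_compose[OF op assms(2) _ _ assms(1)]) (auto intro!: smooth_on_fst op smooth_on_id)
  moreover have "smooth_map_on G (S \<times> ch ` edom G) (\<lambda>p. ich (snd p))"
    by (rule smooth_map_on_compose[OF op smooth_map_on_ich _ _ edom(2)])
      (auto intro!: smooth_on_snd op smooth_on_id)
  ultimately have C: "smooth_map_on G (S \<times> ch ` edom G) C"
    unfolding C_def by (intro smooth_map_on_mult smooth_map_on_inv op)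
  define Z where "Z = (S \<times> ch ` edom G) \<inter> C -` edom G"
  have "open Z" unfolding Z_def by (rule open_vimage_Int[OF op smooth_map_on_continuous[OF C] edom(1)])
  moreover have "(x, e0) \<in> Z" if "x \<in> S" for x using that by (simp add: Z_def C_def)
  moreover have "smooth_on Z (\<lambda>p. ch (C p))"
    by (rule smooth_map_on_chartD[OF smooth_map_on_subset[OF C] echart]) (auto simp: Z_def)
  ultimately show thesis using that by (simp add: C_def case_prod_unfold)
qed

lemma Ad_has_derivative: "((\<lambda>a. ch (g \<otimes> ich a \<otimes> inv g)) has_derivative Ad G g) (at e0)"
proof -
  \<comment> \<open>A dummy real parameter turns the fixed g into a constant family, to which
    \<open>smooth_conjugation\<close> applies.\<close>
  obtain Z where Z: "open Z" "\<And>x. x \<in> UNIV \<Longrightarrow> (x, e0) \<in> Z"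
    "smooth_on Z (\<lambda>(x::real, a). ch (g \<otimes> ich a \<otimes> inv g))"
    using smooth_conjugation[OF open_UNIV smooth_map_on_const[OF open_UNIV, of g]] by blast
  have "((\<lambda>a. (\<lambda>(x::real, a). ch (g \<otimes> ich a \<otimes> inv g)) (0, a)) has_derivative
      (\<lambda>v. frechet_derivative (\<lambda>(x::real, a). ch (g \<otimes> ich a \<otimes> inv g)) (at (0, e0)) (0, v))) (at e0)"
    by (rule has_derivative_compose[of "\<lambda>a. (0, a)"])
      (auto intro!: derivative_eq_intros smooth_on_has_derivative[OF Z(3)] Z(2))
  then have "(\<lambda>a. ch (g \<otimes> ich a \<otimes> inv g)) differentiable (at e0)" by (auto simp: differentiable_def)
  then show ?thesis unfolding frechet_derivative_works Ad_def[abs_def] by simp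
qed

lemma linear_Ad: "linear (Ad G g)"
  using Ad_has_derivative has_derivative_linear by blast

lemma Ad_simps [simp]: "Ad G g (X + Y) = Ad G g X + Ad G g Y" "Ad G g (c *\<^sub>R X) = c *\<^sub>R Ad G g X"
  "Ad G g (- X) = - Ad G g X" "Ad G g (X - Y) = Ad G g X - Ad G g Y" "Ad G g 0 = 0"
  using linear_add[OF linear_Ad] linear_scale[OF linear_Ad] linear_neg[OF linear_Ad] linear_diff[OF linear_Ad]
    linear_0[OF linear_Ad] by auto

lemma derivative_conj_near_one:
  assumes S: "open S" and F: "smooth_map_on G S F" and x: "x \<in> S" "F x = \<one>"
  shows "((\<lambda>y. ch (g \<otimes> F y \<otimes> inv g)) has_derivative
           (\<lambda>v. Ad G g (frechet_derivative (\<lambda>y. ch (F y)) (at x) v))) (at x)"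
  by (rule derivative_through_chart[OF S F x, of "\<lambda>b. ch (g \<otimes> b \<otimes> inv g)", OF Ad_has_derivative])

lemma Ad_one [simp]: "Ad G \<one> X = X"
proof -
  have "((\<lambda>a. ch (\<one> \<otimes> ich a \<otimes> inv \<one>)) has_derivative (\<lambda>v. v)) (at e0)"
    by (rule has_derivative_transform_within_open[OF has_derivative_ident edom(2)]) (auto simp: f_inv_into_f)
  then show ?thesis using has_derivative_unique[OF Ad_has_derivative] by metis
qed

lemma Ad_mult: "Ad G (g \<otimes> h) X = Ad G g (Ad G h X)"
proof -
  have sm: "smooth_map_on G (ch ` edom G) (\<lambda>a. h \<otimes> ich a \<otimes> inv h)"
    by (intro smooth_map_on_mult smooth_map_on_ich smooth_map_on_const edom(2))
  have "frechet_derivative (\<lambda>a. ch (h \<otimes> ich a \<otimes> inv h)) (at e0) = Ad G h"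
    using frechet_derivative_at[OF Ad_has_derivative] by simp
  then have "((\<lambda>a. ch (g \<otimes> (h \<otimes> ich a \<otimes> inv h) \<otimes> inv g)) has_derivative (\<lambda>v. Ad G g (Ad G h v))) (at e0)"
    using derivative_conj_near_one[OF edom(2) sm e0_in, of g] by simp
  then have "((\<lambda>a. ch (g \<otimes> h \<otimes> ich a \<otimes> inv (g \<otimes> h))) has_derivative (\<lambda>v. Ad G g (Ad G h v))) (at e0)"
    by (simp add: mult_assoc inv_mult)
  then show ?thesis using has_derivative_unique[OF Ad_has_derivative] by metis
qed

lemma Ad_inv [simp]: "Ad G (inv g) (Ad G g X) = X" "Ad G g (Ad G (inv g) X) = X"
  by (simp_all flip: Ad_mult)

text \<open>In coordinates this is the derivative of the jointly smooth map (x, a) \<mapsto> F x a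
  (F x)^{-1} at \<open>(x, e0)\<close> in the direction \<open>(0, Y x)\<close>.\<close>

lemma smooth_on_Ad:
  fixes F :: "'a::euclidean_space \<Rightarrow> 'g"
  assumes S: "open S" and F: "smooth_map_on G S F" and Y: "smooth_on S Y"
  shows "smooth_on S (\<lambda>x. Ad G (F x) (Y x))"
proof -
  obtain Z where Z: "open Z" "\<And>x. x \<in> S \<Longrightarrow> (x, e0) \<in> Z"
    "smooth_on Z (\<lambda>(x, a). ch (F x \<otimes> ich a \<otimes> inv (F x)))" (is "smooth_on Z ?C")
    using smooth_conjugation[OF S F] by blast
  have "smooth_on S (\<lambda>x. frechet_derivative ?C (at (x, e0)) (0, Y x))"
    by (rule smooth_on_derivative_compose[OF S Z(3)]) (auto intro!: smooth_on_Pair S Y Z(2))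
  moreover have "frechet_derivative ?C (at (x, e0)) (0, v) = Ad G (F x) v" if "x \<in> S" for x v
  proof -
    have "((\<lambda>a. ?C (x, a)) has_derivative (\<lambda>v. frechet_derivative ?C (at (x, e0)) (0, v))) (at e0)"
      by (rule has_derivative_compose[of "\<lambda>a. (x, a)"])
        (use that in \<open>auto intro!: derivative_eq_intros smooth_on_has_derivative[OF Z(3)] Z(2)\<close>)
    then have "Ad G (F x) = (\<lambda>v. frechet_derivative ?C (at (x, e0)) (0, v))"
      by (intro has_derivative_unique[OF Ad_has_derivative]) simp
    then show ?thesis by (simp only:)
  qed
  ultimately show ?thesis by (elim smooth_on_cong[OF S, rotated]) simp
qed

section \<open>Logarithmic derivatives\<close>

lemma smooth_left_quotient:
  assumes "open S" and "smooth_map_on G S F"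
  shows "smooth_map_on G S (\<lambda>y. inv (F x) \<otimes> F y)" "smooth_map_on G S (\<lambda>y. F y \<otimes> inv (F x))"
  by (intro smooth_map_on_mult smooth_map_on_const assms)+

lemma llog_has_derivative:
  assumes "open S" and "smooth_map_on G S F" and "x \<in> S"
  shows "((\<lambda>y. ch (inv (F x) \<otimes> F y)) has_derivative llog G F x) (at x)"
  unfolding llog_def by (rule has_derivative_near_one[OF assms(1) smooth_left_quotient(1)[OF assms(1,2)] assms(3)]) simp

lemma rlog_has_derivative:
  assumes "open S" and "smooth_map_on G S F" and "x \<in> S"
  shows "((\<lambda>y. ch (F y \<otimes> inv (F x))) has_derivative rlog G F x) (at x)"
  unfolding rlog_def by (rule has_derivative_near_one[OF assms(1) smooth_left_quotient(2)[OF assms(1,2)] assms(3)]) simp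

lemma llog_unique: "((\<lambda>y. ch (inv (F x) \<otimes> F y)) has_derivative D) (at x) \<Longrightarrow> llog G F x = D"
  unfolding llog_def using frechet_derivative_at by metis

lemma rlog_unique: "((\<lambda>y. ch (F y \<otimes> inv (F x))) has_derivative D) (at x) \<Longrightarrow> rlog G F x = D"
  unfolding rlog_def using frechet_derivative_at by metis

lemma linear_llog: "open S \<Longrightarrow> smooth_map_on G S F \<Longrightarrow> x \<in> S \<Longrightarrow> linear (llog G F x)"
  using llog_has_derivative has_derivative_linear by blast

lemma linear_rlog: "open S \<Longrightarrow> smooth_map_on G S F \<Longrightarrow> x \<in> S \<Longrightarrow> linear (rlog G F x)"
  using rlog_has_derivative has_derivative_linear by blast

lemma llog_const_mult: "llog G (\<lambda>y. g \<otimes> F y) x = llog G F x"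
  unfolding llog_def by (simp add: inv_mult mult_assoc)

lemma rlog_eq_Ad_llog:
  assumes "open S" and "smooth_map_on G S F" and "x \<in> S"
  shows "rlog G F x v = Ad G (F x) (llog G F x v)"
proof -
  have "((\<lambda>y. ch (F x \<otimes> (inv (F x) \<otimes> F y) \<otimes> inv (F x))) has_derivative (\<lambda>v. Ad G (F x) (llog G F x v))) (at x)"
    unfolding llog_def
    by (rule derivative_conj_near_one[OF assms(1) smooth_left_quotient(1)[OF assms(1,2)] assms(3)]) simp
  then show ?thesis using rlog_unique[of F x] by (simp add: mult_assoc)
qed

text \<open>The quotient (F x H x)^{-1} F y H y is the quotient of F, conjugated by (H x)^{-1},
  times the quotient of H. Both pass through the identity at y = x, where derivatives of a product
  add.\<close>

lemma llog_mult:
  assumes "open S" and "smooth_map_on G S F" and "smooth_map_on G S H" and "x \<in> S"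
  shows "llog G (\<lambda>y. F y \<otimes> H y) x v = Ad G (inv (H x)) (llog G F x v) + llog G H x v"
proof -
  let ?L = "\<lambda>y. inv (H x) \<otimes> (inv (F x) \<otimes> F y) \<otimes> inv (inv (H x))"
  have sm: "smooth_map_on G S ?L"
    by (intro smooth_map_on_mult smooth_map_on_const assms smooth_left_quotient)
  have "frechet_derivative (\<lambda>y. ch (?L y)) (at x) = (\<lambda>v. Ad G (inv (H x)) (llog G F x v))"
    using frechet_derivative_at[OF derivative_conj_near_one[OF assms(1) smooth_left_quotient(1)[OF assms(1,2)] assms(4), of x "inv (H x)"]]
    unfolding llog_def by simp
  then have "((\<lambda>y. ch (?L y \<otimes> (inv (H x) \<otimes> H y))) has_derivative
      (\<lambda>v. Ad G (inv (H x)) (llog G F x v) + llog G H x v)) (at x)"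
    using derivative_mult_near_one[OF assms(1) sm smooth_left_quotient(1)[OF assms(1,3)] assms(4), of x]
    unfolding llog_def by simp
  then have "((\<lambda>y. ch (inv (F x \<otimes> H x) \<otimes> (F y \<otimes> H y))) has_derivative
      (\<lambda>v. Ad G (inv (H x)) (llog G F x v) + llog G H x v)) (at x)"
    by (simp add: inv_mult mult_assoc)
  then show ?thesis using llog_unique[of "\<lambda>y. F y \<otimes> H y" x] by simp
qed

lemma rlog_mult:
  assumes "open S" and "smooth_map_on G S F" and "smooth_map_on G S H" and "x \<in> S"
  shows "rlog G (\<lambda>y. F y \<otimes> H y) x v = rlog G F x v + Ad G (F x) (rlog G H x v)"
  using llog_mult[OF assms] rlog_eq_Ad_llog[OF assms(1) smooth_map_on_mult[OF assms(1-3)] assms(4)]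
    rlog_eq_Ad_llog[OF assms(1,2,4)] rlog_eq_Ad_llog[OF assms(1,3,4)] by (simp add: Ad_mult)

text \<open>The left quotient of the inverse, F x (F y)^{-1}, is the inverse of the right quotient
  of F.\<close>

lemma llog_inv:
  assumes "open S" and "smooth_map_on G S F" and "x \<in> S"
  shows "llog G (\<lambda>y. inv (F y)) x v = - rlog G F x v"
proof -
  have "((\<lambda>y. ch (inv (F y \<otimes> inv (F x)))) has_derivative (\<lambda>v. - rlog G F x v)) (at x)"
    unfolding rlog_def
    by (rule derivative_inv_near_one[OF assms(1) smooth_left_quotient(2)[OF assms(1,2)] assms(3)]) simp
  then show ?thesis using llog_unique[of "\<lambda>y. inv (F y)" x] by (simp add: inv_mult)
qed

lemma rlog_inv:
  assumes "open S" and "smooth_map_on G S F" and "x \<in> S"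
  shows "rlog G (\<lambda>y. inv (F y)) x v = - llog G F x v"
  using llog_inv[OF assms(1) smooth_map_on_inv[OF assms(1,2)] assms(3)] by simp

lemma llog_compose:
  assumes "open T" and "smooth_map_on G T F" and "k x \<in> T" and "(k has_derivative k') (at x)"
  shows "llog G (\<lambda>y. F (k y)) x v = llog G F (k x) (k' v)"
  using llog_unique[of "\<lambda>y. F (k y)" x,
      OF has_derivative_compose[OF assms(4) llog_has_derivative[OF assms(1-3)]]] by simp

lemma rlog_compose:
  assumes "open T" and "smooth_map_on G T F" and "k x \<in> T" and "(k has_derivative k') (at x)"
  shows "rlog G (\<lambda>y. F (k y)) x v = rlog G F (k x) (k' v)"
  using rlog_unique[of "\<lambda>y. F (k y)" x,
      OF has_derivative_compose[OF assms(4) rlog_has_derivative[OF assms(1-3)]]] by simp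

text \<open>In \<open>llog\<close> the base point and the point of differentiation move together.
  Separating them in C (x, y) = (F x)^{-1} F y gives a partial derivative of a smooth map,
  restricted to the diagonal.\<close>

lemma smooth_on_llog:
  fixes F :: "'a::euclidean_space \<Rightarrow> 'g"
  assumes S: "open S" and F: "smooth_map_on G S F" and v: "smooth_on S v"
  shows "smooth_on S (\<lambda>x. llog G F x (v x))"
proof -
  define C where "C = (\<lambda>p. inv (F (fst p)) \<otimes> F (snd p))"
  have op: "open (S \<times> S)" using S S by (rule open_Times)
  have C: "smooth_map_on G (S \<times> S) C"
    unfolding C_def
    by (intro smooth_map_on_mult smooth_map_on_inv op)
      (auto intro!: smooth_map_on_compose[OF op F _ _ S] smooth_on_fst smooth_on_snd op)
  define Z where "Z = (S \<times> S) \<inter> C -` edom G"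
  have Z: "open Z" unfolding Z_def by (rule open_vimage_Int[OF op smooth_map_on_continuous[OF C] edom(1)])
  have Z': "(x, x) \<in> Z" if "x \<in> S" for x using that by (simp add: Z_def C_def)
  have sm: "smooth_on Z (\<lambda>p. ch (C p))"
    by (rule smooth_map_on_chartD[OF smooth_map_on_subset[OF C] echart]) (auto simp: Z_def)
  have "smooth_on S (\<lambda>x. frechet_derivative (\<lambda>p. ch (C p)) (at (x, x)) (0, v x))"
    by (rule smooth_on_derivative_compose[OF S sm]) (auto intro!: smooth_on_Pair S v Z')
  moreover have "frechet_derivative (\<lambda>p. ch (C p)) (at (x, x)) (0, w) = llog G F x w" if "x \<in> S" for x w
  proof -
    have "((\<lambda>y. ch (C (x, y))) has_derivative (\<lambda>w. frechet_derivative (\<lambda>p. ch (C p)) (at (x, x)) (0, w))) (at x)"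
      by (rule has_derivative_compose[of "\<lambda>y. (x, y)"])
        (use that in \<open>auto intro!: derivative_eq_intros smooth_on_has_derivative[OF sm] Z'\<close>)
    then show ?thesis using llog_unique[of F x] by (simp add: C_def)
  qed
  ultimately show ?thesis by (elim smooth_on_cong[OF S, rotated]) simp
qed

lemma smooth_on_rlog:
  fixes F :: "'a::euclidean_space \<Rightarrow> 'g"
  assumes S: "open S" and F: "smooth_map_on G S F" and v: "smooth_on S v"
  shows "smooth_on S (\<lambda>x. rlog G F x (v x))"
  by (rule smooth_on_cong[OF S _ smooth_on_Ad[OF S F smooth_on_llog[OF S F v]]])
    (simp add: rlog_eq_Ad_llog[OF S F])

section \<open>The bracket as the derivative of the adjoint representation\<close>

lemma Ad_chart_has_derivative:
  "((\<lambda>a. Ad G (ich a) Y) has_derivative (\<lambda>X. bracket G X Y)) (at e0)"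
proof -
  have "smooth_on (ch ` edom G) (\<lambda>a. Ad G (ich a) Y)"
    by (intro smooth_on_Ad smooth_map_on_ich edom(2) smooth_on_const)
  from smooth_on_has_derivative[OF this e0_in] show ?thesis unfolding bracket_def .
qed

lemma linear_bracket_left: "linear (\<lambda>X. bracket G X Y)"
  using Ad_chart_has_derivative has_derivative_linear by blast

lemma linear_bracket_right: "linear (bracket G X)"
proof (rule linearI)
  fix Y Z c
  have "((\<lambda>a. Ad G (ich a) Y + Ad G (ich a) Z) has_derivative (\<lambda>X. bracket G X Y + bracket G X Z)) (at e0)"
    by (intro has_derivative_add Ad_chart_has_derivative)
  then have "(\<lambda>X. bracket G X (Y + Z)) = (\<lambda>X. bracket G X Y + bracket G X Z)"
    by (intro has_derivative_unique[OF Ad_chart_has_derivative]) simp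
  then show "bracket G X (Y + Z) = bracket G X Y + bracket G X Z" by (rule fun_cong)
  have "((\<lambda>a. c *\<^sub>R Ad G (ich a) Y) has_derivative (\<lambda>X. c *\<^sub>R bracket G X Y)) (at e0)"
    by (intro has_derivative_scaleR_right Ad_chart_has_derivative)
  then have "(\<lambda>X. bracket G X (c *\<^sub>R Y)) = (\<lambda>X. c *\<^sub>R bracket G X Y)"
    by (intro has_derivative_unique[OF Ad_chart_has_derivative]) simp
  then show "bracket G X (c *\<^sub>R Y) = c *\<^sub>R bracket G X Y" by (rule fun_cong)
qed

text \<open>\<open>bracket\<close> is the derivative of \<open>Ad\<close> at the identity; writing F
  y = (F y (F x)^{-1}) F x moves the derivative at x there.\<close>

lemma Ad_derivative_rlog:
  assumes "open S" and "smooth_map_on G S F" and "x \<in> S"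
  shows "((\<lambda>y. Ad G (F y) Y) has_derivative (\<lambda>v. bracket G (rlog G F x v) (Ad G (F x) Y))) (at x)"
proof -
  have "((\<lambda>y. Ad G (F y \<otimes> inv (F x)) (Ad G (F x) Y)) has_derivative
      (\<lambda>v. bracket G (rlog G F x v) (Ad G (F x) Y))) (at x)"
    unfolding rlog_def
    by (rule derivative_through_chart[OF assms(1) smooth_left_quotient(2)[OF assms(1,2)] assms(3) _
          Ad_chart_has_derivative]) simp
  then show ?thesis by (simp add: Ad_mult)
qed

lemma left_log_deriv_eq_llog:
  assumes "open S" and "smooth_map_on G S c" and "s \<in> S"
  shows "left_log_deriv G c s = llog G c s 1"
proof -
  have "((\<lambda>r. ch (inv (c s) \<otimes> c r)) has_derivative (\<lambda>r. r *\<^sub>R llog G c s 1)) (at s)"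
    using llog_has_derivative[OF assms]
    by (rule has_derivative_eq_rhs) (rule ext, rule linear_real_eq[OF linear_llog[OF assms]])
  then show ?thesis
    unfolding left_log_deriv_def by (intro vector_derivative_at) (simp add: has_vector_derivative_def)
qed

end

section \<open>Maps are determined by their logarithmic derivative and one value\<close>

context lie
begin

text \<open>For differentiating (F x)^{-1} F at a point y near x inside the chart at the identity:
  (F x)^{-1} F z is the fixed element h = (F x)^{-1} F y times (F y)^{-1} F z.\<close>

lemma left_translation_derivative:
  assumes "h \<in> edom G"
  obtains D where "((\<lambda>b. ch (h \<otimes> ich b)) has_derivative D) (at e0)"
proof -
  let ?Z = "{(a, b). a \<in> ch ` edom G \<and> b \<in> ch ` edom G \<and> ich a \<otimes> ich b \<in> edom G}"
  have sm: "smooth_on ?Z (\<lambda>(a, b). ch (ich a \<otimes> ich b))"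
    by (rule smooth_mult_in_charts[OF echart echart echart])
  have "(ch h, e0) \<in> ?Z" using assms by simp
  from smooth_on_has_derivative[OF sm this]
  obtain D where D: "((\<lambda>(a, b). ch (ich a \<otimes> ich b)) has_derivative D) (at (ch h, e0))" ..
  have "((\<lambda>b. (\<lambda>(a, b). ch (ich a \<otimes> ich b)) (ch h, b)) has_derivative (\<lambda>v. D (0, v))) (at e0)"
    by (rule has_derivative_compose[of "\<lambda>b. (ch h, b)"]) (use D in \<open>auto intro!: derivative_eq_intros\<close>)
  then show thesis using that assms by simp
qed

text \<open>F is locally constant, because the coordinates of (F x)^{-1} F have vanishing derivative
  near x and the chart is injective. Connectedness of S does the rest.\<close>

lemma constant_if_llog_zero:
  fixes F :: "real \<Rightarrow> 'g"
  assumes S: "open S" "connected S" and F: "smooth_map_on G S F" and zero: "\<And>s. s \<in> S \<Longrightarrow> llog G F s 1 = 0"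
    and st: "s \<in> S" "t \<in> S"
  shows "F s = F t"
proof -
  have zero': "llog G F s v = 0" if "s \<in> S" for s v
    using linear_real_eq[OF linear_llog[OF S(1) F that], of v] zero[OF that] by simp
  have "\<forall>\<^sub>F y in at x within S. F x = F y" if x: "x \<in> S" for x
  proof -
    obtain T where T: "open T" "x \<in> T" "T \<subseteq> S" "(\<lambda>y. inv (F x) \<otimes> F y) ` T \<subseteq> edom G"
      by (rule smooth_near_one[OF S(1) smooth_left_quotient(1)[OF S(1) F, of x] x mult_inv(1)])
    obtain e where e: "e > 0" "ball x e \<subseteq> T" using T open_contains_ball by blast
    have "((\<lambda>z. ch (inv (F x) \<otimes> F z)) has_derivative (\<lambda>v. 0)) (at y within ball x e)" if y: "y \<in> ball x e" for y
    proof -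
      have yS: "y \<in> S" using y e T by blast
      have hy: "inv (F x) \<otimes> F y \<in> edom G" using y e T by blast
      obtain D where D: "((\<lambda>b. ch (inv (F x) \<otimes> F y \<otimes> ich b)) has_derivative D) (at e0)"
        using left_translation_derivative[OF hy] by blast
      have "((\<lambda>z. ch (inv (F x) \<otimes> F y \<otimes> (inv (F y) \<otimes> F z))) has_derivative (\<lambda>v. D (llog G F y v))) (at y)"
        unfolding llog_def
        by (rule derivative_through_chart[OF S(1) smooth_left_quotient(1)[OF S(1) F] yS _ D]) simp
      then have "((\<lambda>z. ch (inv (F x) \<otimes> F z)) has_derivative (\<lambda>v. 0)) (at y)"
        using linear_0[OF has_derivative_linear[OF D]] zero'[OF yS] by (simp add: mult_assoc)
      then show ?thesis by (rule has_derivative_at_withinI)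
    qed
    then have const: "ch (inv (F x) \<otimes> F y) = ch (inv (F x) \<otimes> F x)" if "y \<in> ball x e" for y
      using has_derivative_zero_unique[of "ball x e" "\<lambda>z. ch (inv (F x) \<otimes> F z)" x y] that e(1) by auto
    have "inv (F x) \<otimes> F y = \<one>" if "y \<in> ball x e" for y
    proof -
      have "inv (F x) \<otimes> F y \<in> edom G" "inv (F x) \<otimes> F x \<in> edom G" using that T(2,4) e(2) by (blast, simp)
      then show ?thesis
        using inj_onD[OF edom(3) const[OF that]] by simp
    qed
    then have "F x = F y" if "y \<in> ball x e" for y
      using that by (metis mult_inv_cancel(2) mult_one(2))
    then show ?thesis
      using e(1) by (auto simp: eventually_at dist_commute intro!: exI[of _ e])
  qed
  then show ?thesis by (intro connected_local_const[OF S(2) st]) blast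
qed

text \<open>The logarithmic derivative of F H^{-1} is \<open>Ad\<close> of H applied to the
  difference of those of F and H, hence zero.\<close>

lemma eq_if_llog_eq:
  fixes F H :: "real \<Rightarrow> 'g"
  assumes S: "open S" "connected S" and F: "smooth_map_on G S F" and H: "smooth_map_on G S H"
    and eq: "\<And>s. s \<in> S \<Longrightarrow> llog G F s 1 = llog G H s 1" and "t \<in> S" "F t = H t" "s \<in> S"
  shows "F s = H s"
proof -
  have "F s \<otimes> inv (H s) = F t \<otimes> inv (H t)"
  proof (rule constant_if_llog_zero[OF S smooth_map_on_mult[OF S(1) F smooth_map_on_inv[OF S(1) H]]])
    show "llog G (\<lambda>x. F x \<otimes> inv (H x)) s 1 = 0" if "s \<in> S" for s
      using that by (simp add: llog_mult[OF S(1) F smooth_map_on_inv[OF S(1) H]] llog_inv[OF S(1) H]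
          rlog_eq_Ad_llog[OF S(1) H] eq)
  qed (use assms in auto)
  then have "F s \<otimes> inv (H s) \<otimes> H s = H s" using assms by simp
  then show ?thesis by (simp add: mult_assoc)
qed

lemma eq_if_rlog_eq:
  fixes F H :: "real \<Rightarrow> 'g"
  assumes S: "open S" "connected S" and F: "smooth_map_on G S F" and H: "smooth_map_on G S H"
    and eq: "\<And>s. s \<in> S \<Longrightarrow> rlog G F s 1 = rlog G H s 1" and "t \<in> S" "F t = H t" "s \<in> S"
  shows "F s = H s"
proof -
  have "inv (F s) = inv (H s)"
    by (rule eq_if_llog_eq[OF S smooth_map_on_inv[OF S(1) F] smooth_map_on_inv[OF S(1) H]])
      (use assms in \<open>auto simp: llog_inv[OF S(1)]\<close>)
  then show ?thesis by (metis inv_inv)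
qed

section \<open>The Maurer-Cartan equation\<close>

lemma smooth_on_section_derivative:
  fixes f :: "real \<times> real \<Rightarrow> 'b::real_normed_vector"
  assumes "smooth_on S f" and "x \<in> S"
  shows "((\<lambda>r. f (r, snd x)) has_vector_derivative frechet_derivative f (at x) (1, 0)) (at (fst x))"
    and "((\<lambda>r. f (fst x, r)) has_vector_derivative frechet_derivative f (at x) (0, 1)) (at (snd x))"
proof -
  have D: "(f has_derivative frechet_derivative f (at x)) (at x)" using smooth_on_has_derivative assms by blast
  have l: "linear (frechet_derivative f (at x))" using D has_derivative_linear by blast
  have l1: "frechet_derivative f (at x) (h, 0) = h *\<^sub>R frechet_derivative f (at x) (1, 0)" for h
    using linear_scale[OF l, of h "(1, 0)"] by (simp only: scaleR_Pair real_scaleR_def mult_1_right mult_zero_right)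
  have l2: "frechet_derivative f (at x) (0, h) = h *\<^sub>R frechet_derivative f (at x) (0, 1)" for h
    using linear_scale[OF l, of h "(0, 1)"] by (simp only: scaleR_Pair real_scaleR_def mult_1_right mult_zero_right)
  have "((\<lambda>r. f (r, snd x)) has_derivative (\<lambda>h. frechet_derivative f (at x) (h, 0))) (at (fst x))"
    by (rule has_derivative_compose[of "\<lambda>r. (r, snd x)" "\<lambda>h. (h, 0)"])
      (use D in \<open>auto intro!: derivative_eq_intros\<close>)
  then show "((\<lambda>r. f (r, snd x)) has_vector_derivative frechet_derivative f (at x) (1, 0)) (at (fst x))"
    unfolding has_vector_derivative_def
    by (rule has_derivative_eq_rhs) (rule ext, rule l1)
  have "((\<lambda>r. f (fst x, r)) has_derivative (\<lambda>h. frechet_derivative f (at x) (0, h))) (at (snd x))"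
    by (rule has_derivative_compose[of "\<lambda>r. (fst x, r)" "\<lambda>h. (0, h)"])
      (use D in \<open>auto intro!: derivative_eq_intros\<close>)
  then show "((\<lambda>r. f (fst x, r)) has_vector_derivative frechet_derivative f (at x) (0, 1)) (at (snd x))"
    unfolding has_vector_derivative_def
    by (rule has_derivative_eq_rhs) (rule ext, rule l2)
qed

lemma llog_section:
  fixes F :: "real \<times> real \<Rightarrow> 'g"
  assumes "open S" and "smooth_map_on G S F" and "(r, \<theta>) \<in> S"
  shows "llog G (\<lambda>r. F (r, \<theta>)) r 1 = llog G F (r, \<theta>) (1, 0)"
    and "llog G (\<lambda>\<theta>. F (r, \<theta>)) \<theta> 1 = llog G F (r, \<theta>) (0, 1)"
    and "rlog G (\<lambda>r. F (r, \<theta>)) r 1 = rlog G F (r, \<theta>) (1, 0)"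
    and "rlog G (\<lambda>\<theta>. F (r, \<theta>)) \<theta> 1 = rlog G F (r, \<theta>) (0, 1)"
proof -
  have a: "((\<lambda>r. (r, \<theta>)) has_derivative (\<lambda>h. (h, 0))) (at r)" by (auto intro!: derivative_eq_intros)
  have b: "((\<lambda>\<theta>. (r, \<theta>)) has_derivative (\<lambda>h. (0, h))) (at \<theta>)" by (auto intro!: derivative_eq_intros)
  show "llog G (\<lambda>r. F (r, \<theta>)) r 1 = llog G F (r, \<theta>) (1, 0)"
    "llog G (\<lambda>\<theta>. F (r, \<theta>)) \<theta> 1 = llog G F (r, \<theta>) (0, 1)"
    "rlog G (\<lambda>r. F (r, \<theta>)) r 1 = rlog G F (r, \<theta>) (1, 0)"
    "rlog G (\<lambda>\<theta>. F (r, \<theta>)) \<theta> 1 = rlog G F (r, \<theta>) (0, 1)"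
    using llog_compose[OF assms(1,2) assms(3) a] llog_compose[OF assms(1,2) assms(3) b]
      rlog_compose[OF assms(1,2) assms(3) a] rlog_compose[OF assms(1,2) assms(3) b] by auto
qed

text \<open>F is corrected by its values on the two axes until it is the identity there. In the
  chart at the identity the equation then is the symmetry of mixed second derivatives.\<close>

lemma maurer_cartan_at_zero:
  fixes F :: "real \<times> real \<Rightarrow> 'g"
  assumes S: "open S" and F: "smooth_map_on G S F" and "(0, 0) \<in> S"
  shows "frechet_derivative (\<lambda>x. rlog G F x (0, 1)) (at (0, 0)) (1, 0) =
         Ad G (F (0, 0)) (frechet_derivative (\<lambda>x. llog G F x (1, 0)) (at (0, 0)) (0, 1))"
proof -
  obtain A B where AB: "open A" "open B" "(0::real) \<in> A" "(0::real) \<in> B" "A \<times> B \<subseteq> S"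
    using open_prod_elim[OF S assms(3)] by (metis mem_Sigma_iff)
  define g where "g = F (0, 0)"
  have op: "open (A \<times> B)" using AB open_Times by blast
  have F': "smooth_map_on G (A \<times> B) F" using smooth_map_on_subset[OF F AB(5)] .
  \<comment> \<open>K is the identity whenever r = 0 or \<theta> = 0. Its first derivatives there
    are derivatives at the identity: in r across the axis r = 0 they give the left logarithmic
    derivative of F up to Ad g and a constant, in \<theta> across the axis \<theta> = 0 the right
    one up to a constant.\<close>
  define K where "K = (\<lambda>x. g \<otimes> inv (F (0, snd x)) \<otimes> (F x \<otimes> inv (F (fst x, 0))))"
  have K: "smooth_map_on G (A \<times> B) K"
  proof -
    have "smooth_map_on G (A \<times> B) (\<lambda>x. F (0, snd x))" "smooth_map_on G (A \<times> B) (\<lambda>x. F (fst x, 0))"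
      by (rule smooth_map_on_compose[OF op F' _ _ op];
          use AB op in \<open>auto intro!: smooth_on_Pair smooth_on_const smooth_on_fst smooth_on_snd\<close>)+
    then show ?thesis unfolding K_def
      by (intro smooth_map_on_mult smooth_map_on_inv smooth_map_on_const op F')
  qed
  have K0: "K (0, 0) = \<one>" by (simp add: K_def g_def)
  obtain T where T: "open T" "(0, 0) \<in> T" "T \<subseteq> A \<times> B" "K ` T \<subseteq> edom G" "smooth_on T (\<lambda>x. ch (K x))"
    using smooth_near_one[OF op K _ K0] AB by blast
  define Y where "Y = (\<lambda>x. ch (K x))"
  define f1 where "f1 = (\<lambda>x. frechet_derivative Y (at x) (1, 0))"
  define f2 where "f2 = (\<lambda>x. frechet_derivative Y (at x) (0, 1))"
  have Y: "smooth_on T Y" using T by (simp add: Y_def)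
  have f1: "smooth_on T f1" and f2: "smooth_on T f2" unfolding f1_def f2_def by (rule smooth_on_derivative[OF Y])+
  have mixed: "frechet_derivative f1 (at (0, 0)) (0, 1) = frechet_derivative f2 (at (0, 0)) (1, 0)"
    by (rule mixed_derivatives_commute[OF T(1,2), of Y f1 f2 "\<lambda>x. frechet_derivative f1 (at x) (0, 1)"
          "\<lambda>x. frechet_derivative f2 (at x) (1, 0)"])
      (use smooth_on_section_derivative[OF Y] smooth_on_section_derivative[OF f1]
        smooth_on_section_derivative[OF f2] smooth_on_continuous_on[OF smooth_on_derivative[OF f2]]
        in \<open>auto simp: f1_def f2_def\<close>)
  have slice: "smooth_map_on G A (\<lambda>r. F (r, \<theta>))" if "\<theta> \<in> B" for \<theta>
    by (rule smooth_map_on_compose[OF AB(1) F' _ _ op])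
      (use AB that in \<open>auto intro!: smooth_on_Pair smooth_on_const smooth_on_id\<close>)
  have slice': "smooth_map_on G B (\<lambda>\<theta>. F (r, \<theta>))" if "r \<in> A" for r
    by (rule smooth_map_on_compose[OF AB(2) F' _ _ op])
      (use AB that in \<open>auto intro!: smooth_on_Pair smooth_on_const smooth_on_id\<close>)
  have f1_eq: "f1 (0, \<theta>) = Ad G g (llog G F (0, \<theta>) (1, 0)) - rlog G F (0, 0) (1, 0)" if "(0, \<theta>) \<in> T" for \<theta>
  proof -
    have \<theta>: "\<theta> \<in> B" using that T by auto
    let ?E = "\<lambda>r. F (r, \<theta>) \<otimes> inv (F (r, 0))"
    have E: "smooth_map_on G A ?E"
      by (intro smooth_map_on_mult smooth_map_on_inv slice \<theta> AB)
    have "((\<lambda>r. Y (r, \<theta>)) has_derivative llog G ?E 0) (at 0)"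
      using llog_has_derivative[OF AB(1) E AB(3)] unfolding Y_def K_def by (simp add: inv_mult g_def mult_assoc)
    moreover have "((\<lambda>r. Y (r, \<theta>)) has_derivative (\<lambda>h. h *\<^sub>R f1 (0, \<theta>))) (at 0)"
      using smooth_on_section_derivative(1)[OF Y that] by (simp add: has_vector_derivative_def f1_def)
    ultimately have "llog G ?E 0 = (\<lambda>h. h *\<^sub>R f1 (0, \<theta>))" by (rule has_derivative_unique)
    then have "f1 (0, \<theta>) = llog G ?E 0 1" by simp
    also have "\<dots> = Ad G g (llog G (\<lambda>r. F (r, \<theta>)) 0 1) - rlog G (\<lambda>r. F (r, 0)) 0 1"
      by (simp add: llog_mult[OF AB(1) slice[OF \<theta>] smooth_map_on_inv[OF AB(1) slice[OF AB(4)]] AB(3)]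
          llog_inv[OF AB(1) slice[OF AB(4)] AB(3)] g_def)
    finally show ?thesis using llog_section[OF op F', of 0 \<theta>] llog_section[OF op F', of 0 0] \<theta> AB by simp
  qed
  have f2_eq: "f2 (r, 0) = rlog G F (r, 0) (0, 1) - rlog G F (0, 0) (0, 1)" if "(r, 0) \<in> T" for r
  proof -
    have r: "r \<in> A" using that T by auto
    let ?H = "\<lambda>\<theta>. inv (F (0, \<theta>)) \<otimes> F (r, \<theta>)"
    have H: "smooth_map_on G B ?H"
      by (intro smooth_map_on_mult smooth_map_on_inv slice' r AB)
    have "((\<lambda>\<theta>. ch (g \<otimes> (?H \<theta> \<otimes> inv (?H 0)) \<otimes> inv g)) has_derivative (\<lambda>v. Ad G g (rlog G ?H 0 v))) (at 0)"
      unfolding rlog_def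
      by (rule derivative_conj_near_one[OF AB(2) smooth_left_quotient(2)[OF AB(2) H] AB(4)]) simp
    then have "((\<lambda>\<theta>. Y (r, \<theta>)) has_derivative (\<lambda>v. Ad G g (rlog G ?H 0 v))) (at 0)"
      unfolding Y_def K_def by (simp add: inv_mult g_def mult_assoc)
    moreover have "((\<lambda>\<theta>. Y (r, \<theta>)) has_derivative (\<lambda>h. h *\<^sub>R f2 (r, 0))) (at 0)"
      using smooth_on_section_derivative(2)[OF Y that] by (simp add: has_vector_derivative_def f2_def)
    ultimately have "(\<lambda>v. Ad G g (rlog G ?H 0 v)) = (\<lambda>h. h *\<^sub>R f2 (r, 0))" by (rule has_derivative_unique)
    then have "f2 (r, 0) = Ad G g (rlog G ?H 0 1)" by (metis scaleR_one)
    also have "\<dots> = rlog G (\<lambda>\<theta>. F (r, \<theta>)) 0 1 - rlog G (\<lambda>\<theta>. F (0, \<theta>)) 0 1"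
      by (simp add: rlog_mult[OF AB(2) smooth_map_on_inv[OF AB(2) slice'[OF AB(3)]] slice'[OF r] AB(4)]
          rlog_inv[OF AB(2) slice'[OF AB(3)] AB(4)] rlog_eq_Ad_llog[OF AB(2) slice'[OF AB(3)] AB(4)] g_def)
    finally show ?thesis using llog_section[OF op F', of r 0] llog_section[OF op F', of 0 0] r AB by simp
  qed
  let ?L = "\<lambda>x. llog G F x (1, 0)" and ?R = "\<lambda>x. rlog G F x (0, 1)"
  have L: "smooth_on S ?L" by (rule smooth_on_llog[OF S F smooth_on_const[OF S]])
  have R: "smooth_on S ?R" by (rule smooth_on_rlog[OF S F smooth_on_const[OF S]])
  have "((\<lambda>\<theta>. Ad G g (?L (0, \<theta>)) - rlog G F (0, 0) (1, 0)) has_vector_derivative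
      Ad G g (frechet_derivative ?L (at (0, 0)) (0, 1)) - 0) (at 0)"
    using smooth_on_section_derivative(2)[OF L assms(3)]
    by (intro has_vector_derivative_diff has_vector_derivative_const
        bounded_linear.has_vector_derivative[OF linear_conv_bounded_linear[THEN iffD1, OF linear_Ad]]) simp
  moreover have "open ((\<lambda>\<theta>. (0, \<theta>)) -` T)" by (intro open_vimage T continuous_intros)
  ultimately have "((\<lambda>\<theta>. f1 (0, \<theta>)) has_vector_derivative Ad G g (frechet_derivative ?L (at (0, 0)) (0, 1)) - 0) (at 0)"
    by (rule has_vector_derivative_transform_within_open) (use T f1_eq in auto)
  then have 1: "frechet_derivative f1 (at (0, 0)) (0, 1) = Ad G g (frechet_derivative ?L (at (0, 0)) (0, 1))"
    using vector_derivative_unique_at[OF smooth_on_section_derivative(2)[OF f1 T(2)]] by simp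
  have "((\<lambda>r. ?R (r, 0) - ?R (0, 0)) has_vector_derivative frechet_derivative ?R (at (0, 0)) (1, 0) - 0) (at 0)"
    using smooth_on_section_derivative(1)[OF R assms(3)]
    by (intro has_vector_derivative_diff has_vector_derivative_const) simp
  moreover have "open ((\<lambda>r. (r, 0)) -` T)" by (intro open_vimage T continuous_intros)
  ultimately have "((\<lambda>r. f2 (r, 0)) has_vector_derivative frechet_derivative ?R (at (0, 0)) (1, 0) - 0) (at 0)"
    by (rule has_vector_derivative_transform_within_open) (use T f2_eq in auto)
  then have 2: "frechet_derivative f2 (at (0, 0)) (1, 0) = frechet_derivative ?R (at (0, 0)) (1, 0)"
    using vector_derivative_unique_at[OF smooth_on_section_derivative(1)[OF f2 T(2)]] by simp
  show ?thesis using 1 2 mixed by (simp add: g_def)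
qed

text \<open>A form of the Maurer--Cartan equation that does not involve the bracket.\<close>
lemma maurer_cartan:
  fixes F :: "real \<times> real \<Rightarrow> 'g"
  assumes S: "open S" and F: "smooth_map_on G S F" and p: "p \<in> S"
  shows "frechet_derivative (\<lambda>x. rlog G F x (0, 1)) (at p) (1, 0) =
         Ad G (F p) (frechet_derivative (\<lambda>x. llog G F x (1, 0)) (at p) (0, 1))"
proof -
  \<comment> \<open>Translating the parameters moves p to the origin and leaves all derivatives in
    the equation unchanged.\<close>
  define k where "k = (\<lambda>x. p + x)"
  have k: "(k has_derivative (\<lambda>v. v)) (at x)" for x
    unfolding k_def by (auto intro!: derivative_eq_intros)
  have op: "open (k -` S)" unfolding k_def by (intro open_vimage S continuous_intros)
  have sk: "smooth_on (k -` S) k"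
    using op unfolding k_def by (intro smooth_on_add smooth_on_const smooth_on_id)
  have Fk: "smooth_map_on G (k -` S) (\<lambda>x. F (k x))" by (rule smooth_map_on_compose[OF op F sk _ S]) auto
  have k0: "k (0, 0) = p" by (simp add: k_def flip: zero_prod_def)
  have shift: "frechet_derivative (\<lambda>x. h' x) (at (0, 0)) v = frechet_derivative h (at p) v"
    if h: "smooth_on S h" and eq: "\<And>x. x \<in> k -` S \<Longrightarrow> h' x = h (k x)" for h h' :: "real \<times> real \<Rightarrow> complex^'n" and v
  proof -
    have "((\<lambda>x. h (k x)) has_derivative (\<lambda>v. frechet_derivative h (at p) v)) (at (0, 0))"
      by (rule has_derivative_compose[OF k]) (use k0 smooth_on_has_derivative[OF h p] in simp)
    then have "(h' has_derivative (\<lambda>v. frechet_derivative h (at p) v)) (at (0, 0))"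
      by (rule has_derivative_transform_within_open[OF _ op]) (use eq k0 p in auto)
    then show ?thesis using frechet_derivative_at by metis
  qed
  have "frechet_derivative (\<lambda>x. rlog G (\<lambda>x. F (k x)) x (0, 1)) (at (0, 0)) (1, 0) =
        frechet_derivative (\<lambda>x. rlog G F x (0, 1)) (at p) (1, 0)"
    by (rule shift[OF smooth_on_rlog[OF S F smooth_on_const[OF S]]])
      (use rlog_compose[OF S F _ k] in simp)
  moreover have "frechet_derivative (\<lambda>x. llog G (\<lambda>x. F (k x)) x (1, 0)) (at (0, 0)) (0, 1) =
        frechet_derivative (\<lambda>x. llog G F x (1, 0)) (at p) (0, 1)"
    by (rule shift[OF smooth_on_llog[OF S F smooth_on_const[OF S]]])
      (use llog_compose[OF S F _ k] in simp)
  ultimately show ?thesis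
    using maurer_cartan_at_zero[OF op Fk] k0 p by simp
qed

lemma maurer_cartan_vector_derivative:
  fixes F :: "real \<times> real \<Rightarrow> 'g"
  assumes S: "open S" and F: "smooth_map_on G S F" and p: "(r, \<theta>) \<in> S"
    and L: "((\<lambda>\<theta>. llog G F (r, \<theta>) (1, 0)) has_vector_derivative L') (at \<theta>)"
  shows "((\<lambda>r. rlog G F (r, \<theta>) (0, 1)) has_vector_derivative Ad G (F (r, \<theta>)) L') (at r)"
  using smooth_on_section_derivative(1)[OF smooth_on_rlog[OF S F smooth_on_const[OF S]] p, of "(0, 1)"]
    vector_derivative_unique_at[OF L, of "frechet_derivative (\<lambda>x. llog G F x (1, 0)) (at (r, \<theta>)) (0, 1)"]
    smooth_on_section_derivative(2)[OF smooth_on_llog[OF S F smooth_on_const[OF S]] p, of "(1, 0)"]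
    maurer_cartan[OF S F p] by simp

end

section \<open>The exponential map\<close>

context lie
begin

lemma llog_has_vector_derivative:
  assumes "open S" and "smooth_map_on G S c" and "s \<in> S"
  shows "((\<lambda>r. ch (inv (c s) \<otimes> c r)) has_vector_derivative llog G c s 1) (at s)"
  unfolding has_vector_derivative_def
  by (rule has_derivative_eq_rhs[OF llog_has_derivative[OF assms]])
    (rule ext, rule linear_real_eq[OF linear_llog[OF assms]])

text \<open>Near the identity the equation \<open>c\<^sup>-\<^sup>1 c' = X\<close> is an ordinary differential equation for the
  coordinates of \<open>c\<close>. By left invariance the initial value is irrelevant.\<close>
lemma flow_near_zero:
  obtains d :: real and c where "d > 0" and "smooth_map_on G {-d<..<d} c" and "c 0 = \<one>"
    and "\<And>s. s \<in> {-d<..<d} \<Longrightarrow> llog G c s 1 = X"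
proof -
  define S where "S = ch ` edom G"
  have S: "open S" "e0 \<in> S" unfolding S_def using edom(2) by auto
  define \<mu> where "\<mu> = (\<lambda>(a, b). ch (ich a \<otimes> ich b))"
  define Z where "Z = {(a, b). a \<in> ch ` edom G \<and> b \<in> ch ` edom G \<and> ich a \<otimes> ich b \<in> edom G}"
  have \<mu>: "smooth_on Z \<mu>" unfolding Z_def \<mu>_def by (rule smooth_mult_in_charts[OF echart echart echart])
  have Z: "(a, e0) \<in> Z" if "a \<in> S" for a using that unfolding Z_def S_def by auto
  \<comment> \<open>In coordinates, the left invariant vector field with value X at the identity:
    the derivative of b \<mapsto> a b at \<open>e0\<close> in the direction X.\<close>
  define F where "F = (\<lambda>a. frechet_derivative \<mu> (at (a, e0)) (0, X))"
  have F: "smooth_on S F"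
    unfolding F_def by (rule smooth_on_derivative_compose[OF S(1) \<mu>])
      (auto intro!: smooth_on_Pair S smooth_on_id smooth_on_const Z)
  obtain d x where d: "d > 0"
    and x: "\<And>s. s \<in> {0<..<d} \<Longrightarrow> x s \<in> S \<and> (x has_vector_derivative F (x s)) (at s)"
    using ode_local_existence[OF S(1) F S(2)] by blast
  define c where "c = (\<lambda>s. ich (x s))"
  have I: "open {0<..<d}" by simp
  have c: "smooth_map_on G {0<..<d} c"
    unfolding c_def
    by (rule smooth_map_on_compose[OF I smooth_map_on_ich smooth_on_ode_solution[OF I F]])
      (use x edom(2) in \<open>auto simp: S_def\<close>)
  have llog_c: "llog G c s 1 = X" if s: "s \<in> {0<..<d}" for s
  proof -
    have xs: "x s \<in> ch ` edom G" using x[OF s] by (simp add: S_def)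
    then have cs: "c s \<in> edom G" "ch (c s) = x s" unfolding c_def by (auto simp: f_inv_into_f)
    define D where "D = (\<lambda>v. frechet_derivative \<mu> (at (x s, e0)) (0, v))"
    have D: "((\<lambda>b. ch (c s \<otimes> ich b)) has_derivative D) (at e0)"
    proof -
      have "((\<lambda>b. \<mu> (x s, b)) has_derivative D) (at e0)"
        unfolding D_def
        by (rule has_derivative_compose[of "\<lambda>b. (x s, b)"])
          (auto intro!: derivative_eq_intros smooth_on_has_derivative[OF \<mu>] Z xs simp: S_def)
      then show ?thesis by (simp add: \<mu>_def c_def)
    qed
    have sm: "smooth_map_on G (ch ` edom G) (\<lambda>p. inv (c s) \<otimes> ich p)"
      by (intro smooth_map_on_mult smooth_map_on_ich smooth_map_on_const edom(2))
    have "inv (c s) \<otimes> ich (x s) = \<one>" by (simp add: c_def)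
    \<comment> \<open>E is the derivative of the translation back to the identity. It undoes D
      because the two translations compose to the identity near \<open>e0\<close>.\<close>
    then obtain E where E: "((\<lambda>p. ch (inv (c s) \<otimes> ich p)) has_derivative E) (at (x s))"
      using has_derivative_near_one[OF edom(2) sm xs] by blast
    have "((\<lambda>b. ch (inv (c s) \<otimes> ich (ch (c s \<otimes> ich b)))) has_derivative (\<lambda>v. E (D v))) (at e0)"
      by (rule has_derivative_compose[OF D]) (use E cs in simp)
    moreover have "open {b \<in> ch ` edom G. c s \<otimes> ich b \<in> edom G}"
    proof -
      have "continuous_on (ch ` edom G) (\<lambda>b. c s \<otimes> ich b)"
        by (intro continuous_mult continuous_on_const edom(5))
      from open_vimage_Int[OF edom(2) this edom(1)] show ?thesis
        by (simp add: Int_def vimage_def)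
    qed
    ultimately have "((\<lambda>b. b) has_derivative (\<lambda>v. E (D v))) (at e0)"
      by (rule has_derivative_transform_within_open) (use cs in \<open>auto simp: f_inv_into_f\<close>)
    then have ED: "E (D v) = v" for v using has_derivative_unique[OF has_derivative_ident] by metis
    have "((\<lambda>r. ch (inv (c s) \<otimes> ich (x r))) has_derivative (\<lambda>h. E (h *\<^sub>R F (x s)))) (at s)"
      by (rule has_derivative_compose[where f = x and g = "\<lambda>p. ch (inv (c s) \<otimes> ich p)", OF _ E]) (use x[OF s] in \<open>simp add: has_vector_derivative_def\<close>)
    then have "llog G c s = (\<lambda>h. E (h *\<^sub>R F (x s)))" by (intro llog_unique) (simp add: c_def)
    then have "llog G c s 1 = E (D X)" by (simp add: F_def D_def)
    then show ?thesis using ED by simp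
  qed
  \<comment> \<open>The solution is known on the open interval (0, d) only. Restarting it at d/2 and
    translating to the identity gives a flow line on a symmetric interval around 0.\<close>
  define k where "k = (\<lambda>s. d/2 + s)"
  have k: "(k has_derivative (\<lambda>v. v)) (at x)" for x unfolding k_def by (auto intro!: derivative_eq_intros)
  have kI: "k s \<in> {0<..<d}" if "s \<in> {-(d/2)<..<d/2}" for s using that by (auto simp: k_def)
  show thesis
  proof (rule that[of "d/2" "\<lambda>s. inv (c (d/2)) \<otimes> c (k s)"])
    show "smooth_map_on G {-(d/2)<..<d/2} (\<lambda>s. inv (c (d/2)) \<otimes> c (k s))"
      by (intro smooth_map_on_mult smooth_map_on_const smooth_map_on_compose[OF _ c])
        (use kI in \<open>auto simp: k_def intro!: smooth_on_add smooth_on_const smooth_on_id\<close>)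
    show "llog G (\<lambda>s. inv (c (d/2)) \<otimes> c (k s)) s 1 = X" if "s \<in> {-(d/2)<..<d/2}" for s
      using llog_compose[OF I c kI[OF that] k] llog_c[OF kI[OF that]] by (simp add: llog_const_mult)
  qed (use d in \<open>auto simp: k_def\<close>)
qed

lemma has_derivative_times_const: "((\<lambda>s. s * a :: real) has_derivative (\<lambda>v. v * a)) (at s)"
  by (auto intro!: derivative_eq_intros)

text \<open>If \<open>c\<close> is a flow line on \<open>(-d, d)\<close>, then \<open>c (s/2)\<^sup>2\<close> is one on \<open>(-2d, 2d)\<close>, since \<open>c\<close> is a local
  homomorphism and so \<open>Ad (c s) X = X\<close>.\<close>
lemma flow_double:
  fixes c :: "real \<Rightarrow> 'g" and d :: real
  assumes d: "d > 0" and c: "smooth_map_on G {-d<..<d} c" "c 0 = \<one>"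
    and X: "\<And>s. s \<in> {-d<..<d} \<Longrightarrow> llog G c s 1 = X"
  shows "\<exists>c'. smooth_map_on G {-(2*d)<..<2*d} c' \<and> c' 0 = \<one> \<and> (\<forall>s\<in>{-(2*d)<..<2*d}. llog G c' s 1 = X)"
proof -
  have I: "open {-d<..<d}" by simp
  \<comment> \<open>For fixed r both sides are flow lines in u with the same value at u = 0, on an
    interval where both are defined.\<close>
  have hom: "c (r + u) = c r \<otimes> c u" if r: "r \<in> {-d<..<d}" and u: "u \<in> {-d<..<d}" "r + u \<in> {-d<..<d}" for r u
  proof -
    define S where "S = {-d<..<d} \<inter> {-d-r<..<d-r}"
    have S: "open S" "connected S" "0 \<in> S" "u \<in> S" "S \<subseteq> {-d<..<d}" "(\<lambda>u. r + u) ` S \<subseteq> {-d<..<d}"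
      using r u d by (auto simp: S_def intro!: convex_connected convex_Int)
    have k: "((\<lambda>u. r + u) has_derivative (\<lambda>v. v)) (at u)" for u by (auto intro!: derivative_eq_intros)
    have sm1: "smooth_map_on G S (\<lambda>u. c (r + u))"
      by (rule smooth_map_on_compose[OF S(1) c(1) _ S(6) I]) (intro smooth_on_add S smooth_on_const smooth_on_id)
    have sm2: "smooth_map_on G S (\<lambda>u. c r \<otimes> c u)"
      by (intro smooth_map_on_mult smooth_map_on_const S smooth_map_on_subset[OF c(1) S(5)])
    show ?thesis
    proof (rule eq_if_llog_eq[OF S(1,2) sm1 sm2 _ S(3) _ S(4)])
      fix s assume s: "s \<in> S"
      have "llog G (\<lambda>u. c (r + u)) s 1 = X"
        using llog_compose[OF I c(1), of "\<lambda>u. r + u" s, OF _ k] X S(6) s by auto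
      moreover have "llog G (\<lambda>u. c r \<otimes> c u) s 1 = X" using X S(5) s by (auto simp: llog_const_mult)
      ultimately show "llog G (\<lambda>u. c (r + u)) s 1 = llog G (\<lambda>u. c r \<otimes> c u) s 1" by simp
    qed (simp add: c(2))
  qed
  \<comment> \<open>c s commutes with c r for small r, so conjugation by c s fixes the curve c near
    0 and \<open>Ad\<close> fixes its velocity X.\<close>
  have Ad_c: "Ad G (c s) X = X" if s: "s \<in> {-d<..<d}" for s
  proof -
    define e where "e = d - \<bar>s\<bar>"
    have e: "e > 0" "{-e<..<e} \<subseteq> {-d<..<d}" using s by (auto simp: e_def)
    have c': "smooth_map_on G {-e<..<e} c" using smooth_map_on_subset[OF c(1) e(2)] .
    have "c s \<otimes> c r \<otimes> inv (c s) = c r" if r: "r \<in> {-e<..<e}" for r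
    proof -
      have "s + r \<in> {-d<..<d}" "r \<in> {-d<..<d}" using r s by (auto simp: e_def)
      then have "c s \<otimes> c r = c r \<otimes> c s" using hom[OF s, of r] hom[of r s] s by (simp add: add.commute)
      then show ?thesis by (simp add: mult_assoc)
    qed
    moreover have "((\<lambda>r. ch (c s \<otimes> c r \<otimes> inv (c s))) has_derivative
        (\<lambda>v. Ad G (c s) (frechet_derivative (\<lambda>y. ch (c y)) (at 0) v))) (at 0)"
      by (rule derivative_conj_near_one[OF _ c']) (use e c(2) in auto)
    ultimately have 1: "((\<lambda>r. ch (c r)) has_derivative
        (\<lambda>v. Ad G (c s) (frechet_derivative (\<lambda>y. ch (c y)) (at 0) v))) (at 0)"
      by (elim has_derivative_transform_within_open[of _ _ _ _ "{-e<..<e}"]) (use e in auto)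
    have 2: "frechet_derivative (\<lambda>y. ch (c y)) (at 0) = llog G c 0" by (simp add: llog_def c(2))
    have "((\<lambda>r. ch (c r)) has_derivative llog G c 0) (at 0)"
      using llog_has_derivative[OF I c(1), of 0] d c(2) by simp
    from has_derivative_unique[OF this 1[unfolded 2]] have "llog G c 0 1 = Ad G (c s) (llog G c 0 1)"
      by (rule fun_cong)
    then show ?thesis using X[of 0] d by simp
  qed
  define k where "k = (\<lambda>s::real. s * (1/2))"
  have k: "(k has_derivative (\<lambda>v. v * (1/2))) (at s)" for s unfolding k_def by (rule has_derivative_times_const)
  have kI: "k s \<in> {-d<..<d}" if "s \<in> {-(2*d)<..<2*d}" for s using that by (auto simp: k_def)
  have J: "open {-(2*d)<..<2*d}" by simp
  have ck: "smooth_map_on G {-(2*d)<..<2*d} (\<lambda>s. c (k s))"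
    by (rule smooth_map_on_compose[OF J c(1)])
      (use kI in \<open>auto simp: k_def[abs_def] simp del: times_divide_eq_right
        intro!: smooth_on_bounded_linear[OF _ bounded_linear_mult_left]\<close>)
  \<comment> \<open>Each factor contributes X/2, since the inner map halves the speed and
    \<open>Ad\<close> fixes X.\<close>
  have "llog G (\<lambda>s. c (k s) \<otimes> c (k s)) s 1 = X" if s: "s \<in> {-(2*d)<..<2*d}" for s
  proof -
    have half: "llog G (\<lambda>s. c (k s)) s 1 = (1/2) *\<^sub>R X"
    proof -
      have "llog G (\<lambda>s. c (k s)) s 1 = llog G c (k s) (1/2)"
        using llog_compose[OF I c(1) kI[OF s] k, of 1] by simp
      then show ?thesis
        using linear_real_eq[OF linear_llog[OF I c(1) kI[OF s]], of "1/2"] X[OF kI[OF s]] by simp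
    qed
    have "Ad G (inv (c (k s))) X = X" using Ad_c[OF kI[OF s]] Ad_inv(1) by metis
    then show ?thesis using llog_mult[OF J ck ck s, of 1] half by (simp flip: scaleR_left_distrib)
  qed
  moreover have "c (k 0) \<otimes> c (k 0) = \<one>" using c(2) by (simp add: k_def)
  ultimately show ?thesis using smooth_map_on_mult[OF J ck ck] by blast
qed

text \<open>Repeated doubling gives flow lines on the intervals (-2^n d, 2^n d), which exhaust the
  line. They agree on overlaps by uniqueness and glue.\<close>

lemma flow_exists:
  obtains c :: "real \<Rightarrow> 'g" where "smooth_map_on G UNIV c" and "c 0 = \<one>" and "\<And>s. llog G c s 1 = X"
proof -
  obtain d :: real and c0 :: "real \<Rightarrow> 'g" where d: "d > 0" and c0: "smooth_map_on G {-d<..<d} c0" "c0 0 = \<one>"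
    "\<And>s. s \<in> {-d<..<d} \<Longrightarrow> llog G c0 s 1 = X"
    using flow_near_zero[of X] by blast
  define I where "I = (\<lambda>n::nat. {-(2^n*d)<..<2^n*d})"
  have I: "open (I n)" "connected (I n)" "0 \<in> I n" for n using d by (auto simp: I_def)
  have Imono: "I m \<subseteq> I n" if "m \<le> n" for m n
  proof -
    have "(2::real)^m * d \<le> 2^n * d" using that d by (intro mult_right_mono power_increasing) auto
    then show ?thesis by (auto simp: I_def)
  qed
  have "\<exists>c. smooth_map_on G (I n) c \<and> c 0 = \<one> \<and> (\<forall>s\<in>I n. llog G c s 1 = X)" for n
  proof (induction n)
    case 0
    then show ?case using c0 by (auto simp: I_def)
  next
    case (Suc n)
    then obtain c where c: "smooth_map_on G (I n) c" "c 0 = \<one>" "\<And>s. s \<in> I n \<Longrightarrow> llog G c s 1 = X" by blast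
    have "2^n * d > 0" using d by simp
    from flow_double[OF this, of c X] c show ?case unfolding I_def by (simp add: mult.assoc)
  qed
  then obtain C where C: "\<And>n. smooth_map_on G (I n) (C n)" "\<And>n. C n 0 = \<one>"
    "\<And>n s. s \<in> I n \<Longrightarrow> llog G (C n) s 1 = X" by metis
  have agree: "C m s = C n s" if "m \<le> n" "s \<in> I m" for m n s
    by (rule eq_if_llog_eq[OF I(1,2) C(1) smooth_map_on_subset[OF C(1) Imono[OF that(1)]] _ I(3) _ that(2)])
      (use C Imono[OF that(1)] in auto)
  have ex: "\<exists>n. s \<in> I n" for s
  proof -
    obtain n where "\<bar>s\<bar> / d < 2^n" using real_arch_pow[of 2 "\<bar>s\<bar> / d"] by auto
    then have "\<bar>s\<bar> < 2^n * d" using d by (simp add: field_simps)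
    then show ?thesis by (auto simp: I_def intro!: exI[of _ n])
  qed
  define c where "c = (\<lambda>s. C (LEAST n. s \<in> I n) s)"
  have c_eq: "c s = C n s" if "s \<in> I n" for s n
    unfolding c_def by (rule agree[OF Least_le[of "\<lambda>n. s \<in> I n", OF that] LeastI[of "\<lambda>n. s \<in> I n", OF that]])
  have sm: "smooth_map_on G (I n) c" for n
    by (rule smooth_map_on_cong[OF I(1) _ C(1)]) (simp add: c_eq)
  show thesis
  proof (rule that[of c])
    show "smooth_map_on G UNIV c"
    proof (rule smooth_map_on_local)
      fix s
      obtain n where "s \<in> I n" using ex by blast
      then show "\<exists>T. open T \<and> s \<in> T \<and> smooth_map_on G T c" using I(1)[of n] sm[of n] by blast
    qed
    show "c 0 = \<one>" using c_eq[OF I(3)] C(2) by simp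
    show "llog G c s 1 = X" for s
    proof -
      obtain n where n: "s \<in> I n" using ex by blast
      have "((\<lambda>y. ch (inv (C n s) \<otimes> C n y)) has_derivative llog G (C n) s) (at s)"
        by (rule llog_has_derivative[OF I(1) C(1) n])
      then have "((\<lambda>y. ch (inv (c s) \<otimes> c y)) has_derivative llog G (C n) s) (at s)"
        by (rule has_derivative_transform_within_open[OF _ I(1) n]) (use c_eq n in simp)
      then have "llog G c s = llog G (C n) s" by (rule llog_unique)
      then show ?thesis using C(3)[OF n] by simp
    qed
  qed
qed

text \<open>Replaces the homomorphism property by a differential equation, to which existence and
  uniqueness for \<open>llog\<close> apply.\<close>

lemma one_parameter_subgroup_iff:
  "one_parameter_subgroup G X c \<longleftrightarrow> smooth_map_on G UNIV c \<and> c 0 = \<one> \<and> (\<forall>s. llog G c s 1 = X)"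
proof safe
  assume c: "one_parameter_subgroup G X c"
  then show sm: "smooth_map_on G UNIV c" by (simp add: one_parameter_subgroup_def)
  have hom: "c (s + r) = c s \<otimes> c r" for s r using c by (simp add: one_parameter_subgroup_def)
  from hom[of 0 0] show c0: "c 0 = \<one>" by (metis add_0 mult_left_cancel mult_one(2))
  have D: "((\<lambda>s. ch (c s)) has_derivative (\<lambda>h. h *\<^sub>R X)) (at 0)"
    using c by (simp add: one_parameter_subgroup_def has_vector_derivative_def)
  show "llog G c s 1 = X" for s
  proof -
    have "((\<lambda>r. r - s) has_derivative (\<lambda>h. h)) (at s)" by (auto intro!: derivative_eq_intros)
    from has_derivative_compose[OF this, of "\<lambda>s. ch (c s)" "\<lambda>h. h *\<^sub>R X"] D
    have "((\<lambda>r. ch (c (r - s))) has_derivative (\<lambda>h. h *\<^sub>R X)) (at s)" by simp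
    moreover have "c (r - s) = inv (c s) \<otimes> c r" for r using hom[of s "r - s"] by simp
    ultimately have "llog G c s = (\<lambda>h. h *\<^sub>R X)" by (intro llog_unique) simp
    then show ?thesis by simp
  qed
next
  assume sm: "smooth_map_on G UNIV c" and c0: "c 0 = \<one>" and X: "\<forall>s. llog G c s 1 = X"
  have "c (s + r) = c s \<otimes> c r" for s r
  proof -
    have k: "((\<lambda>u. s + u) has_derivative (\<lambda>v. v)) (at u)" for u by (auto intro!: derivative_eq_intros)
    have sm1: "smooth_map_on G UNIV (\<lambda>u. c (s + u))"
      by (rule smooth_map_on_compose[OF _ sm]) (auto intro!: smooth_on_add)
    have sm2: "smooth_map_on G UNIV (\<lambda>u. c s \<otimes> c u)" by (intro smooth_map_on_mult smooth_map_on_const sm) auto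
    have "llog G (\<lambda>u. c (s + u)) u 1 = X" for u
      using llog_compose[OF open_UNIV sm UNIV_I k] X by simp
    moreover have "llog G (\<lambda>u. c s \<otimes> c u) u 1 = X" for u using X by (simp add: llog_const_mult)
    ultimately show ?thesis
      using eq_if_llog_eq[OF open_UNIV connected_UNIV sm1 sm2, of 0 r] by (simp add: c0)
  qed
  moreover have "((\<lambda>s. ch (c s)) has_vector_derivative X) (at 0)"
    using llog_has_vector_derivative[OF open_UNIV sm, of 0] X c0 by simp
  ultimately show "one_parameter_subgroup G X c" using sm by (simp add: one_parameter_subgroup_def)
qed

lemma one_parameter_subgroup_unique:
  assumes "one_parameter_subgroup G X c" and "one_parameter_subgroup G X c'"
  shows "c = c'"
proof (rule ext)
  show "c s = c' s" for s
    by (rule eq_if_llog_eq[OF open_UNIV connected_UNIV, of _ _ 0])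
      (use assms in \<open>auto simp: one_parameter_subgroup_iff\<close>)
qed

text \<open>\<open>lie_exp\<close> evaluates at time 1. Rescaling the time of a one-parameter
  subgroup for X gives one for s X, whose value at 1 is c s.\<close>

lemma lie_exp_eq:
  assumes "one_parameter_subgroup G X c"
  shows "lie_exp G (s *\<^sub>R X) = c s"
proof -
  have c: "smooth_map_on G UNIV c" "c 0 = \<one>" "\<And>s. llog G c s 1 = X"
    using assms by (auto simp: one_parameter_subgroup_iff)
  have k: "((\<lambda>r. r * s) has_derivative (\<lambda>v. v * s)) (at r)" for r by (rule has_derivative_times_const)
  have "llog G (\<lambda>r. c (r * s)) r 1 = s *\<^sub>R X" for r
    using llog_compose[OF open_UNIV c(1) UNIV_I k, of r 1] linear_real_eq[OF linear_llog[OF open_UNIV c(1) UNIV_I], of "r * s" s] c(3)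
    by simp
  moreover have "smooth_map_on G UNIV (\<lambda>r. c (r * s))"
    by (rule smooth_map_on_compose[OF _ c(1)]) (auto intro!: smooth_on_bounded_linear bounded_linear_mult_left)
  ultimately have "one_parameter_subgroup G (s *\<^sub>R X) (\<lambda>r. c (r * s))"
    by (simp add: one_parameter_subgroup_iff c(2))
  from the_equality[of "one_parameter_subgroup G (s *\<^sub>R X)", OF this one_parameter_subgroup_unique[OF _ this]]
  have "(THE c. one_parameter_subgroup G (s *\<^sub>R X) c) = (\<lambda>r. c (r * s))" .
  then show ?thesis by (simp add: lie_exp_def)
qed

lemma one_parameter_subgroup_lie_exp: "one_parameter_subgroup G X (\<lambda>s. lie_exp G (s *\<^sub>R X))"
proof -
  obtain c :: "real \<Rightarrow> 'g" where "smooth_map_on G UNIV c" "c 0 = \<one>" "\<And>s. llog G c s 1 = X"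
    using flow_exists[of X] by blast
  then have c: "one_parameter_subgroup G X c" by (simp add: one_parameter_subgroup_iff)
  then have "(\<lambda>s. lie_exp G (s *\<^sub>R X)) = c" using lie_exp_eq by blast
  then show ?thesis using c by simp
qed

section \<open>Exponentials of commuting elements\<close>

lemma smooth_lie_exp: "smooth_map_on G UNIV (\<lambda>s. lie_exp G (s *\<^sub>R X))"
  and lie_exp_zero [simp]: "lie_exp G 0 = \<one>"
  and llog_lie_exp: "llog G (\<lambda>s. lie_exp G (s *\<^sub>R X)) s 1 = X"
  using one_parameter_subgroup_lie_exp[of X] by (auto simp: one_parameter_subgroup_iff)

lemma lie_exp_mult: "lie_exp G ((s + r) *\<^sub>R X) = lie_exp G (s *\<^sub>R X) \<otimes> lie_exp G (r *\<^sub>R X)"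
  using one_parameter_subgroup_lie_exp[of X] by (simp add: one_parameter_subgroup_def)

text \<open>The values of a one-parameter subgroup commute, so its left and right quotients are the
  same curve.\<close>

lemma rlog_lie_exp: "rlog G (\<lambda>s. lie_exp G (s *\<^sub>R X)) s 1 = X"
proof -
  have "lie_exp G (r *\<^sub>R X) \<otimes> inv (lie_exp G (s *\<^sub>R X)) = inv (lie_exp G (s *\<^sub>R X)) \<otimes> lie_exp G (r *\<^sub>R X)" for r
  proof -
    have "lie_exp G (s *\<^sub>R X) \<otimes> lie_exp G (r *\<^sub>R X) = lie_exp G (r *\<^sub>R X) \<otimes> lie_exp G (s *\<^sub>R X)"
      by (simp only: lie_exp_mult[symmetric] add.commute)
    then have "inv (lie_exp G (s *\<^sub>R X)) \<otimes> (lie_exp G (s *\<^sub>R X) \<otimes> lie_exp G (r *\<^sub>R X)) \<otimes> inv (lie_exp G (s *\<^sub>R X))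
       = inv (lie_exp G (s *\<^sub>R X)) \<otimes> (lie_exp G (r *\<^sub>R X) \<otimes> lie_exp G (s *\<^sub>R X)) \<otimes> inv (lie_exp G (s *\<^sub>R X))"
      by simp
    then show ?thesis by (simp add: mult_assoc)
  qed
  then have "rlog G (\<lambda>s. lie_exp G (s *\<^sub>R X)) s = llog G (\<lambda>s. lie_exp G (s *\<^sub>R X)) s"
    by (simp add: rlog_def llog_def)
  then show ?thesis using llog_lie_exp by simp
qed

text \<open>s \<mapsto> Ad (exp (s X)) Y has derivative [X, Y] = 0 at 0, and the homomorphism
  property carries this to every s.\<close>

lemma Ad_lie_exp_fixed:
  assumes "bracket G X Y = 0"
  shows "Ad G (lie_exp G X) Y = Y"
proof -
  let ?c = "\<lambda>s. lie_exp G (s *\<^sub>R X)"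
  have mult: "?c y = ?c s \<otimes> ?c (y - s)" for y s
    using lie_exp_mult[of s "y - s" X] by simp
  have "((\<lambda>y. Ad G (?c y) Y) has_derivative (\<lambda>v. 0)) (at s within UNIV)" for s
  proof -
    have r: "rlog G ?c 0 v = v *\<^sub>R X" for v
      using linear_real_eq[OF linear_rlog[OF open_UNIV smooth_lie_exp], of 0 X v] by (simp add: rlog_lie_exp)
    have "((\<lambda>y. Ad G (?c y) Y) has_derivative (\<lambda>v. bracket G (rlog G ?c 0 v) (Ad G (?c 0) Y))) (at 0)"
      by (rule Ad_derivative_rlog[OF open_UNIV smooth_lie_exp]) simp
    then have D0: "((\<lambda>y. Ad G (?c y) Y) has_derivative (\<lambda>v. 0)) (at 0)"
      using linear_scale[OF linear_bracket_left, of _ X Y] assms by (simp add: r)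
    have "((\<lambda>y. y - s) has_derivative (\<lambda>v. v)) (at s)" by (auto intro!: derivative_eq_intros)
    from has_derivative_compose[OF this, of "\<lambda>y. Ad G (?c y) Y" "\<lambda>v. 0"] D0
    have "((\<lambda>y. Ad G (?c (y - s)) Y) has_derivative (\<lambda>v. 0)) (at s)" by simp
    from bounded_linear.has_derivative[OF linear_conv_bounded_linear[THEN iffD1, OF linear_Ad[of "?c s"]] this]
    have "((\<lambda>y. Ad G (?c s \<otimes> ?c (y - s)) Y) has_derivative (\<lambda>v. 0)) (at s)" by (simp add: Ad_mult)
    then show ?thesis by (simp only: flip: mult)
  qed
  from has_derivative_zero_unique[OF convex_UNIV this UNIV_I UNIV_I, of 1 0]
  show ?thesis by simp
qed

text \<open>In s, both exp (s (X + Y)) and exp (s X) exp (s Y) have right logarithmic derivative X +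
  Y, since \<open>Ad\<close> of exp (s X) fixes Y.\<close>

lemma lie_exp_add:
  assumes "bracket G X Y = 0"
  shows "lie_exp G (X + Y) = lie_exp G X \<otimes> lie_exp G Y"
proof -
  have Ad: "Ad G (lie_exp G (s *\<^sub>R X)) Y = Y" for s
    using Ad_lie_exp_fixed[of "s *\<^sub>R X" Y] linear_scale[OF linear_bracket_left, of s X Y] assms by simp
  have sm: "smooth_map_on G UNIV (\<lambda>s. lie_exp G (s *\<^sub>R X) \<otimes> lie_exp G (s *\<^sub>R Y))"
    by (intro smooth_map_on_mult smooth_lie_exp open_UNIV)
  have "rlog G (\<lambda>s. lie_exp G (s *\<^sub>R X) \<otimes> lie_exp G (s *\<^sub>R Y)) s 1 = X + Y" for s
    by (simp add: rlog_mult[OF open_UNIV smooth_lie_exp smooth_lie_exp] rlog_lie_exp Ad)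
  then have "lie_exp G (1 *\<^sub>R (X + Y)) = lie_exp G (1 *\<^sub>R X) \<otimes> lie_exp G (1 *\<^sub>R Y)"
    using eq_if_rlog_eq[OF open_UNIV connected_UNIV smooth_lie_exp[of "X + Y"] sm, of 0 1]
    by (simp add: rlog_lie_exp)
  then show ?thesis by simp
qed

end

section \<open>Smooth families of loops\<close>

text \<open>For a family F of loops, \<open>lvel\<close> and \<open>rvel\<close> are the loops
  F^{-1} F' and F' F^{-1}, where the prime is the derivative in the parameter. The pair
  \<open>langle\<close> and \<open>rangle\<close> differentiates a single loop in the angle; since
  \<lambda> = cis \<theta>, that is \<i> \<lambda> times the derivative in \<lambda>.\<close>

definition lvel :: "('g, 'n::finite) lie_group \<Rightarrow> (real \<Rightarrow> real \<Rightarrow> 'g) \<Rightarrow> real \<Rightarrow> real \<Rightarrow> complex^'n" where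
  "lvel G F s = (\<lambda>\<theta>. llog G (\<lambda>r. F r \<theta>) s 1)"

definition rvel :: "('g, 'n::finite) lie_group \<Rightarrow> (real \<Rightarrow> real \<Rightarrow> 'g) \<Rightarrow> real \<Rightarrow> real \<Rightarrow> complex^'n" where
  "rvel G F s = (\<lambda>\<theta>. rlog G (\<lambda>r. F r \<theta>) s 1)"

definition langle :: "('g, 'n::finite) lie_group \<Rightarrow> (real \<Rightarrow> 'g) \<Rightarrow> real \<Rightarrow> complex^'n" where
  "langle G g = (\<lambda>\<theta>. llog G g \<theta> 1)"

definition rangle :: "('g, 'n::finite) lie_group \<Rightarrow> (real \<Rightarrow> 'g) \<Rightarrow> real \<Rightarrow> complex^'n" where
  "rangle G g = (\<lambda>\<theta>. rlog G g \<theta> 1)"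

lemma smooth_on_vector_derivative:
  assumes "open S" and "smooth_on S f"
  shows "smooth_on S (\<lambda>s. vector_derivative f (at s))"
    and "\<And>s. s \<in> S \<Longrightarrow> (f has_vector_derivative vector_derivative f (at s)) (at s)"
proof -
  have eq: "vector_derivative f (at s) = frechet_derivative f (at s) 1" if "s \<in> S" for s
    using smooth_on_has_vector_derivative[OF assms(2) that] by (rule vector_derivative_at)
  show "smooth_on S (\<lambda>s. vector_derivative f (at s))"
    by (rule smooth_on_cong[OF assms(1) _ smooth_on_derivative[OF assms(2)]]) (use eq in auto)
  show "\<And>s. s \<in> S \<Longrightarrow> (f has_vector_derivative vector_derivative f (at s)) (at s)"
    using smooth_on_has_vector_derivative[OF assms(2)] eq by simp
qed

lemma smooth_on_slice:
  fixes f :: "'a::euclidean_space \<times> real \<Rightarrow> 'b::real_normed_vector"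
  assumes "smooth_on (S \<times> UNIV) f" and "s \<in> S"
  shows "smooth_on UNIV (\<lambda>\<theta>. f (s, \<theta>))"
  by (rule smooth_on_compose[OF open_UNIV assms(1)])
    (use assms(2) in \<open>auto intro!: smooth_on_Pair smooth_on_const smooth_on_id\<close>)

context lie
begin

section \<open>Pointwise operations on loops and on families of loops\<close>

lemma loop_group_simps [simp]:
  "mult (loop_group G) \<alpha> \<beta> = (\<lambda>\<theta>. \<alpha> \<theta> \<otimes> \<beta> \<theta>)"
  "one (loop_group G) = (\<lambda>\<theta>. \<one>)"
  by (simp_all add: loop_group_def)

lemma loop_group_carrier:
  "\<gamma> \<in> carrier (loop_group G) \<longleftrightarrow> (\<forall>\<theta>. \<gamma> (\<theta> + 2 * pi) = \<gamma> \<theta>) \<and> smooth_map_on G UNIV \<gamma>"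
  by (simp add: loop_group_def)

lemma group_loop_group: "group (loop_group G)"
proof (rule groupI)
  show "\<And>x y. x \<in> carrier (loop_group G) \<Longrightarrow> y \<in> carrier (loop_group G) \<Longrightarrow>
      x \<otimes>\<^bsub>loop_group G\<^esub> y \<in> carrier (loop_group G)"
    by (auto simp: loop_group_carrier intro!: smooth_map_on_mult)
  show "\<one>\<^bsub>loop_group G\<^esub> \<in> carrier (loop_group G)"
    by (auto simp: loop_group_carrier)
  fix x assume "x \<in> carrier (loop_group G)"
  then have "(\<lambda>\<theta>. inv (x \<theta>)) \<in> carrier (loop_group G)"
    by (auto simp: loop_group_carrier intro!: smooth_map_on_inv)
  then show "\<exists>y\<in>carrier (loop_group G). y \<otimes>\<^bsub>loop_group G\<^esub> x = \<one>\<^bsub>loop_group G\<^esub>"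
    by (rule bexI[rotated]) simp
qed (auto simp: mult_assoc)

lemma loop_inv: "x \<in> carrier (loop_group G) \<Longrightarrow> inv\<^bsub>loop_group G\<^esub> x = (\<lambda>\<theta>. inv (x \<theta>))"
  by (rule group.inv_equality[OF group_loop_group])
    (auto simp: loop_group_carrier intro!: smooth_map_on_inv)

lemma loop_carrier_mult:
  "x \<in> carrier (loop_group G) \<Longrightarrow> y \<in> carrier (loop_group G) \<Longrightarrow> (\<lambda>\<theta>. x \<theta> \<otimes> y \<theta>) \<in> carrier (loop_group G)"
  using group.is_monoid[OF group_loop_group] monoid.m_closed by fastforce

lemma loop_carrier_inv: "x \<in> carrier (loop_group G) \<Longrightarrow> (\<lambda>\<theta>. inv (x \<theta>)) \<in> carrier (loop_group G)"
  using group.inv_closed[OF group_loop_group] loop_inv by metis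

lemma smooth_familyD:
  assumes "smooth_family G S F"
  shows "\<And>s. s \<in> S \<Longrightarrow> F s \<in> carrier (loop_group G)"
    and "smooth_map_on G (S \<times> UNIV) (\<lambda>x. F (fst x) (snd x))"
    and "\<And>s \<theta>. s \<in> S \<Longrightarrow> F s (\<theta> + 2 * pi) = F s \<theta>"
    and "\<And>s. s \<in> S \<Longrightarrow> smooth_map_on G UNIV (F s)"
  using assms by (auto simp: smooth_family_def loop_group_carrier case_prod_unfold)

lemma smooth_familyI:
  assumes "\<And>s. s \<in> S \<Longrightarrow> F s \<in> carrier (loop_group G)"
    and "smooth_map_on G (S \<times> UNIV) (\<lambda>x. F (fst x) (snd x))"
  shows "smooth_family G S F"
  using assms by (auto simp: smooth_family_def case_prod_unfold)

lemma open_strip: "open S \<Longrightarrow> open (S \<times> (UNIV :: real set))"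
  by (simp add: open_Times)

lemma smooth_family_mult:
  fixes S :: "'a::real_normed_vector set"
  assumes "open S" and "smooth_family G S F" and "smooth_family G S H"
  shows "smooth_family G S (\<lambda>s \<theta>. F s \<theta> \<otimes> H s \<theta>)"
  using smooth_familyD[OF assms(2)] smooth_familyD[OF assms(3)] open_strip[OF assms(1)]
  by (intro smooth_familyI loop_carrier_mult smooth_map_on_mult) auto

lemma smooth_family_inv:
  fixes S :: "'a::real_normed_vector set"
  assumes "open S" and "smooth_family G S F"
  shows "smooth_family G S (\<lambda>s \<theta>. inv (F s \<theta>))"
  using smooth_familyD[OF assms(2)] open_strip[OF assms(1)]
  by (intro smooth_familyI loop_carrier_inv smooth_map_on_inv) auto

lemma smooth_family_const:
  fixes S :: "'a::euclidean_space set"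
  assumes "open S" and "g \<in> carrier (loop_group G)"
  shows "smooth_family G S (\<lambda>s. g)"
proof (rule smooth_familyI)
  show "smooth_map_on G (S \<times> UNIV) (\<lambda>x. g (snd x))"
    by (rule smooth_map_on_compose[OF open_strip[OF assms(1)], where T = UNIV])
      (use assms open_strip in \<open>auto simp: loop_group_carrier intro!: smooth_on_snd smooth_on_id\<close>)
qed (use assms in auto)

lemma smooth_family_compose:
  fixes S :: "'b::euclidean_space set" and U :: "'a::euclidean_space set"
  assumes "open S" and "open U" and "smooth_family G U F" and "smooth_on S k" and "k ` S \<subseteq> U"
  shows "smooth_family G S (\<lambda>s. F (k s))"
proof (rule smooth_familyI)
  have "smooth_on (S \<times> UNIV) (\<lambda>x :: 'b \<times> real. k (fst x))"
    by (rule smooth_on_compose[OF open_strip[OF assms(1)] assms(4)])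
      (use open_strip[OF assms(1)] in \<open>auto intro!: smooth_on_fst\<close>)
  then have sm: "smooth_on (S \<times> UNIV) (\<lambda>x :: 'b \<times> real. (k (fst x), snd x))"
    using open_strip[OF assms(1)] by (intro smooth_on_Pair smooth_on_snd smooth_on_id)
  have img: "(\<lambda>x. (k (fst x), snd x)) ` (S \<times> UNIV) \<subseteq> U \<times> UNIV" using assms(5) by auto
  from smooth_map_on_compose[OF open_strip[OF assms(1)] smooth_familyD(2)[OF assms(3)] sm img open_strip[OF assms(2)]]
  show "smooth_map_on G (S \<times> UNIV) (\<lambda>x. F (k (fst x)) (snd x))"
    by (simp only: fst_conv snd_conv)
qed (use assms smooth_familyD(1)[OF assms(3)] in auto)

lemma smooth_family_subset:
  "smooth_family G S F \<Longrightarrow> T \<subseteq> S \<Longrightarrow> smooth_family G T F"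
  unfolding smooth_family_def
  by (meson Sigma_mono order_refl smooth_map_on_subset subsetD)

lemma smooth_family_cong:
  fixes S :: "'a::real_normed_vector set"
  assumes "open S" and "\<And>s. s \<in> S \<Longrightarrow> F s = H s" and "smooth_family G S F"
  shows "smooth_family G S H"
proof (rule smooth_familyI)
  show "smooth_map_on G (S \<times> UNIV) (\<lambda>x. H (fst x) (snd x))"
    by (rule smooth_map_on_cong[OF open_strip[OF assms(1)] _ smooth_familyD(2)[OF assms(3)]])
      (use assms(2) in auto)
qed (use assms(2) smooth_familyD(1)[OF assms(3)] in force)

lemma smooth_section:
  fixes S :: "'a::euclidean_space set"
  assumes "open S" and "smooth_family G S F"
  shows "smooth_map_on G S (\<lambda>s. F s \<theta>)"
proof -
  have img: "(\<lambda>s. (s, \<theta>)) ` S \<subseteq> S \<times> UNIV" by auto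
  have sm: "smooth_on S (\<lambda>s. (s, \<theta>))" using assms(1) by (intro smooth_on_Pair smooth_on_const smooth_on_id)
  from smooth_map_on_compose[OF assms(1) smooth_familyD(2)[OF assms(2)] sm img open_strip[OF assms(1)]]
  show ?thesis by (simp only: fst_conv snd_conv)
qed

section \<open>Velocities and angular derivatives of families\<close>

lemma angle_eq_llog:
  fixes S :: "'a::euclidean_space set"
  assumes "open S" and "smooth_family G S F" and "s \<in> S"
  shows "langle G (F s) \<theta> = llog G (\<lambda>x. F (fst x) (snd x)) (s, \<theta>) (0, 1)"
    and "rangle G (F s) \<theta> = rlog G (\<lambda>x. F (fst x) (snd x)) (s, \<theta>) (0, 1)"
proof -
  have k: "((\<lambda>\<theta>. (s, \<theta>)) has_derivative (\<lambda>h. (0, h))) (at \<theta>)" by (auto intro!: derivative_eq_intros)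
  have "(s, \<theta>) \<in> S \<times> UNIV" using assms by simp
  from llog_compose[where k="\<lambda>\<theta>. (s, \<theta>)", OF open_strip[OF assms(1)] smooth_familyD(2)[OF assms(2)] this k]
    rlog_compose[where k="\<lambda>\<theta>. (s, \<theta>)", OF open_strip[OF assms(1)] smooth_familyD(2)[OF assms(2)] this k]
  show "langle G (F s) \<theta> = llog G (\<lambda>x. F (fst x) (snd x)) (s, \<theta>) (0, 1)"
    "rangle G (F s) \<theta> = rlog G (\<lambda>x. F (fst x) (snd x)) (s, \<theta>) (0, 1)"
    by (auto simp: langle_def rangle_def)
qed

lemma vel_eq_llog:
  assumes "open S" and "smooth_family G S F" and "s \<in> S"
  shows "lvel G F s \<theta> = llog G (\<lambda>x. F (fst x) (snd x)) (s, \<theta>) (1, 0)"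
    and "rvel G F s \<theta> = rlog G (\<lambda>x. F (fst x) (snd x)) (s, \<theta>) (1, 0)"
  using llog_section[OF open_strip[OF assms(1)] smooth_familyD(2)[OF assms(2)], of s \<theta>] assms(3)
  by (auto simp: lvel_def rvel_def)

lemma smooth_angle:
  fixes S :: "'a::euclidean_space set"
  assumes S: "open S" and F: "smooth_family G S F"
  shows "smooth_on (S \<times> UNIV) (\<lambda>x. langle G (F (fst x)) (snd x))"
    and "smooth_on (S \<times> UNIV) (\<lambda>x. rangle G (F (fst x)) (snd x))"
  using smooth_on_cong[OF open_strip[OF S] _ smooth_on_llog[OF open_strip[OF S] smooth_familyD(2)[OF F]
        smooth_on_const[OF open_strip[OF S], of "(0, 1)"]]]
    smooth_on_cong[OF open_strip[OF S] _ smooth_on_rlog[OF open_strip[OF S] smooth_familyD(2)[OF F]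
        smooth_on_const[OF open_strip[OF S], of "(0, 1)"]]]
  by (auto simp: angle_eq_llog[OF S F])

lemma smooth_vel:
  assumes S: "open S" and F: "smooth_family G S F"
  shows "smooth_on (S \<times> UNIV) (\<lambda>x. lvel G F (fst x) (snd x))"
    and "smooth_on (S \<times> UNIV) (\<lambda>x. rvel G F (fst x) (snd x))"
  using smooth_on_cong[OF open_strip[OF S] _ smooth_on_llog[OF open_strip[OF S] smooth_familyD(2)[OF F]
        smooth_on_const[OF open_strip[OF S], of "(1, 0)"]]]
    smooth_on_cong[OF open_strip[OF S] _ smooth_on_rlog[OF open_strip[OF S] smooth_familyD(2)[OF F]
        smooth_on_const[OF open_strip[OF S], of "(1, 0)"]]]
  by (auto simp: vel_eq_llog[OF S F])

lemma llog_cong: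
  assumes "open S" and "\<And>y. y \<in> S \<Longrightarrow> F y = H y" and "smooth_map_on G S F" and "x \<in> S"
  shows "llog G F x = llog G H x" and "rlog G F x = rlog G H x"
proof -
  have "((\<lambda>y. ch (inv (H x) \<otimes> H y)) has_derivative llog G F x) (at x)"
    by (rule has_derivative_transform_within_open[OF llog_has_derivative[OF assms(1,3,4)] assms(1,4)])
      (use assms in simp)
  then show "llog G F x = llog G H x" by (rule llog_unique[symmetric])
  have "((\<lambda>y. ch (H y \<otimes> inv (H x))) has_derivative rlog G F x) (at x)"
    by (rule has_derivative_transform_within_open[OF rlog_has_derivative[OF assms(1,3,4)] assms(1,4)])
      (use assms in simp)
  then show "rlog G F x = rlog G H x" by (rule rlog_unique[symmetric])
qed

lemma vel_cong:
  assumes "open S" and "\<And>r. r \<in> S \<Longrightarrow> F r = H r" and "smooth_family G S F" and "s \<in> S"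
  shows "lvel G F s = lvel G H s" and "rvel G F s = rvel G H s"
proof -
  have "llog G (\<lambda>r. F r \<theta>) s = llog G (\<lambda>r. H r \<theta>) s" "rlog G (\<lambda>r. F r \<theta>) s = rlog G (\<lambda>r. H r \<theta>) s" for \<theta>
    using llog_cong[OF assms(1) _ smooth_section[OF assms(1,3)] assms(4), of "\<theta>" "\<lambda>r. H r \<theta>"] assms(2) by auto
  then show "lvel G F s = lvel G H s" "rvel G F s = rvel G H s" by (simp_all add: lvel_def rvel_def)
qed

lemma vel_loop_algebra:
  assumes S: "open S" and F: "smooth_family G S F" and s: "s \<in> S"
  shows "lvel G F s \<in> loop_algebra" and "rvel G F s \<in> loop_algebra"
proof -
  have "llog G (\<lambda>r. F r (\<theta> + 2 * pi)) s = llog G (\<lambda>r. F r \<theta>) s"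
    "rlog G (\<lambda>r. F r (\<theta> + 2 * pi)) s = rlog G (\<lambda>r. F r \<theta>) s" for \<theta>
    using llog_cong[OF S _ smooth_section[OF S F] s, of "\<theta> + 2 * pi" "\<lambda>r. F r \<theta>"] smooth_familyD(3)[OF F] by auto
  then show "lvel G F s \<in> loop_algebra" "rvel G F s \<in> loop_algebra"
    using smooth_on_slice[OF smooth_vel(1)[OF S F] s] smooth_on_slice[OF smooth_vel(2)[OF S F] s]
    by (auto simp: loop_algebra_def lvel_def rvel_def)
qed

lemma smooth_loop_Ad:
  assumes "g \<in> carrier (loop_group G)" and "\<xi> \<in> loop_algebra"
  shows "loop_Ad G g \<xi> \<in> loop_algebra"
  using assms smooth_on_Ad[OF open_UNIV, of g \<xi>] by (auto simp: loop_algebra_def loop_group_carrier loop_Ad_def)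

lemma rvel_eq: "open S \<Longrightarrow> smooth_family G S F \<Longrightarrow> s \<in> S \<Longrightarrow> rvel G F s \<theta> = Ad G (F s \<theta>) (lvel G F s \<theta>)"
  using rlog_eq_Ad_llog[OF _ smooth_section] by (auto simp: lvel_def rvel_def)

lemma vel_mult:
  assumes "open S" and "smooth_family G S F" and "smooth_family G S H" and "s \<in> S"
  shows "lvel G (\<lambda>r \<theta>. F r \<theta> \<otimes> H r \<theta>) s \<theta> = Ad G (inv (H s \<theta>)) (lvel G F s \<theta>) + lvel G H s \<theta>"
    and "rvel G (\<lambda>r \<theta>. F r \<theta> \<otimes> H r \<theta>) s \<theta> = rvel G F s \<theta> + Ad G (F s \<theta>) (rvel G H s \<theta>)"
  using llog_mult[OF assms(1) smooth_section[OF assms(1,2)] smooth_section[OF assms(1,3)] assms(4)]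
    rlog_mult[OF assms(1) smooth_section[OF assms(1,2)] smooth_section[OF assms(1,3)] assms(4)]
  by (auto simp: lvel_def rvel_def)

lemma vel_inv:
  assumes "open S" and "smooth_family G S F" and "s \<in> S"
  shows "lvel G (\<lambda>r \<theta>. inv (F r \<theta>)) s \<theta> = - rvel G F s \<theta>"
    and "rvel G (\<lambda>r \<theta>. inv (F r \<theta>)) s \<theta> = - lvel G F s \<theta>"
  using llog_inv[OF assms(1) smooth_section[OF assms(1,2)] assms(3)]
    rlog_inv[OF assms(1) smooth_section[OF assms(1,2)] assms(3)]
  by (auto simp: lvel_def rvel_def)

lemma vel_const [simp]: "lvel G (\<lambda>r. g) s = (\<lambda>\<theta>. 0)" "rvel G (\<lambda>r. g) s = (\<lambda>\<theta>. 0)"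
  by (simp_all add: lvel_def rvel_def llog_def rlog_def frechet_derivative_const)

lemma vel_compose:
  assumes "open S" and "smooth_family G S F" and "k s \<in> S" and "(k has_vector_derivative a) (at s)"
  shows "lvel G (\<lambda>r. F (k r)) s \<theta> = a *\<^sub>R lvel G F (k s) \<theta>"
    and "rvel G (\<lambda>r. F (k r)) s \<theta> = a *\<^sub>R rvel G F (k s) \<theta>"
proof -
  have k: "(k has_derivative (\<lambda>h. h *\<^sub>R a)) (at s)" using assms(4) by (simp add: has_vector_derivative_def)
  note sm = smooth_section[OF assms(1,2), of \<theta>]
  show "lvel G (\<lambda>r. F (k r)) s \<theta> = a *\<^sub>R lvel G F (k s) \<theta>"
    using llog_compose[OF assms(1) sm assms(3) k, of 1] linear_real_eq[OF linear_llog[OF assms(1) sm assms(3)], of a]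
    by (simp add: lvel_def)
  show "rvel G (\<lambda>r. F (k r)) s \<theta> = a *\<^sub>R rvel G F (k s) \<theta>"
    using rlog_compose[OF assms(1) sm assms(3) k, of 1] linear_real_eq[OF linear_rlog[OF assms(1) sm assms(3)], of a]
    by (simp add: rvel_def)
qed

text \<open>The Maurer-Cartan equation in the two variables s and \<theta>.\<close>

lemma rangle_derivative:
  assumes S: "open S" and F: "smooth_family G S F" and s: "s \<in> S"
  shows "((\<lambda>s. rangle G (F s) \<theta>) has_vector_derivative
           Ad G (F s \<theta>) (vector_derivative (lvel G F s) (at \<theta>))) (at s)"
proof -
  have "(lvel G F s has_vector_derivative vector_derivative (lvel G F s) (at \<theta>)) (at \<theta>)"
    by (rule smooth_on_vector_derivative(2)[OF open_UNIV]) (use vel_loop_algebra[OF S F s] in \<open>auto simp: loop_algebra_def\<close>)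
  then have "((\<lambda>\<theta>. llog G (\<lambda>x. F (fst x) (snd x)) (s, \<theta>) (1, 0)) has_vector_derivative
      vector_derivative (lvel G F s) (at \<theta>)) (at \<theta>)"
    by (simp add: vel_eq_llog[OF S F s, symmetric])
  from maurer_cartan_vector_derivative[OF open_strip[OF S] smooth_familyD(2)[OF F] _ this] s
  have "((\<lambda>s. rlog G (\<lambda>x. F (fst x) (snd x)) (s, \<theta>) (0, 1)) has_vector_derivative
      Ad G (F s \<theta>) (vector_derivative (lvel G F s) (at \<theta>))) (at s)" by simp
  then show ?thesis
    by (rule has_vector_derivative_transform_within_open[OF _ S s]) (simp add: angle_eq_llog[OF S F])
qed

lemma rangle_inv: "g \<in> carrier (loop_group G) \<Longrightarrow> rangle G (\<lambda>\<theta>. inv (g \<theta>)) \<theta> = - langle G g \<theta>"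
  by (simp add: rangle_def langle_def rlog_inv[OF open_UNIV] loop_group_carrier)

lemma rangle_eq: "g \<in> carrier (loop_group G) \<Longrightarrow> rangle G g \<theta> = Ad G (g \<theta>) (langle G g \<theta>)"
  by (simp add: rangle_def langle_def rlog_eq_Ad_llog[OF open_UNIV] loop_group_carrier)

text \<open>The previous equation for the pointwise inverse family, which exchanges left and right
  logarithmic derivatives up to sign.\<close>

lemma langle_derivative:
  assumes S: "open S" and F: "smooth_family G S F" and s: "s \<in> S"
  shows "((\<lambda>s. langle G (F s) \<theta>) has_vector_derivative
           Ad G (inv (F s \<theta>)) (vector_derivative (rvel G F s) (at \<theta>))) (at s)"
proof -
  have r: "(rvel G F s has_vector_derivative vector_derivative (rvel G F s) (at \<theta>)) (at \<theta>)"
    by (rule smooth_on_vector_derivative(2)[OF open_UNIV]) (use vel_loop_algebra[OF S F s] in \<open>auto simp: loop_algebra_def\<close>)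
  have "lvel G (\<lambda>s \<theta>. inv (F s \<theta>)) s = (\<lambda>\<theta>. - rvel G F s \<theta>)" using vel_inv[OF S F s] by auto
  then have "vector_derivative (lvel G (\<lambda>s \<theta>. inv (F s \<theta>)) s) (at \<theta>) = - vector_derivative (rvel G F s) (at \<theta>)"
    using vector_derivative_at[OF has_vector_derivative_minus[OF r]] by simp
  then have "((\<lambda>s. - rangle G (\<lambda>\<theta>. inv (F s \<theta>)) \<theta>) has_vector_derivative
      Ad G (inv (F s \<theta>)) (vector_derivative (rvel G F s) (at \<theta>))) (at s)"
    using has_vector_derivative_minus[OF rangle_derivative[OF S smooth_family_inv[OF S F] s, of \<theta>]] by simp
  then show ?thesis
    by (rule has_vector_derivative_transform_within_open[OF _ S s])
      (use smooth_familyD(1)[OF F] rangle_inv in simp)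
qed

end

section \<open>The residue cocycle\<close>

locale lie_form = lie +
  fixes B
  assumes form: "invariant_form G B"
begin

lemma linear_B: "Vector_Spaces.linear (*s) (*) (B X)" "Vector_Spaces.linear (*s) (*) (\<lambda>X. B X Y)"
  using form unfolding invariant_form_def by auto

lemma B_scale: "B X (c *s Y) = c * B X Y" "B (c *s X) Y = c * B X Y"
proof -
  interpret a: Vector_Spaces.linear "(*s)" "(*)" "B X" by (rule linear_B)
  interpret b: Vector_Spaces.linear "(*s)" "(*)" "\<lambda>X. B X Y" by (rule linear_B)
  show "B X (c *s Y) = c * B X Y" "B (c *s X) Y = c * B X Y" using a.scale b.scale by auto
qed

lemma B_add: "B X (Y + Z) = B X Y + B X Z" "B (X + Y) Z = B X Z + B Y Z"
proof -
  interpret a: Vector_Spaces.linear "(*s)" "(*)" "B X" by (rule linear_B)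
  interpret b: Vector_Spaces.linear "(*s)" "(*)" "\<lambda>X. B X Z" by (rule linear_B)
  show "B X (Y + Z) = B X Y + B X Z" "B (X + Y) Z = B X Z + B Y Z" using a.add b.add by auto
qed

lemma scaleR_eq_scale: "r *\<^sub>R (X :: complex^'k::finite) = complex_of_real r *s X"
  by (simp add: vec_eq_iff) (simp add: scaleR_conv_of_real)

lemma bounded_bilinear_B: "bounded_bilinear B"
proof -
  have "bilinear B"
    unfolding bilinear_def
    by (auto intro!: linearI simp: B_add B_scale scaleR_eq_scale scaleR_conv_of_real)
  then show ?thesis by (simp add: bilinear_conv_bounded_bilinear)
qed

lemma B_simps [simp]: "B 0 Y = 0" "B X 0 = 0" "B (- X) Y = - B X Y" "B X (- Y) = - B X Y"
  "B (r *\<^sub>R X) Y = r *\<^sub>R B X Y" "B X (r *\<^sub>R Y) = r *\<^sub>R B X Y"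
  by (simp_all add: bounded_bilinear.zero_left[OF bounded_bilinear_B] bounded_bilinear.zero_right[OF bounded_bilinear_B]
      bounded_bilinear.minus_left[OF bounded_bilinear_B] bounded_bilinear.minus_right[OF bounded_bilinear_B]
      bounded_bilinear.scaleR_left[OF bounded_bilinear_B] bounded_bilinear.scaleR_right[OF bounded_bilinear_B])

lemma continuous_on_B: "continuous_on S f \<Longrightarrow> continuous_on S g \<Longrightarrow> continuous_on S (\<lambda>x. B (f x) (g x))"
  by (rule bounded_bilinear.continuous_on[OF bounded_bilinear_B])

text \<open>Possibly a proper subset of the group: the form is only ad-invariant, and the group need
  not be connected.\<close>

definition B_inv :: "'a set" where
  "B_inv = {g. \<forall>X Y. B (Ad G g X) (Ad G g Y) = B X Y}"

lemma B_inv_one: "\<one> \<in> B_inv" by (simp add: B_inv_def)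

lemma B_invD: "g \<in> B_inv \<Longrightarrow> B X (Ad G g Y) = B (Ad G (inv g) X) Y"
proof -
  assume "g \<in> B_inv"
  then have "B (Ad G g (Ad G (inv g) X)) (Ad G g Y) = B (Ad G (inv g) X) Y" unfolding B_inv_def by blast
  then show ?thesis by simp
qed

lemma B_inv_inv: "g \<in> B_inv \<Longrightarrow> inv g \<in> B_inv"
  unfolding B_inv_def mem_Collect_eq
proof safe
  fix X Y assume "\<forall>X Y. B (Ad G g X) (Ad G g Y) = B X Y"
  then have "B (Ad G g (Ad G (inv g) X)) (Ad G g (Ad G (inv g) Y)) = B (Ad G (inv g) X) (Ad G (inv g) Y)" by blast
  then show "B (Ad G (inv g) X) (Ad G (inv g) Y) = B X Y" by simp
qed

text \<open>Invariance of the form under the bracket gives invariance under \<open>Ad\<close> only along paths.\<close>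
lemma B_inv_path:
  fixes F :: "real \<Rightarrow> 'a"
  assumes S: "open S" "{0..1} \<subseteq> S" and F: "smooth_map_on G S F" and "F 0 \<in> B_inv" and "s \<in> {0..1}"
  shows "F s \<in> B_inv"
proof -
  have "B (Ad G (F s) X) (Ad G (F s) Y) = B (Ad G (F 0) X) (Ad G (F 0) Y)" for X Y
  proof (rule has_derivative_zero_unique[of "{0..1}" "\<lambda>s. B (Ad G (F s) X) (Ad G (F s) Y)" s 0])
    fix s :: real assume "s \<in> {0..1}"
    then have s: "s \<in> S" using S by blast
    have "((\<lambda>s. B (Ad G (F s) X) (Ad G (F s) Y)) has_derivative
        (\<lambda>v. B (Ad G (F s) X) (bracket G (rlog G F s v) (Ad G (F s) Y)) +
             B (bracket G (rlog G F s v) (Ad G (F s) X)) (Ad G (F s) Y))) (at s)"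
      by (rule bounded_bilinear.FDERIV[OF bounded_bilinear_B Ad_derivative_rlog[OF S(1) F s] Ad_derivative_rlog[OF S(1) F s]])
    moreover have "B (bracket G Z X) Y + B X (bracket G Z Y) = 0" for X Y Z
      using form unfolding invariant_form_def by blast
    ultimately have "((\<lambda>s. B (Ad G (F s) X) (Ad G (F s) Y)) has_derivative (\<lambda>v. 0)) (at s)"
      by (simp add: add.commute)
    then show "((\<lambda>s. B (Ad G (F s) X) (Ad G (F s) Y)) has_derivative (\<lambda>v. 0)) (at s within {0..1})"
      by (rule has_derivative_at_withinI)
  qed (use assms in auto)
  then show ?thesis using assms(4) by (simp add: B_inv_def)
qed

text \<open>The coefficient of \<lambda>^{-1} when one argument comes from a derivative in
  \<lambda>, rewritten for the angular derivative: the factor \<lambda>^{-1} in the former cancels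
  the factor \<lambda> that extracts the coefficient, and 1/\<i> is left.\<close>

definition pairing :: "(real \<Rightarrow> complex^'b) \<Rightarrow> (real \<Rightarrow> complex^'b) \<Rightarrow> complex" where
  "pairing \<xi> \<eta> = 1 / (2 * pi * \<i>) * integral {0..2 * pi} (\<lambda>\<theta>. B (\<xi> \<theta>) (\<eta> \<theta>))"

lemma loop_pairing_dlambda:
  "loop_pairing B (-1) (dlambda \<xi>) \<eta> = pairing (\<lambda>\<theta>. vector_derivative \<xi> (at \<theta>)) \<eta>"
  "loop_pairing B (-1) \<xi> (dlambda \<eta>) = pairing \<xi> (\<lambda>\<theta>. vector_derivative \<eta> (at \<theta>))"
proof -
  have c: "1 / (\<i> * cis \<theta>) * z * cis (- (of_int (-1) * \<theta>)) = 1 / \<i> * z" for \<theta> z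
    by (simp add: field_simps)
  show "loop_pairing B (-1) (dlambda \<xi>) \<eta> = pairing (\<lambda>\<theta>. vector_derivative \<xi> (at \<theta>)) \<eta>"
    "loop_pairing B (-1) \<xi> (dlambda \<eta>) = pairing \<xi> (\<lambda>\<theta>. vector_derivative \<eta> (at \<theta>))"
    unfolding loop_pairing_def laurent_coeff_def dlambda_def pairing_def B_scale c integral_mult_right
    by (simp_all only: divide_inverse inverse_mult_distrib mult_ac mult_1_left
        of_real_mult of_real_inverse of_real_numeral)
qed

lemma residue_cocycle_eq: "residue_cocycle B \<xi> \<eta> = pairing (\<lambda>\<theta>. vector_derivative \<xi> (at \<theta>)) \<eta>"
  by (simp add: residue_cocycle_def loop_pairing_dlambda)

lemma loop_algebra_smooth: "\<xi> \<in> loop_algebra \<Longrightarrow> smooth_on UNIV \<xi>"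
  by (simp add: loop_algebra_def)

lemma pairing_integrable:
  "smooth_on UNIV \<xi> \<Longrightarrow> smooth_on UNIV \<eta> \<Longrightarrow> (\<lambda>\<theta>. B (\<xi> \<theta>) (\<eta> \<theta>)) integrable_on {0..2 * pi}"
  by (rule integrable_continuous_interval)
    (auto intro!: continuous_on_B intro: continuous_on_subset[OF smooth_on_continuous_on])

text \<open>The boundary terms cancel by periodicity. The arguments keep their places because
  \<open>invariant_form\<close> does not ask for symmetry of B.\<close>

lemma pairing_by_parts:
  assumes "\<xi> \<in> loop_algebra" and "\<eta> \<in> loop_algebra"
  shows "pairing (\<lambda>\<theta>. vector_derivative \<xi> (at \<theta>)) \<eta> = - pairing \<xi> (\<lambda>\<theta>. vector_derivative \<eta> (at \<theta>))"
proof -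
  note sm = smooth_on_vector_derivative[OF open_UNIV loop_algebra_smooth[OF assms(1)]]
    smooth_on_vector_derivative[OF open_UNIV loop_algebra_smooth[OF assms(2)]]
  have "((\<lambda>\<theta>. B (\<xi> \<theta>) (\<eta> \<theta>)) has_vector_derivative
      B (\<xi> \<theta>) (vector_derivative \<eta> (at \<theta>)) + B (vector_derivative \<xi> (at \<theta>)) (\<eta> \<theta>)) (at \<theta> within {0..2 * pi})" for \<theta>
    by (rule has_vector_derivative_at_within,
        rule bounded_bilinear.has_vector_derivative[OF bounded_bilinear_B sm(2)[OF UNIV_I] sm(4)[OF UNIV_I]])
  then have "((\<lambda>\<theta>. B (\<xi> \<theta>) (vector_derivative \<eta> (at \<theta>)) + B (vector_derivative \<xi> (at \<theta>)) (\<eta> \<theta>)) has_integral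
      B (\<xi> (2 * pi)) (\<eta> (2 * pi)) - B (\<xi> 0) (\<eta> 0)) {0..2 * pi}"
    by (intro fundamental_theorem_of_calculus) auto
  moreover have "\<xi> (0 + 2 * pi) = \<xi> 0" "\<eta> (0 + 2 * pi) = \<eta> 0"
    using assms unfolding loop_algebra_def mem_Collect_eq by blast+
  ultimately have "integral {0..2 * pi} (\<lambda>\<theta>. B (\<xi> \<theta>) (vector_derivative \<eta> (at \<theta>)) + B (vector_derivative \<xi> (at \<theta>)) (\<eta> \<theta>)) = 0"
    by (simp add: integral_unique)
  then have "integral {0..2 * pi} (\<lambda>\<theta>. B (\<xi> \<theta>) (vector_derivative \<eta> (at \<theta>))) +
      integral {0..2 * pi} (\<lambda>\<theta>. B (vector_derivative \<xi> (at \<theta>)) (\<eta> \<theta>)) = 0"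
    by (subst (asm) integral_add) (use sm loop_algebra_smooth assms in \<open>auto intro!: pairing_integrable\<close>)
  then have "integral {0..2 * pi} (\<lambda>\<theta>. B (vector_derivative \<xi> (at \<theta>)) (\<eta> \<theta>)) =
      - integral {0..2 * pi} (\<lambda>\<theta>. B (\<xi> \<theta>) (vector_derivative \<eta> (at \<theta>)))"
    by (simp add: eq_neg_iff_add_eq_0 add.commute)
  then show ?thesis unfolding pairing_def by (simp only: mult_minus_right)
qed

lemma pairing_derivative:
  assumes S: "open S" and a: "smooth_on (S \<times> UNIV) (\<lambda>x. a (fst x) (snd x))"
    and der: "\<And>r \<theta>. r \<in> S \<Longrightarrow> ((\<lambda>r. a r \<theta>) has_vector_derivative D r \<theta>) (at r)"
    and c: "smooth_on UNIV c" and s: "s \<in> S"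
  shows "((\<lambda>r. pairing c (a r)) has_vector_derivative pairing c (D s)) (at s)"
proof -
  obtain e where e: "e > 0" "cball s e \<subseteq> S" using S s open_contains_cball by blast
  let ?I = "cball s e"
  \<comment> \<open>D is given pointwise as a derivative. Being the partial derivative in r of the
    jointly smooth a, it is continuous, as the Leibniz rule demands.\<close>
  have D: "continuous_on (?I \<times> {0..2 * pi}) (\<lambda>x. D (fst x) (snd x))"
  proof -
    have "frechet_derivative (\<lambda>x. a (fst x) (snd x)) (at x) (1, 0) = D (fst x) (snd x)" if "x \<in> S \<times> UNIV" for x
      using vector_derivative_unique_at[OF der smooth_on_section_derivative(1)[OF a that, simplified]] that by auto
    then have "smooth_on (S \<times> UNIV) (\<lambda>x. D (fst x) (snd x))"
      by (intro smooth_on_cong[OF open_strip[OF S] _ smooth_on_derivative[OF a, of "(1, 0)"]])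
    then show ?thesis using smooth_on_continuous_on e(2) by (blast intro: continuous_on_subset)
  qed
  have "((\<lambda>r. integral (cbox 0 (2 * pi)) (\<lambda>\<theta>. B (c \<theta>) (a r \<theta>))) has_vector_derivative
      integral (cbox 0 (2 * pi)) (\<lambda>\<theta>. B (c \<theta>) (D s \<theta>))) (at s within ?I)"
  proof (rule leibniz_rule_vector_derivative[where f = "\<lambda>r \<theta>. B (c \<theta>) (a r \<theta>)" and
        fx = "\<lambda>r \<theta>. B (c \<theta>) (D r \<theta>)"])
    show "((\<lambda>r. B (c \<theta>) (a r \<theta>)) has_vector_derivative B (c \<theta>) (D r \<theta>)) (at r within ?I)"
      if "r \<in> ?I" for r \<theta>
    proof -
      have "r \<in> S" using that e(2) by blast
      from bounded_linear.has_vector_derivative[OF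
          bounded_bilinear.bounded_linear_right[OF bounded_bilinear_B, of "c \<theta>"] der[OF this, of \<theta>]]
      show ?thesis by (rule has_vector_derivative_at_within)
    qed
    show "(\<lambda>\<theta>. B (c \<theta>) (a r \<theta>)) integrable_on cbox 0 (2 * pi)" if "r \<in> ?I" for r
      using pairing_integrable[OF c smooth_on_slice[OF a, of r, simplified]] that e(2) by auto
    show "continuous_on (?I \<times> cbox 0 (2 * pi)) (\<lambda>(r, \<theta>). B (c \<theta>) (D r \<theta>))"
      unfolding case_prod_unfold
      by (intro continuous_on_B continuous_on_compose2[OF smooth_on_continuous_on[OF c]] continuous_intros) (use D in auto)
  qed (use e in auto)
  then have "((\<lambda>r. pairing c (a r)) has_vector_derivative pairing c (D s)) (at s within ?I)"
    unfolding pairing_def cbox_interval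
    by (rule bounded_linear.has_vector_derivative[OF bounded_linear_mult_right])
  moreover have "at s within ?I = at s" using e(1) by (intro at_within_interior) (simp add: interior_cball)
  ultimately show ?thesis by simp
qed

text \<open>This reduces the integral of \<open>w\<close> over a surface \<open>(s, r) \<mapsto> h(s) q(r)\<close> to integrals along \<open>h\<close>.\<close>
lemma rangle_pairing_derivative:
  assumes S: "open S" "{0..1} \<subseteq> S" and q: "smooth_family G S q"
    and inv: "\<And>s \<theta>. s \<in> {0..1} \<Longrightarrow> q s \<theta> \<in> B_inv" and \<zeta>: "\<zeta> \<in> loop_algebra" and r: "r \<in> {0..1}"
  shows "((\<lambda>r. pairing \<zeta> (rangle G (q r))) has_vector_derivative
           - residue_cocycle B (loop_Ad G (\<lambda>\<theta>. inv (q r \<theta>)) \<zeta>) (lvel G q r)) (at r within {0..1})"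
proof -
  define D where "D = (\<lambda>r \<theta>. Ad G (q r \<theta>) (vector_derivative (lvel G q r) (at \<theta>)))"
  have rS: "r \<in> S" using r S(2) by blast
  have "((\<lambda>r. pairing \<zeta> (rangle G (q r))) has_vector_derivative pairing \<zeta> (D r)) (at r)"
    by (rule pairing_derivative[OF S(1) smooth_angle(2)[OF S(1) q] _ loop_algebra_smooth[OF \<zeta>] rS])
      (use rangle_derivative[OF S(1) q] in \<open>simp add: D_def\<close>)
  then have "((\<lambda>r. pairing \<zeta> (rangle G (q r))) has_vector_derivative pairing \<zeta> (D r)) (at r within {0..1})"
    by (rule has_vector_derivative_at_within)
  \<comment> \<open>Invariance moves \<open>Ad\<close> from the second argument to its inverse on
    the first; the angular derivative then changes sides by parts.\<close>
  moreover have "pairing \<zeta> (D r) = - residue_cocycle B (loop_Ad G (\<lambda>\<theta>. inv (q r \<theta>)) \<zeta>) (lvel G q r)"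
  proof -
    have "B (\<zeta> \<theta>) (D r \<theta>) = B (loop_Ad G (\<lambda>\<theta>. inv (q r \<theta>)) \<zeta> \<theta>) (vector_derivative (lvel G q r) (at \<theta>))" for \<theta>
      unfolding D_def loop_Ad_def by (rule B_invD[OF inv[OF r]])
    then have "pairing \<zeta> (D r) = pairing (loop_Ad G (\<lambda>\<theta>. inv (q r \<theta>)) \<zeta>) (\<lambda>\<theta>. vector_derivative (lvel G q r) (at \<theta>))"
      by (simp add: pairing_def)
    then show ?thesis
      unfolding residue_cocycle_eq
      using pairing_by_parts[OF smooth_loop_Ad[OF loop_carrier_inv[OF smooth_familyD(1)[OF q rS]] \<zeta>] vel_loop_algebra(1)[OF S(1) q rS]]
      by simp
  qed
  ultimately show ?thesis by simp
qed

end

section \<open>Integration over the triangle\<close>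

lemma compact_triangle: "compact triangle"
proof -
  let ?T = "{x. 0 \<le> fst x} \<inter> {x. 0 \<le> snd x} \<inter> {x :: real \<times> real. fst x + snd x \<le> 1}"
  have "closed ?T" by (intro closed_Int closed_Collect_le continuous_intros)
  then have "compact (?T \<inter> cbox (0, 0) (1, 1))" by (rule closed_Int_compact) (rule compact_cbox)
  moreover have "triangle = ?T \<inter> cbox (0, 0) (1, 1)" by (auto simp: triangle_def)
  ultimately show ?thesis by (simp only:)
qed

text \<open>The order of integration is exchanged for the Lebesgue integral of the extension of f by
  zero. The slices are continuous on intervals, where the Lebesgue and the gauge integral
  agree.\<close>

lemma triangle_fubini:
  fixes f :: "real \<times> real \<Rightarrow> complex"
  assumes f: "continuous_on triangle f"
  shows "integral triangle f = integral {0..1} (\<lambda>u. integral {0..1-u} (\<lambda>v. f (u, v)))" (is ?A)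
    and "integral triangle f = integral {0..1} (\<lambda>v. integral {0..1-v} (\<lambda>u. f (u, v)))" (is ?B)
proof -
  define g where "g = (\<lambda>x. indicator triangle x *\<^sub>R f x)"
  have ig: "integrable lborel g" unfolding g_def by (rule borel_integrable_compact[OF compact_triangle f])
  then have ig': "integrable (lborel \<Otimes>\<^sub>M lborel) g" by (simp add: lborel_prod)
  have tri: "integral triangle f = integral\<^sup>L lborel g"
    using set_borel_integral_eq_integral(2)[of triangle f] ig
    by (simp add: set_integrable_def set_lebesgue_integral_def g_def)
  have slice: "set_integrable lborel {0..c} k \<and> (LINT v:{0..c}|lborel. k v) = integral {0..c} k"
    if "continuous_on {0..c} k" for c and k :: "real \<Rightarrow> complex"
    using borel_integrable_atLeastAtMost'[OF that] set_borel_integral_eq_integral(2) by blast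
  \<comment> \<open>Serves both orders of integration: K is an inner integral as a function on the
    line, zero outside [0, 1].\<close>
  have outer: "integral\<^sup>L lborel K = integral {0..1} (\<lambda>u. integral {0..1-u} (k u))"
    if K: "integrable lborel K" "\<And>u. K u = indicator {0..1} u *\<^sub>R integral {0..1-u} (k u)"
    for K and k :: "real \<Rightarrow> real \<Rightarrow> complex"
  proof -
    have Ke: "(\<lambda>u. indicator {0..1} u *\<^sub>R integral {0..1-u} (k u)) = K" using K(2) by auto
    have "set_integrable lborel {0..1} (\<lambda>u. integral {0..1-u} (k u))"
      unfolding set_integrable_def Ke by (rule K(1))
    from set_borel_integral_eq_integral(2)[OF this] show ?thesis
      unfolding set_lebesgue_integral_def Ke .
  qed
  have A: "(LINT v|lborel. g (u, v)) = indicator {0..1} u *\<^sub>R integral {0..1-u} (\<lambda>v. f (u, v))" for u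
  proof (cases "u \<in> {0..1}")
    case True
    have eq: "g (u, v) = indicator {0..1-u} v *\<^sub>R f (u, v)" for v
      using True by (auto simp: g_def triangle_def indicator_def)
    have "continuous_on {0..1-u} (\<lambda>v. f (u, v))"
      by (rule continuous_on_compose2[OF f]) (use True in \<open>auto simp: triangle_def intro!: continuous_intros\<close>)
    from slice[OF this] show ?thesis using True by (simp add: set_lebesgue_integral_def eq)
  next
    case False
    then have "g (u, v) = 0" for v by (auto simp: g_def triangle_def indicator_def)
    then show ?thesis using False by simp
  qed
  have B: "(LINT u|lborel. g (u, v)) = indicator {0..1} v *\<^sub>R integral {0..1-v} (\<lambda>u. f (u, v))" for v
  proof (cases "v \<in> {0..1}")
    case True
    have eq: "g (u, v) = indicator {0..1-v} u *\<^sub>R f (u, v)" for u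
      using True by (auto simp: g_def triangle_def indicator_def)
    have "continuous_on {0..1-v} (\<lambda>u. f (u, v))"
      by (rule continuous_on_compose2[OF f]) (use True in \<open>auto simp: triangle_def intro!: continuous_intros\<close>)
    from slice[OF this] show ?thesis using True by (simp add: set_lebesgue_integral_def eq)
  next
    case False
    then have "g (u, v) = 0" for u by (auto simp: g_def triangle_def indicator_def)
    then show ?thesis using False by simp
  qed
  show ?A
    using lborel_pair.integral_fst'[OF ig'] outer[OF lborel_pair.integrable_fst'[OF ig'] A] tri
    by (simp add: lborel_prod)
  have ig2: "integrable (lborel \<Otimes>\<^sub>M lborel) (\<lambda>(u, v). g (u, v))" using ig' by simp
  show ?B
    using lborel_pair.integral_snd[of "\<lambda>u v. g (u, v)", OF ig2]
      outer[OF lborel_pair.integrable_snd[of "\<lambda>u v. g (u, v)", OF ig2] B] tri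
    by (simp add: lborel_prod)
qed

lemma integral_reflect_interval:
  fixes k :: "real \<Rightarrow> complex"
  shows "integral {0..c} (\<lambda>x. k (c - x)) = integral {0..c} k"
  using integral_shift_Icc_real[of 0 c "\<lambda>y. k (- y)" "- c"] Henstock_Kurzweil_Integration.integral_reflect_real[of c 0 k]
  by (simp add: o_def)

lemma continuous_on_triangle_shear:
  fixes g :: "real \<times> real \<Rightarrow> complex"
  assumes "continuous_on ({0..1} \<times> {0..1}) g"
  shows "continuous_on triangle (\<lambda>(u, v). g (u + v, v))" "continuous_on triangle (\<lambda>(u, v). g (v, u + v))"
    "continuous_on triangle (\<lambda>(u, v). g (1 - u, v))"
  unfolding case_prod_unfold
  by (rule continuous_on_compose2[OF assms]; auto simp: triangle_def intro!: continuous_intros)+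

text \<open>The substitution s = u + v, r = v, composed of reflections in one variable and exchanges
  of the order of integration.\<close>

lemma integral_triangle_lower:
  fixes g :: "real \<times> real \<Rightarrow> complex"
  assumes g: "continuous_on ({0..1} \<times> {0..1}) g"
  shows "integral triangle (\<lambda>(u, v). g (u + v, v)) = integral {0..1} (\<lambda>s. integral {0..s} (\<lambda>r. g (s, r)))"
proof -
  have "integral triangle (\<lambda>(u, v). g (u + v, v)) = integral {0..1} (\<lambda>v. integral {0..1-v} (\<lambda>u. g (u + v, v)))"
    using triangle_fubini(2)[OF continuous_on_triangle_shear(1)[OF g]] by simp
  also have "(\<lambda>v. integral {0..1-v} (\<lambda>u. g (u + v, v))) = (\<lambda>v. integral {0..1-v} (\<lambda>u. g (1 - u, v)))"
  proof
    show "integral {0..1-v} (\<lambda>u. g (u + v, v)) = integral {0..1-v} (\<lambda>u. g (1 - u, v))" for v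
      using integral_reflect_interval[of "1 - v" "\<lambda>u. g (u + v, v)"] by (simp add: algebra_simps)
  qed
  also have "integral {0..1} (\<lambda>v. integral {0..1-v} (\<lambda>u. g (1 - u, v))) =
      integral {0..1} (\<lambda>u. integral {0..1-u} (\<lambda>v. g (1 - u, v)))"
    using triangle_fubini[OF continuous_on_triangle_shear(3)[OF g]] by simp
  also have "\<dots> = integral {0..1} (\<lambda>s. integral {0..s} (\<lambda>r. g (s, r)))"
    using integral_reflect_interval[of 1 "\<lambda>s. integral {0..s} (\<lambda>r. g (s, r))"] by simp
  finally show ?thesis .
qed

text \<open>The substitution s = v, r = u + v, which is a shift of the inner variable.\<close>

lemma integral_triangle_upper:
  fixes g :: "real \<times> real \<Rightarrow> complex"
  assumes g: "continuous_on ({0..1} \<times> {0..1}) g"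
  shows "integral triangle (\<lambda>(u, v). g (v, u + v)) = integral {0..1} (\<lambda>s. integral {s..1} (\<lambda>r. g (s, r)))"
proof -
  have "integral triangle (\<lambda>(u, v). g (v, u + v)) = integral {0..1} (\<lambda>v. integral {0..1-v} (\<lambda>u. g (v, u + v)))"
    using triangle_fubini(2)[OF continuous_on_triangle_shear(2)[OF g]] by simp
  moreover have "integral {0..1-v} (\<lambda>u. g (v, u + v)) = integral {v..1} (\<lambda>r. g (v, r))" for v
    using integral_shift_Icc_real[of 0 "1 - v" "\<lambda>r. g (v, r)" v] by (simp add: o_def add.commute)
  ultimately show ?thesis by simp
qed

section \<open>Singular chains\<close>

lemma triangle_point_in: "(u, v) \<in> triangle \<Longrightarrow> triangle_point u v \<in> standard_simplex 2"
  by (auto simp: triangle_def triangle_point_def standard_simplex_def numeral_2_eq_2)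

lemma simplex2_triangle_point: "(u, v) \<in> triangle \<Longrightarrow> simplex2 F (triangle_point u v) = F (u, v)"
  using triangle_point_in by (simp add: simplex2_def) (simp add: triangle_point_def)

lemma simplex1_cong: "(\<And>s. s \<in> {0..1} \<Longrightarrow> p s = q s) \<Longrightarrow> simplex1 p = simplex1 q"
  by (auto simp: simplex1_def standard_simplex_def intro!: restrict_ext)

text \<open>Every edge is parametrized from its vertex of smaller index to that of larger index,
  which fixes the signs.\<close>

lemma chain_boundary_simplex2:
  "chain_boundary 2 (frag_of (simplex2 F)) =
     frag_of (simplex1 (\<lambda>s. F (1 - s, s))) - frag_of (simplex1 (\<lambda>s. F (0, s))) + frag_of (simplex1 (\<lambda>s. F (s, 0)))"
proof -
  have std: "x 0 = 1 - x 1" if "x \<in> standard_simplex (Suc 0)" for x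
    using that by (auto simp: standard_simplex_def)
  have face: "simplical_face k x \<in> standard_simplex 2" if "x \<in> standard_simplex (Suc 0)" "k \<le> 2" for k and x :: "nat \<Rightarrow> real"
    using simplical_face_in_standard_simplex[of 2 k x] that by simp
  have 0: "singular_face 2 0 (simplex2 F) = simplex1 (\<lambda>s. F (1 - s, s))"
    and 1: "singular_face 2 (Suc 0) (simplex2 F) = simplex1 (\<lambda>s. F (0, s))"
    and 2: "singular_face 2 2 (simplex2 F) = simplex1 (\<lambda>s. F (s, 0))"
    unfolding singular_face_def simplex1_def simplex2_def
    by (rule ext, simp add: restrict_def face, simp add: simplical_face_def std)+
  have "{..2::nat} = {0, Suc 0, 2}" by auto
  then have "chain_boundary 2 (frag_of (simplex2 F)) = frag_of (singular_face 2 0 (simplex2 F))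
      - frag_of (singular_face 2 (Suc 0) (simplex2 F)) + frag_of (singular_face 2 2 (simplex2 F))"
    by (simp add: chain_boundary_of)
  then show ?thesis by (simp only: 0 1 2)
qed

text \<open>Simplices may cancel in a sum of chains, so additivity is checked on a common finite set
  of simplices instead of the supports.\<close>

lemma chain_integral_superset:
  assumes "finite S" and "Poly_Mapping.keys C \<subseteq> S"
  shows "chain_integral G w C = (\<Sum>\<sigma>\<in>S. of_int (Poly_Mapping.lookup C \<sigma>) * simplex_integral G w \<sigma>)"
  unfolding chain_integral_def
  by (rule sum.mono_neutral_left) (use assms in \<open>auto simp: in_keys_iff\<close>)

lemma chain_integral_add: "chain_integral G w (C + D) = chain_integral G w C + chain_integral G w D"
proof -
  let ?S = "Poly_Mapping.keys C \<union> Poly_Mapping.keys D"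
  have "chain_integral G w (C + D) = (\<Sum>\<sigma>\<in>?S. of_int (Poly_Mapping.lookup (C + D) \<sigma>) * simplex_integral G w \<sigma>)"
    by (rule chain_integral_superset) (use keys_add[of C D] in auto)
  moreover have "chain_integral G w C = (\<Sum>\<sigma>\<in>?S. of_int (Poly_Mapping.lookup C \<sigma>) * simplex_integral G w \<sigma>)"
    "chain_integral G w D = (\<Sum>\<sigma>\<in>?S. of_int (Poly_Mapping.lookup D \<sigma>) * simplex_integral G w \<sigma>)"
    by (rule chain_integral_superset; auto)+
  ultimately show ?thesis by (simp add: lookup_add distrib_right sum.distrib)
qed

lemma chain_integral_zero [simp]: "chain_integral G w 0 = 0"
  by (simp add: chain_integral_def)

lemma chain_integral_uminus: "chain_integral G w (- C) = - chain_integral G w C"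
  using chain_integral_add[of G w C "- C"] by (simp add: eq_neg_iff_add_eq_0 add.commute)

lemma chain_integral_diff: "chain_integral G w (C - D) = chain_integral G w C - chain_integral G w D"
  using chain_integral_add[of G w C "- D"] by (simp add: chain_integral_uminus)

lemma chain_integral_of [simp]: "chain_integral G w (frag_of \<sigma>) = simplex_integral G w \<sigma>"
  by (simp add: chain_integral_def)

lemma smooth_2chain_add: "smooth_2chain G C \<Longrightarrow> smooth_2chain G D \<Longrightarrow> smooth_2chain G (C + D)"
  unfolding smooth_2chain_def using keys_add[of C D] by (meson Un_least order_trans)

lemma smooth_2chain_diff: "smooth_2chain G C \<Longrightarrow> smooth_2chain G D \<Longrightarrow> smooth_2chain G (C - D)"
  unfolding smooth_2chain_def using keys_diff[of C D] by (meson Un_least order_trans)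

lemma smooth_2chain_zero: "smooth_2chain G 0"
  by (simp add: smooth_2chain_def)

lemma smooth_2chain_of:
  "open S \<Longrightarrow> triangle \<subseteq> S \<Longrightarrow> smooth_family G S F \<Longrightarrow> smooth_2chain G (frag_of (simplex2 F))"
  unfolding smooth_2chain_def by auto

lemma path_chain_simps [simp]:
  "path_chain [] = 0" "path_chain (p # P) = frag_of (simplex1 p) + path_chain P"
  "path_chain (P @ Q) = path_chain P + path_chain Q"
  by (simp_all add: path_chain_def)

context lie
begin

text \<open>Simplices are restricted functions; their partial derivatives are computed from a smooth
  curve that agrees with them nearby.\<close>

lemma left_log_deriv_local:
  assumes T: "open T" and c': "smooth_map_on G T c'" and "s \<in> T" and eq: "\<And>r. r \<in> T \<Longrightarrow> c r = c' r"
  shows "left_log_deriv G c s = llog G c' s 1"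
proof -
  have c: "smooth_map_on G T c" by (rule smooth_map_on_cong[OF T _ c']) (simp add: eq)
  show ?thesis
    using left_log_deriv_eq_llog[OF T c assms(3)] llog_cong(1)[OF T _ c assms(3), of c'] eq by simp
qed

lemma simplex_integral_simplex2:
  assumes S: "open S" "triangle \<subseteq> S" and F: "smooth_family G S F"
  shows "simplex_integral G w (simplex2 F) =
    integral triangle (\<lambda>(u, v). w (lvel G (\<lambda>r. F (r, v)) u) (lvel G (\<lambda>r. F (u, r)) v))"
  unfolding simplex_integral_def
\<comment> \<open>The three lines carry the edges of the triangle. Away from them a point is
  interior, so short coordinate segments stay in the triangle, where \<open>simplex2 F\<close>
  agrees with F.\<close>
proof (rule integral_spike[where S = "{x. (1, 0) \<bullet> x = 0} \<union> {x. (0, 1) \<bullet> x = 0} \<union> {x. (1, 1) \<bullet> x = (1 :: real)}"])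
  show "negligible ({x. (1, 0) \<bullet> x = 0} \<union> {x. (0, 1) \<bullet> x = 0} \<union> {x :: real \<times> real. (1, 1) \<bullet> x = (1 :: real)})"
    by (intro negligible_Un negligible_hyperplane) (auto simp: zero_prod_def)
  fix x :: "real \<times> real"
  assume x: "x \<in> triangle - ({x. (1, 0) \<bullet> x = 0} \<union> {x. (0, 1) \<bullet> x = 0} \<union> {x. (1, 1) \<bullet> x = (1 :: real)})"
  obtain u v where uv: "x = (u, v)" by (cases x)
  have in_tri: "0 < u" "0 < v" "u + v < 1" using x by (auto simp: uv triangle_def)
  let ?U = "{0<..<1 - v}" and ?V = "{0<..<1 - u}"
  have "smooth_family G ?U (\<lambda>r. F (r, v))"
    by (rule smooth_family_compose[OF _ S(1) F])
      (use S(2) in_tri in \<open>auto simp: triangle_def intro!: smooth_on_Pair smooth_on_const smooth_on_id\<close>)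
  from smooth_section[OF _ this] have smU: "smooth_map_on G ?U (\<lambda>r. F (r, v) \<theta>)" for \<theta> by simp
  have "smooth_family G ?V (\<lambda>r. F (u, r))"
    by (rule smooth_family_compose[OF _ S(1) F])
      (use S(2) in_tri in \<open>auto simp: triangle_def intro!: smooth_on_Pair smooth_on_const smooth_on_id\<close>)
  from smooth_section[OF _ this] have smV: "smooth_map_on G ?V (\<lambda>r. F (u, r) \<theta>)" for \<theta> by simp
  have "left_log_deriv G (\<lambda>r. simplex2 F (triangle_point r v) \<theta>) u = llog G (\<lambda>r. F (r, v) \<theta>) u 1" for \<theta>
    by (rule left_log_deriv_local[OF _ smU])
      (use in_tri in \<open>auto simp: simplex2_triangle_point triangle_def\<close>)
  moreover have "left_log_deriv G (\<lambda>r. simplex2 F (triangle_point u r) \<theta>) v = llog G (\<lambda>r. F (u, r) \<theta>) v 1" for \<theta>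
    by (rule left_log_deriv_local[OF _ smV])
      (use in_tri in \<open>auto simp: simplex2_triangle_point triangle_def\<close>)
  ultimately show "(case x of (u, v) \<Rightarrow> w (lvel G (\<lambda>r. F (r, v)) u) (lvel G (\<lambda>r. F (u, r)) v)) =
      (case x of (u, v) \<Rightarrow> w (\<lambda>\<theta>. left_log_deriv G (\<lambda>r. simplex2 F (triangle_point r v) \<theta>) u)
        (\<lambda>\<theta>. left_log_deriv G (\<lambda>r. simplex2 F (triangle_point u r) \<theta>) v))"
    by (simp add: uv lvel_def)
qed

end

section \<open>Lie algebras of subgroups of the loop group\<close>

context lie
begin

lemma loop_subgroup:
  assumes "subgroup H (loop_group G)"
  shows "\<And>x. x \<in> H \<Longrightarrow> x \<in> carrier (loop_group G)"
    and "\<And>x y. x \<in> H \<Longrightarrow> y \<in> H \<Longrightarrow> (\<lambda>\<theta>. x \<theta> \<otimes> y \<theta>) \<in> H"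
    and "\<And>x. x \<in> H \<Longrightarrow> (\<lambda>\<theta>. inv (x \<theta>)) \<in> H"
    and "(\<lambda>\<theta>. \<one>) \<in> H"
proof -
  show c: "\<And>x. x \<in> H \<Longrightarrow> x \<in> carrier (loop_group G)" using subgroup.mem_carrier[OF assms] .
  show "\<And>x y. x \<in> H \<Longrightarrow> y \<in> H \<Longrightarrow> (\<lambda>\<theta>. x \<theta> \<otimes> y \<theta>) \<in> H"
    using subgroup.m_closed[OF assms] by simp
  show "\<And>x. x \<in> H \<Longrightarrow> (\<lambda>\<theta>. inv (x \<theta>)) \<in> H"
    using subgroup.m_inv_closed[OF assms] loop_inv[OF c] by metis
  show "(\<lambda>\<theta>. \<one>) \<in> H" using subgroup.one_closed[OF assms] by simp
qed

text \<open>The velocity in the chart and the left logarithmic derivative coincide because c 0 is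
  the identity.\<close>

lemma lie_algebra_ofI:
  assumes "open S" and "0 \<in> S" and "smooth_family G S c" and "\<And>s. s \<in> S \<Longrightarrow> c s \<in> H"
    and "c 0 = (\<lambda>\<theta>. \<one>)"
  shows "lvel G c 0 \<in> lie_algebra_of G H"
proof -
  obtain e where e: "e > 0" "ball 0 e \<subseteq> S" using assms(1,2) open_contains_ball by blast
  then have sub: "{-e<..<e} \<subseteq> S" by (auto simp: ball_def dist_real_def subset_iff abs_less_iff)
  have "lvel G c 0 = (\<lambda>\<theta>. vector_derivative (\<lambda>s. ch (c s \<theta>)) (at 0))"
  proof
    fix \<theta>
    have "((\<lambda>s. ch (c s \<theta>)) has_vector_derivative lvel G c 0 \<theta>) (at 0)"
      using llog_has_vector_derivative[OF assms(1) smooth_section[OF assms(1,3)] assms(2), of \<theta>] assms(5)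
      by (simp add: lvel_def)
    then show "lvel G c 0 \<theta> = vector_derivative (\<lambda>s. ch (c s \<theta>)) (at 0)" by (simp add: vector_derivative_at)
  qed
  then show ?thesis
    using e sub assms smooth_family_subset[OF assms(3) sub] unfolding lie_algebra_of_def
    by (auto intro!: exI[of _ e] exI[of _ c])
qed

lemma lie_algebra_ofE:
  assumes "\<xi> \<in> lie_algebra_of G H"
  obtains S c where "open S" and "0 \<in> S" and "smooth_family G S c" and "\<And>s. s \<in> S \<Longrightarrow> c s \<in> H"
    and "c 0 = (\<lambda>\<theta>. \<one>)" and "\<xi> = lvel G c 0"
proof -
  obtain e c where c: "e > 0" "smooth_family G {-e<..<e} c" "\<forall>s\<in>{-e<..<e}. c s \<in> H" "c 0 = (\<lambda>\<theta>. \<one>)"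
    "\<xi> = (\<lambda>\<theta>. vector_derivative (\<lambda>s. ch (c s \<theta>)) (at 0))"
    using assms unfolding lie_algebra_of_def by auto
  have op: "open {-e<..<e}" "0 \<in> {-e<..<e}" using c(1) by auto
  have "\<xi> = lvel G c 0"
  proof
    fix \<theta>
    have "((\<lambda>s. ch (c s \<theta>)) has_vector_derivative lvel G c 0 \<theta>) (at 0)"
      using llog_has_vector_derivative[OF op(1) smooth_section[OF op(1) c(2)] op(2), of \<theta>] c(4)
      by (simp add: lvel_def)
    then show "\<xi> \<theta> = lvel G c 0 \<theta>" by (simp add: vector_derivative_at c(5))
  qed
  then show thesis using that[OF op c(2)] c by blast
qed

text \<open>Translating the curve to the identity from the left, F(s)^{-1} F(s + u), or from the
  right, F(s + u) F(s)^{-1}, gives curves in H with these velocities.\<close>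

lemma vel_in_lie_algebra:
  assumes H: "subgroup H (loop_group G)" and S: "open S" and F: "smooth_family G S F" and s: "s \<in> S"
    and mem: "\<And>r. r \<in> S \<Longrightarrow> F r \<in> H"
  shows "lvel G F s \<in> lie_algebra_of G H" and "rvel G F s \<in> lie_algebra_of G H"
proof -
  let ?k = "\<lambda>u. s + u"
  have k: "(?k has_vector_derivative 1) (at 0)" by (auto intro!: derivative_eq_intros)
  have op: "open (?k -` S)" by (intro open_vimage S continuous_intros)
  have Fk: "smooth_family G (?k -` S) (\<lambda>u. F (?k u))"
    by (rule smooth_family_compose[OF op S F]) (use op in \<open>auto intro!: smooth_on_add\<close>)
  have const: "smooth_family G (?k -` S) (\<lambda>u \<theta>. inv (F s \<theta>))"
    by (rule smooth_family_const[OF op loop_carrier_inv[OF smooth_familyD(1)[OF F s]]])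
  have s0: "?k 0 \<in> S" "0 \<in> ?k -` S" using s by auto
  have "lvel G (\<lambda>u \<theta>. inv (F s \<theta>) \<otimes> F (?k u) \<theta>) 0 \<in> lie_algebra_of G H"
    by (rule lie_algebra_ofI[OF op s0(2) smooth_family_mult[OF op const Fk]])
      (use loop_subgroup[OF H] mem s in auto)
  moreover have "lvel G (\<lambda>u \<theta>. inv (F s \<theta>) \<otimes> F (?k u) \<theta>) 0 = lvel G F s"
    using vel_mult(1)[OF op const Fk s0(2)] vel_compose(1)[OF S F s0(1) k] by auto
  ultimately show "lvel G F s \<in> lie_algebra_of G H" by simp
  have "lvel G (\<lambda>u \<theta>. F (?k u) \<theta> \<otimes> inv (F s \<theta>)) 0 \<in> lie_algebra_of G H"
    by (rule lie_algebra_ofI[OF op s0(2) smooth_family_mult[OF op Fk const]])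
      (use loop_subgroup[OF H] mem s in auto)
  moreover have "lvel G (\<lambda>u \<theta>. F (?k u) \<theta> \<otimes> inv (F s \<theta>)) 0 = rvel G F s"
    using vel_mult(1)[OF op Fk const s0(2)] vel_compose(1)[OF S F s0(1) k] rvel_eq[OF S F s] by auto
  ultimately show "rvel G F s \<in> lie_algebra_of G H" by simp
qed

text \<open>Conjugation by g takes a curve in H representing \<xi> to another curve in H.\<close>

lemma Ad_in_lie_algebra:
  assumes H: "subgroup H (loop_group G)" and g: "g \<in> H" and \<xi>: "\<xi> \<in> lie_algebra_of G H"
  shows "loop_Ad G g \<xi> \<in> lie_algebra_of G H"
proof -
  obtain S c where c: "open S" "0 \<in> S" "smooth_family G S c" "\<And>s. s \<in> S \<Longrightarrow> c s \<in> H" "c 0 = (\<lambda>\<theta>. \<one>)"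
    "\<xi> = lvel G c 0" using lie_algebra_ofE[OF \<xi>] by blast
  have gc: "smooth_family G S (\<lambda>s. g)" "smooth_family G S (\<lambda>s \<theta>. inv (g \<theta>))"
    using smooth_family_const[OF c(1)] loop_subgroup(1)[OF H g] loop_carrier_inv by blast+
  have m: "smooth_family G S (\<lambda>s \<theta>. g \<theta> \<otimes> c s \<theta>)" by (rule smooth_family_mult[OF c(1) gc(1) c(3)])
  have "lvel G (\<lambda>s \<theta>. g \<theta> \<otimes> c s \<theta> \<otimes> inv (g \<theta>)) 0 \<in> lie_algebra_of G H"
    by (rule lie_algebra_ofI[OF c(1,2) smooth_family_mult[OF c(1) m gc(2)]])
      (use loop_subgroup[OF H] c g in auto)
  moreover have "lvel G (\<lambda>s \<theta>. g \<theta> \<otimes> c s \<theta> \<otimes> inv (g \<theta>)) 0 = loop_Ad G g \<xi>"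
    using vel_mult(1)[OF c(1) m gc(2) c(2)] vel_mult(1)[OF c(1) gc(1) c(3) c(2)]
    by (auto simp: loop_Ad_def c(6))
  ultimately show ?thesis by simp
qed

end

section \<open>Integration of the left invariant form over rectangles\<close>

lemma smooth_on_snd_derivative:
  fixes f :: "'a::euclidean_space \<times> real \<Rightarrow> 'b::real_normed_vector"
  assumes "smooth_on S f" and "(p, \<theta>) \<in> S"
  shows "((\<lambda>\<theta>. f (p, \<theta>)) has_vector_derivative frechet_derivative f (at (p, \<theta>)) (0, 1)) (at \<theta>)"
proof -
  have D: "(f has_derivative frechet_derivative f (at (p, \<theta>))) (at (p, \<theta>))" using smooth_on_has_derivative assms by blast
  have l: "frechet_derivative f (at (p, \<theta>)) (0, h) = h *\<^sub>R frechet_derivative f (at (p, \<theta>)) (0, 1)" for h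
    using linear_scale[OF has_derivative_linear[OF D], of h "(0, 1)"]
    by (simp only: scaleR_Pair real_scaleR_def mult_1_right scaleR_zero_right)
  have "((\<lambda>r. f (p, r)) has_derivative (\<lambda>h. frechet_derivative f (at (p, \<theta>)) (0, h))) (at \<theta>)"
    by (rule has_derivative_compose[of "\<lambda>r. (p, r)" "\<lambda>h. (0, h)"])
      (use D in \<open>auto intro!: derivative_eq_intros\<close>)
  then show ?thesis
    unfolding has_vector_derivative_def by (rule has_derivative_eq_rhs) (rule ext, rule l)
qed

context lie_form
begin

lemma continuous_on_pairing:
  assumes "continuous_on (T \<times> {0..2 * pi}) (\<lambda>x. a (fst x) (snd x))"
    and "continuous_on (T \<times> {0..2 * pi}) (\<lambda>x. b (fst x) (snd x))"
  shows "continuous_on T (\<lambda>p. pairing (a p) (b p))"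
proof -
  have "continuous_on T (\<lambda>p. integral (cbox 0 (2 * pi)) (\<lambda>\<theta>. B (a p \<theta>) (b p \<theta>)))"
    by (rule integral_continuous_on_param)
      (use continuous_on_B[OF assms] in \<open>simp add: case_prod_unfold\<close>)
  then show ?thesis unfolding pairing_def by (intro continuous_on_mult_left) simp
qed

end

locale lie_cocycle = lie_form +
  assumes cocycle: "two_cocycle G (residue_cocycle B)"
begin

abbreviation "w \<equiv> residue_cocycle B"

lemma w_anti: "\<xi> \<in> loop_algebra \<Longrightarrow> \<eta> \<in> loop_algebra \<Longrightarrow> w \<xi> \<eta> = - w \<eta> \<xi>"
  using cocycle unfolding two_cocycle_def by blast

lemma w_self: "\<xi> \<in> loop_algebra \<Longrightarrow> w \<xi> \<xi> = 0"
  using w_anti[of \<xi> \<xi>] by simp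

lemma w_add_right:
  assumes "\<xi> \<in> loop_algebra" and "\<eta> \<in> loop_algebra" and "\<zeta> \<in> loop_algebra"
  shows "w \<xi> (\<lambda>\<theta>. \<eta> \<theta> + \<zeta> \<theta>) = w \<xi> \<eta> + w \<xi> \<zeta>"
proof -
  note sm = loop_algebra_smooth[OF assms(2)] loop_algebra_smooth[OF assms(3)]
    smooth_on_vector_derivative(1)[OF open_UNIV loop_algebra_smooth[OF assms(1)]]
  show ?thesis
    unfolding residue_cocycle_eq pairing_def B_add
    by (subst integral_add) (use sm in \<open>auto intro!: pairing_integrable simp: distrib_left\<close>)
qed

text \<open>The rectangle \<open>(s, r) \<mapsto> h(s) q(r)\<close> is cut along its diagonal: \<open>tri_lower\<close> is the half \<open>r \<le> s\<close> and
  \<open>tri_upper\<close> the half \<open>s \<le> r\<close>, which enters with the opposite orientation.\<close>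
definition tri_lower :: "(real \<Rightarrow> real \<Rightarrow> 'a) \<Rightarrow> (real \<Rightarrow> real \<Rightarrow> 'a) \<Rightarrow> (nat \<Rightarrow> real) \<Rightarrow> real \<Rightarrow> 'a" where
  "tri_lower h q = simplex2 (\<lambda>x \<theta>. h (fst x + snd x) \<theta> \<otimes> q (snd x) \<theta>)"

definition tri_upper :: "(real \<Rightarrow> real \<Rightarrow> 'a) \<Rightarrow> (real \<Rightarrow> real \<Rightarrow> 'a) \<Rightarrow> (nat \<Rightarrow> real) \<Rightarrow> real \<Rightarrow> 'a" where
  "tri_upper h q = simplex2 (\<lambda>x \<theta>. h (snd x) \<theta> \<otimes> q (fst x + snd x) \<theta>)"

definition rect_chain :: "(real \<Rightarrow> real \<Rightarrow> 'a) \<Rightarrow> (real \<Rightarrow> real \<Rightarrow> 'a) list \<Rightarrow> (real \<Rightarrow> 'a) chain" where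
  "rect_chain h Q = (\<Sum>q\<leftarrow>Q. frag_of (tri_lower h q) - frag_of (tri_upper h q))"

context
  fixes S :: "real set" and h q :: "real \<Rightarrow> real \<Rightarrow> 'a"
  assumes S: "open S" "{0..1} \<subseteq> S" and h: "smooth_family G S h" and q: "smooth_family G S q"
begin

text \<open>An open neighbourhood of the triangle on which both shears stay in S; smooth simplices
  must extend past their edges.\<close>

private definition "T = {x :: real \<times> real. fst x + snd x \<in> S \<and> snd x \<in> S}"

private lemma T: "open T" "triangle \<subseteq> T"
proof -
  have "T = ((\<lambda>x. fst x + snd x) -` S) \<inter> (snd -` S)" by (auto simp: T_def)
  then show "open T" using S(1) by (auto intro!: open_Int open_vimage continuous_intros)
  show "triangle \<subseteq> T" using S(2) by (auto simp: T_def triangle_def)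
qed

private lemma shear_families:
  "smooth_family G T (\<lambda>x \<theta>. h (fst x + snd x) \<theta> \<otimes> q (snd x) \<theta>)"
  "smooth_family G T (\<lambda>x \<theta>. h (snd x) \<theta> \<otimes> q (fst x + snd x) \<theta>)"
proof -
  have sm: "smooth_on T (\<lambda>x. fst x + snd x)" "smooth_on T (\<lambda>x. snd x)"
    by (intro smooth_on_add smooth_on_fst smooth_on_snd smooth_on_id T)+
  have img: "(\<lambda>x. fst x + snd x) ` T \<subseteq> S" "snd ` T \<subseteq> S" by (auto simp: T_def)
  show "smooth_family G T (\<lambda>x \<theta>. h (fst x + snd x) \<theta> \<otimes> q (snd x) \<theta>)"
    "smooth_family G T (\<lambda>x \<theta>. h (snd x) \<theta> \<otimes> q (fst x + snd x) \<theta>)"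
    by (rule smooth_family_mult[OF T(1) smooth_family_compose[OF T(1) S(1) h sm(1) img(1)]
          smooth_family_compose[OF T(1) S(1) q sm(2) img(2)]],
        rule smooth_family_mult[OF T(1) smooth_family_compose[OF T(1) S(1) h sm(2) img(2)]
          smooth_family_compose[OF T(1) S(1) q sm(1) img(1)]])
qed

lemma smooth_2chain_tri: "smooth_2chain G (frag_of (tri_lower h q))" "smooth_2chain G (frag_of (tri_upper h q))"
  unfolding tri_lower_def tri_upper_def using smooth_2chain_of[OF T] shear_families by auto

text \<open>The left invariant form on (s, r) \<mapsto> h(s) q(r): the left logarithmic derivatives
  of this product in s and in r are Ad (q^{-1}) (h^{-1} h') and q^{-1} q'.\<close>

private definition "\<phi> s r = w (loop_Ad G (\<lambda>\<theta>. inv (q r \<theta>)) (lvel G h s)) (lvel G q r)"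

private lemma factors:
  assumes "s \<in> S" "r \<in> S"
  shows "loop_Ad G (\<lambda>\<theta>. inv (q r \<theta>)) (lvel G h s) \<in> loop_algebra" "lvel G q r \<in> loop_algebra"
  using smooth_loop_Ad[OF loop_carrier_inv[OF smooth_familyD(1)[OF q assms(2)]] vel_loop_algebra(1)[OF S(1) h assms(1)]]
    vel_loop_algebra(1)[OF S(1) q assms(2)] by auto

private lemma shift_vel:
  assumes F: "smooth_family G S F" and "a + b \<in> S"
  shows "lvel G (\<lambda>r. F (r + b)) a = lvel G F (a + b)" "lvel G (\<lambda>r. F (b + r)) a = lvel G F (a + b)"
proof -
  have "((\<lambda>r. r + b) has_vector_derivative 1) (at a)" "((\<lambda>r. b + r) has_vector_derivative 1) (at a)"
    by (auto intro!: derivative_eq_intros)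
  then show "lvel G (\<lambda>r. F (r + b)) a = lvel G F (a + b)" "lvel G (\<lambda>r. F (b + r)) a = lvel G F (a + b)"
    using vel_compose(1)[OF S(1) F, of "\<lambda>r. r + b" a 1] vel_compose(1)[OF S(1) F, of "\<lambda>r. b + r" a 1] assms(2)
    by (auto simp: add.commute)
qed

private lemma shift_family:
  assumes F: "smooth_family G S F"
  shows "open ((\<lambda>r. r + b) -` S)" "smooth_family G ((\<lambda>r. r + b) -` S) (\<lambda>r. F (r + b))"
proof -
  show op: "open ((\<lambda>r. r + b) -` S)" by (intro open_vimage S continuous_intros)
  show "smooth_family G ((\<lambda>r. r + b) -` S) (\<lambda>r. F (r + b))"
    by (rule smooth_family_compose[OF op S(1) F]) (use op in \<open>auto intro!: smooth_on_add\<close>)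
qed

text \<open>The v-direction of the simplex moves both factors. Its h-part equals the u-direction and
  drops out by antisymmetry.\<close>

private lemma integrand_lower:
  assumes uv: "(u, v) \<in> triangle"
  shows "w (lvel G (\<lambda>r \<theta>. h (r + v) \<theta> \<otimes> q v \<theta>) u) (lvel G (\<lambda>r \<theta>. h (u + r) \<theta> \<otimes> q r \<theta>) v) = \<phi> (u + v) v"
proof -
  have mem: "u + v \<in> S" "v \<in> S" using uv S(2) by (auto simp: triangle_def)
  have 1: "lvel G (\<lambda>r \<theta>. h (r + v) \<theta> \<otimes> q v \<theta>) u = loop_Ad G (\<lambda>\<theta>. inv (q v \<theta>)) (lvel G h (u + v))"
    using vel_mult(1)[OF shift_family[OF h, of v] smooth_family_const[OF shift_family(1)[OF h] smooth_familyD(1)[OF q mem(2)]], of u]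
      mem shift_vel[OF h mem(1)] by (auto simp: loop_Ad_def)
  define R where "R = ((\<lambda>r. r + u) -` S) \<inter> S"
  have R: "open R" "v \<in> R" "R \<subseteq> S" "R \<subseteq> (\<lambda>r. r + u) -` S"
    using shift_family(1)[OF h, of u] S mem by (auto simp: R_def add.commute)
  have "smooth_family G R (\<lambda>r. h (r + u))" "smooth_family G R q"
    using smooth_family_subset[OF shift_family(2)[OF h] R(4)] smooth_family_subset[OF q R(3)] by auto
  from vel_mult(1)[OF R(1) this R(2)]
  have 2: "lvel G (\<lambda>r \<theta>. h (u + r) \<theta> \<otimes> q r \<theta>) v =
      (\<lambda>\<theta>. loop_Ad G (\<lambda>\<theta>. inv (q v \<theta>)) (lvel G h (u + v)) \<theta> + lvel G q v \<theta>)"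
    using shift_vel[OF h, of v u] mem by (auto simp: loop_Ad_def add.commute)
  show ?thesis unfolding 1 2 \<phi>_def using factors[OF mem] by (simp add: w_add_right w_self)
qed

text \<open>Here the u-direction moves q alone, so the q-part of the v-direction drops out. The
  remaining arguments stand in the opposite order, hence the sign.\<close>

private lemma integrand_upper:
  assumes uv: "(u, v) \<in> triangle"
  shows "w (lvel G (\<lambda>r \<theta>. h v \<theta> \<otimes> q (r + v) \<theta>) u) (lvel G (\<lambda>r \<theta>. h r \<theta> \<otimes> q (u + r) \<theta>) v) = - \<phi> v (u + v)"
proof -
  have mem: "u + v \<in> S" "v \<in> S" using uv S(2) by (auto simp: triangle_def)
  have 1: "lvel G (\<lambda>r \<theta>. h v \<theta> \<otimes> q (r + v) \<theta>) u = lvel G q (u + v)"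
    using vel_mult(1)[OF shift_family(1)[OF q, of v] smooth_family_const[OF shift_family(1)[OF q] smooth_familyD(1)[OF h mem(2)]]
        shift_family(2)[OF q, of v], of u]
      mem shift_vel[OF q mem(1)] by auto
  define R where "R = ((\<lambda>r. r + u) -` S) \<inter> S"
  have R: "open R" "v \<in> R" "R \<subseteq> S" "R \<subseteq> (\<lambda>r. r + u) -` S"
    using shift_family(1)[OF q, of u] S mem by (auto simp: R_def add.commute)
  have "smooth_family G R h" "smooth_family G R (\<lambda>r. q (r + u))"
    using smooth_family_subset[OF shift_family(2)[OF q] R(4)] smooth_family_subset[OF h R(3)] by auto
  from vel_mult(1)[OF R(1) this R(2)]
  have 2: "lvel G (\<lambda>r \<theta>. h r \<theta> \<otimes> q (u + r) \<theta>) v =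
      (\<lambda>\<theta>. loop_Ad G (\<lambda>\<theta>. inv (q (u + v) \<theta>)) (lvel G h v) \<theta> + lvel G q (u + v) \<theta>)"
    using shift_vel[OF q, of v u] mem by (auto simp: loop_Ad_def add.commute)
  show ?thesis
    unfolding 1 2 \<phi>_def using factors[OF mem(2,1)] w_anti[OF factors(2)[OF mem(2,1)] factors(1)[OF mem(2,1)]]
    by (simp add: w_add_right w_self)
qed

private lemma continuous_\<phi>: "continuous_on ({0..1} \<times> {0..1}) (\<lambda>x. \<phi> (fst x) (snd x))"
proof -
  have op: "open (S \<times> S)" using S(1) by (simp add: open_Times)
  have "smooth_family G (S \<times> S) (\<lambda>p. q (snd p))"
    by (rule smooth_family_compose[OF op S(1) q]) (use op in \<open>auto intro!: smooth_on_snd smooth_on_id\<close>)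
  from smooth_familyD(2)[OF smooth_family_inv[OF op this]]
  have sq: "smooth_map_on G ((S \<times> S) \<times> UNIV) (\<lambda>x. inv (q (snd (fst x)) (snd x)))" .
  have op2: "open ((S \<times> S) \<times> (UNIV :: real set))" by (rule open_strip[OF op])
  have img: "(\<lambda>x. (fst (fst x), snd x)) ` ((S \<times> S) \<times> UNIV) \<subseteq> S \<times> (UNIV :: real set)"
    "(\<lambda>x. (snd (fst x), snd x)) ` ((S \<times> S) \<times> UNIV) \<subseteq> S \<times> (UNIV :: real set)" by auto
  have proj: "smooth_on ((S \<times> S) \<times> UNIV) (\<lambda>x :: (real \<times> real) \<times> real. (fst (fst x), snd x))"
    "smooth_on ((S \<times> S) \<times> UNIV) (\<lambda>x :: (real \<times> real) \<times> real. (snd (fst x), snd x))"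
    using op2 by (auto intro!: smooth_on_Pair smooth_on_fst smooth_on_snd smooth_on_id)
  have sh: "smooth_on ((S \<times> S) \<times> UNIV) (\<lambda>x. lvel G h (fst (fst x)) (snd x))"
    using smooth_on_compose[OF op2 smooth_vel(1)[OF S(1) h] proj(1) img(1)] by (simp only: fst_conv snd_conv)
  have sk: "smooth_on ((S \<times> S) \<times> UNIV) (\<lambda>x. lvel G q (snd (fst x)) (snd x))"
    using smooth_on_compose[OF op2 smooth_vel(1)[OF S(1) q] proj(2) img(2)] by (simp only: fst_conv snd_conv)
  \<comment> \<open>w differentiates its first argument in the angle. As a function A of both
    parameters and the angle this argument is smooth, so that derivative is jointly
    continuous.\<close>
  define A where "A = (\<lambda>x. Ad G (inv (q (snd (fst x)) (snd x))) (lvel G h (fst (fst x)) (snd x)))"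
  have A: "smooth_on ((S \<times> S) \<times> UNIV) A" unfolding A_def by (rule smooth_on_Ad[OF op2 sq sh])
  have sub: "({0..1} \<times> {0..1}) \<times> {0..2 * pi} \<subseteq> (S \<times> S) \<times> (UNIV :: real set)" using S(2) by auto
  have "continuous_on ({0..1} \<times> {0..1}) (\<lambda>p. pairing (\<lambda>\<theta>. frechet_derivative A (at (p, \<theta>)) (0, 1)) (\<lambda>\<theta>. lvel G q (snd p) \<theta>))"
    by (rule continuous_on_pairing)
      (use continuous_on_subset[OF smooth_on_continuous_on[OF smooth_on_derivative[OF A, of "(0, 1)"]] sub]
        continuous_on_subset[OF smooth_on_continuous_on[OF sk] sub] in auto)
  moreover have "pairing (\<lambda>\<theta>. frechet_derivative A (at (p, \<theta>)) (0, 1)) (\<lambda>\<theta>. lvel G q (snd p) \<theta>) = \<phi> (fst p) (snd p)"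
    if p: "p \<in> {0..1} \<times> {0..1}" for p
  proof -
    have "p \<in> S \<times> S" using p S(2) by auto
    then have "vector_derivative (\<lambda>\<theta>. A (p, \<theta>)) (at \<theta>) = frechet_derivative A (at (p, \<theta>)) (0, 1)" for \<theta>
      using vector_derivative_at[OF smooth_on_snd_derivative[OF A, of p \<theta>]] by simp
    moreover have "(\<lambda>\<theta>. A (p, \<theta>)) = loop_Ad G (\<lambda>\<theta>. inv (q (snd p) \<theta>)) (lvel G h (fst p))"
      by (auto simp: A_def loop_Ad_def)
    ultimately show ?thesis by (simp add: \<phi>_def residue_cocycle_eq)
  qed
  ultimately show ?thesis by (rule continuous_on_eq)
qed

text \<open>For s fixed and q with values in \<open>B_inv\<close>, minus a primitive of r \<mapsto>
  \<phi> s r, by \<open>rangle_pairing_derivative\<close>.\<close>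

definition "\<Psi> s r = pairing (lvel G h s) (rangle G (q r))"

lemma continuous_\<Psi>: "continuous_on (S \<times> S) (\<lambda>x. \<Psi> (fst x) (snd x))"
  unfolding \<Psi>_def
proof (rule continuous_on_pairing)
  show "continuous_on ((S \<times> S) \<times> {0..2 * pi}) (\<lambda>x. lvel G h (fst (fst x)) (snd x))"
    by (rule continuous_on_compose2[OF smooth_on_continuous_on[OF smooth_vel(1)[OF S(1) h]], of _ "\<lambda>x. (fst (fst x), snd x)", simplified])
      (auto intro!: continuous_intros)
  show "continuous_on ((S \<times> S) \<times> {0..2 * pi}) (\<lambda>x. rangle G (q (snd (fst x))) (snd x))"
    by (rule continuous_on_compose2[OF smooth_on_continuous_on[OF smooth_angle(2)[OF S(1) q]], of _ "\<lambda>x. (snd (fst x), snd x)", simplified])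
      (auto intro!: continuous_intros)
qed

lemma continuous_\<Psi>_graph:
  assumes "continuous_on {0..1} k" and "k ` {0..1} \<subseteq> S"
  shows "continuous_on {0..1} (\<lambda>s. \<Psi> s (k s))"
proof -
  have "continuous_on {0..1} (\<lambda>s. (s, k s))" by (intro continuous_intros assms)
  moreover have "(\<lambda>s. (s, k s)) ` {0..1} \<subseteq> S \<times> S" using assms(2) S(2) by auto
  ultimately show ?thesis
    using continuous_on_compose2[OF continuous_\<Psi>, of "{0..1}" "\<lambda>s. (s, k s)"] by (simp only: fst_conv snd_conv)
qed

context
  assumes inv_q: "\<And>s \<theta>. s \<in> {0..1} \<Longrightarrow> q s \<theta> \<in> B_inv"
begin

private lemma integral_\<phi>:
  assumes "s \<in> {0..1}" "0 \<le> a" "a \<le> b" "b \<le> 1"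
  shows "integral {a..b} (\<lambda>r. \<phi> s r) = \<Psi> s a - \<Psi> s b"
proof -
  have sS: "s \<in> S" using assms(1) S(2) by blast
  have "((\<lambda>r. \<Psi> s r) has_vector_derivative - \<phi> s r) (at r within {a..b})" if "r \<in> {a..b}" for r
  proof -
    have "r \<in> {0..1}" using that assms by auto
    from rangle_pairing_derivative[OF S q inv_q vel_loop_algebra(1)[OF S(1) h sS] this]
    show ?thesis unfolding \<Psi>_def \<phi>_def
      by (rule has_vector_derivative_within_subset) (use assms in auto)
  qed
  then have "((\<lambda>r. - \<phi> s r) has_integral \<Psi> s b - \<Psi> s a) {a..b}"
    by (intro fundamental_theorem_of_calculus assms) auto
  from has_integral_neg[OF this] show ?thesis by (simp add: integral_unique)
qed

lemma simplex_integral_lower: "simplex_integral G w (tri_lower h q) = integral {0..1} (\<lambda>s. \<Psi> s 0 - \<Psi> s s)"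
proof -
  have "simplex_integral G w (tri_lower h q) = integral triangle (\<lambda>(u, v). \<phi> (u + v) v)"
    unfolding tri_lower_def simplex_integral_simplex2[OF T shear_families(1)]
    by (rule integral_cong) (use integrand_lower in auto)
  also have "\<dots> = integral {0..1} (\<lambda>s. integral {0..s} (\<lambda>r. \<phi> s r))"
    using integral_triangle_lower[OF continuous_\<phi>] by simp
  also have "\<dots> = integral {0..1} (\<lambda>s. \<Psi> s 0 - \<Psi> s s)"
    by (rule integral_cong) (rule integral_\<phi>, auto)
  finally show ?thesis .
qed

lemma simplex_integral_upper: "simplex_integral G w (tri_upper h q) = integral {0..1} (\<lambda>s. \<Psi> s 1 - \<Psi> s s)"
proof -
  have "simplex_integral G w (tri_upper h q) = integral triangle (\<lambda>x. - (case x of (u, v) \<Rightarrow> \<phi> v (u + v)))"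
    unfolding tri_upper_def simplex_integral_simplex2[OF T shear_families(2)]
    by (rule integral_cong) (use integrand_upper in auto)
  also have "\<dots> = - integral {0..1} (\<lambda>s. integral {s..1} (\<lambda>r. \<phi> s r))"
    using integral_triangle_upper[OF continuous_\<phi>] by (simp only: integral_neg) simp
  also have "integral {0..1} (\<lambda>s. integral {s..1} (\<lambda>r. \<phi> s r)) = integral {0..1} (\<lambda>s. \<Psi> s s - \<Psi> s 1)"
    by (rule integral_cong) (rule integral_\<phi>, auto)
  also have "- \<dots> = integral {0..1} (\<lambda>s. \<Psi> s 1 - \<Psi> s s)"
    by (simp flip: integral_neg)
  finally show ?thesis .
qed

text \<open>The diagonal terms of the two halves cancel, which leaves the edges r = 0 and r = 1 of
  the rectangle.\<close>

lemma simplex_integral_rect: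
  "simplex_integral G w (tri_lower h q) - simplex_integral G w (tri_upper h q) = integral {0..1} (\<lambda>s. \<Psi> s 0) - integral {0..1} (\<lambda>s. \<Psi> s 1)"
proof -
  have "continuous_on {0..1} (\<lambda>s. \<Psi> s 0)" "continuous_on {0..1} (\<lambda>s. \<Psi> s 1)" "continuous_on {0..1} (\<lambda>s. \<Psi> s s)"
    using S(2) by (auto intro!: continuous_\<Psi>_graph)
  then show ?thesis
    unfolding simplex_integral_lower simplex_integral_upper
    by (simp add: integral_diff integrable_continuous_interval)
qed

end

end

text \<open>The diagonal s \<mapsto> h(s) q(s) occurs with the same sign in both halves, so it
  cancels in their difference.\<close>

lemma chain_boundary_tri:
  "chain_boundary 2 (frag_of (tri_lower h q)) = frag_of (simplex1 (\<lambda>s \<theta>. h 1 \<theta> \<otimes> q s \<theta>))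
     - frag_of (simplex1 (\<lambda>s \<theta>. h s \<theta> \<otimes> q s \<theta>)) + frag_of (simplex1 (\<lambda>s \<theta>. h s \<theta> \<otimes> q 0 \<theta>))"
  "chain_boundary 2 (frag_of (tri_upper h q)) = frag_of (simplex1 (\<lambda>s \<theta>. h s \<theta> \<otimes> q 1 \<theta>))
     - frag_of (simplex1 (\<lambda>s \<theta>. h s \<theta> \<otimes> q s \<theta>)) + frag_of (simplex1 (\<lambda>s \<theta>. h 0 \<theta> \<otimes> q s \<theta>))"
  by (simp_all add: tri_lower_def tri_upper_def chain_boundary_simplex2)

end

section \<open>Piecewise smooth paths\<close>

lemma path_in_append:
  "path_in G H P a b \<Longrightarrow> path_in G H Q b c \<Longrightarrow> path_in G H (P @ Q) a c"
  by (induction P arbitrary: a) auto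

lemma path_in_mono: "H \<subseteq> K \<Longrightarrow> path_in G H P a b \<Longrightarrow> path_in G K P a b"
  by (induction P arbitrary: a) auto

lemma path_in_points: "path_in G H P a b \<Longrightarrow> p \<in> set P \<Longrightarrow> s \<in> {0..1} \<Longrightarrow> p s \<in> H"
  by (induction P arbitrary: a) auto

lemma path_chain_map_cong:
  assumes "\<And>p s. p \<in> set P \<Longrightarrow> s \<in> {0..1} \<Longrightarrow> F p s = K p s"
  shows "path_chain (map F P) = path_chain (map K P)"
  using assms
proof (induction P)
  case (Cons p P)
  then have "simplex1 (F p) = simplex1 (K p)" by (intro simplex1_cong) auto
  then show ?case using Cons by simp
qed simp

context lie
begin

lemma path_in_inv:
  "path_in G (carrier (loop_group G)) P a b \<Longrightarrow>
   path_in G (carrier (loop_group G)) (map (\<lambda>p s \<theta>. inv (p s \<theta>)) P) (\<lambda>\<theta>. inv (a \<theta>)) (\<lambda>\<theta>. inv (b \<theta>))"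
proof (induction P arbitrary: a)
  case Nil
  then show ?case using loop_carrier_inv by auto
next
  case (Cons p P)
  then obtain S where S: "open S" "{0..1} \<subseteq> S" "smooth_family G S p" by auto
  have "\<exists>S. open S \<and> {0..1} \<subseteq> S \<and> smooth_family G S (\<lambda>s \<theta>. inv (p s \<theta>))"
    using S smooth_family_inv[OF S(1,3)] by blast
  then show ?case using Cons loop_carrier_inv by auto
qed

end

section \<open>Rectangles along a path, and isotropic subgroups\<close>

context lie_cocycle
begin

text \<open>One induction over the pieces, as the end of each piece is the start of the next:
  membership in \<open>B_inv\<close> is handed on, the edge s \<mapsto> h(s) p(1) between
  neighbouring rectangles cancels, and the integrals telescope.\<close>

lemma rect_chain_path:
  assumes S: "open S" "{0..1} \<subseteq> S" "smooth_family G S h"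
    and "path_in G (carrier (loop_group G)) Q a b" and "\<And>\<theta>. a \<theta> \<in> B_inv"
  shows "b \<theta> \<in> B_inv"
    and "smooth_2chain G (rect_chain h Q)"
    and "chain_boundary 2 (rect_chain h Q) =
      path_chain (map (\<lambda>q s \<theta>. h 1 \<theta> \<otimes> q s \<theta>) Q) - path_chain (map (\<lambda>q s \<theta>. h 0 \<theta> \<otimes> q s \<theta>) Q)
      + frag_of (simplex1 (\<lambda>s \<theta>. h s \<theta> \<otimes> a \<theta>)) - frag_of (simplex1 (\<lambda>s \<theta>. h s \<theta> \<otimes> b \<theta>))"
    and "chain_integral G w (rect_chain h Q) =
      integral {0..1} (\<lambda>s. pairing (lvel G h s) (rangle G a)) - integral {0..1} (\<lambda>s. pairing (lvel G h s) (rangle G b))"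
proof -
  have "(\<forall>\<theta>. b \<theta> \<in> B_inv) \<and> smooth_2chain G (rect_chain h Q) \<and>
    chain_boundary 2 (rect_chain h Q) =
      path_chain (map (\<lambda>q s \<theta>. h 1 \<theta> \<otimes> q s \<theta>) Q) - path_chain (map (\<lambda>q s \<theta>. h 0 \<theta> \<otimes> q s \<theta>) Q)
      + frag_of (simplex1 (\<lambda>s \<theta>. h s \<theta> \<otimes> a \<theta>)) - frag_of (simplex1 (\<lambda>s \<theta>. h s \<theta> \<otimes> b \<theta>)) \<and>
    chain_integral G w (rect_chain h Q) =
      integral {0..1} (\<lambda>s. pairing (lvel G h s) (rangle G a)) - integral {0..1} (\<lambda>s. pairing (lvel G h s) (rangle G b))"
    using assms(4,5)
  proof (induction Q arbitrary: a)
    case Nil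
    then show ?case by (simp add: rect_chain_def smooth_2chain_zero)
  next
    case (Cons p Q)
    then obtain S' where S': "open S'" "{0..1} \<subseteq> S'" "smooth_family G S' p" by auto
    have p0: "p 0 = a" and path: "path_in G (carrier (loop_group G)) Q (p 1) b" using Cons.prems by auto
    define R where "R = S \<inter> S'"
    have R: "open R" "{0..1} \<subseteq> R" "smooth_family G R h" "smooth_family G R p"
      using S S' smooth_family_subset[of S h R] smooth_family_subset[of S' p R] by (auto simp: R_def)
    have inv: "p s \<theta> \<in> B_inv" if "s \<in> {0..1}" for s \<theta>
      by (rule B_inv_path[OF S'(1,2) smooth_section[OF S'(1,3)] _ that]) (use p0 Cons.prems(2) in simp)
    from Cons.IH[OF path] inv[of 1] have IH: "(\<forall>\<theta>. b \<theta> \<in> B_inv)" "smooth_2chain G (rect_chain h Q)"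
      "chain_boundary 2 (rect_chain h Q) =
      path_chain (map (\<lambda>q s \<theta>. h 1 \<theta> \<otimes> q s \<theta>) Q) - path_chain (map (\<lambda>q s \<theta>. h 0 \<theta> \<otimes> q s \<theta>) Q)
      + frag_of (simplex1 (\<lambda>s \<theta>. h s \<theta> \<otimes> p 1 \<theta>)) - frag_of (simplex1 (\<lambda>s \<theta>. h s \<theta> \<otimes> b \<theta>))"
      "chain_integral G w (rect_chain h Q) =
      integral {0..1} (\<lambda>s. pairing (lvel G h s) (rangle G (p 1))) - integral {0..1} (\<lambda>s. pairing (lvel G h s) (rangle G b))"
      by auto
    have rc: "rect_chain h (p # Q) = (frag_of (tri_lower h p) - frag_of (tri_upper h p)) + rect_chain h Q"
      by (simp add: rect_chain_def)
    have 1: "smooth_2chain G (rect_chain h (p # Q))"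
      unfolding rc by (intro smooth_2chain_add smooth_2chain_diff smooth_2chain_tri[OF R] IH)
    have 2: "chain_boundary 2 (rect_chain h (p # Q)) =
      path_chain (map (\<lambda>q s \<theta>. h 1 \<theta> \<otimes> q s \<theta>) (p # Q)) - path_chain (map (\<lambda>q s \<theta>. h 0 \<theta> \<otimes> q s \<theta>) (p # Q))
      + frag_of (simplex1 (\<lambda>s \<theta>. h s \<theta> \<otimes> a \<theta>)) - frag_of (simplex1 (\<lambda>s \<theta>. h s \<theta> \<otimes> b \<theta>))"
      unfolding rc chain_boundary_add chain_boundary_diff chain_boundary_tri IH(3) using p0 by simp
    have rect: "simplex_integral G w (tri_lower h p) - simplex_integral G w (tri_upper h p) =
        integral {0..1} (\<lambda>s. \<Psi> h p s 0) - integral {0..1} (\<lambda>s. \<Psi> h p s 1)"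
      by (rule simplex_integral_rect[OF R]) (rule inv)
    have 3: "chain_integral G w (rect_chain h (p # Q)) =
      integral {0..1} (\<lambda>s. pairing (lvel G h s) (rangle G a)) - integral {0..1} (\<lambda>s. pairing (lvel G h s) (rangle G b))"
      unfolding rc chain_integral_add chain_integral_diff chain_integral_of rect IH(4)
      by (simp add: \<Psi>_def[OF R] p0)
    show ?case using IH(1) 1 2 3 by blast
  qed
  then show "b \<theta> \<in> B_inv" "smooth_2chain G (rect_chain h Q)"
    "chain_boundary 2 (rect_chain h Q) =
      path_chain (map (\<lambda>q s \<theta>. h 1 \<theta> \<otimes> q s \<theta>) Q) - path_chain (map (\<lambda>q s \<theta>. h 0 \<theta> \<otimes> q s \<theta>) Q)
      + frag_of (simplex1 (\<lambda>s \<theta>. h s \<theta> \<otimes> a \<theta>)) - frag_of (simplex1 (\<lambda>s \<theta>. h s \<theta> \<otimes> b \<theta>))"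
    "chain_integral G w (rect_chain h Q) =
      integral {0..1} (\<lambda>s. pairing (lvel G h s) (rangle G a)) - integral {0..1} (\<lambda>s. pairing (lvel G h s) (rangle G b))"
    by blast+
qed

text \<open>The derivative is minus the cocycle of Ad (q^{-1}) \<zeta> and q^{-1} q', both in the
  isotropic Lie algebra of H.\<close>

lemma rangle_pairing_constant:
  fixes q :: "real \<Rightarrow> real \<Rightarrow> 'a"
  assumes H: "subgroup H (loop_group G)" "lie_algebra_of G H \<subseteq> loop_algebra"
    and iso: "\<And>\<xi> \<eta>. \<xi> \<in> lie_algebra_of G H \<Longrightarrow> \<eta> \<in> lie_algebra_of G H \<Longrightarrow> w \<xi> \<eta> = 0"
    and S: "open S" "{0..1} \<subseteq> S" "smooth_family G S q" and mem: "\<And>s. s \<in> {0..1} \<Longrightarrow> q s \<in> H"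
    and inv: "\<And>\<theta>. q 0 \<theta> \<in> B_inv" and \<zeta>: "\<zeta> \<in> lie_algebra_of G H" and r: "r \<in> {0..1}"
  shows "pairing \<zeta> (rangle G (q r)) = pairing \<zeta> (rangle G (q 0))"
proof -
  have inv': "q s \<theta> \<in> B_inv" if "s \<in> {0..1}" for s \<theta>
    by (rule B_inv_path[OF S(1,2) smooth_section[OF S(1,3)] inv that])
  have \<zeta>': "\<zeta> \<in> loop_algebra" using \<zeta> H(2) by blast
  have der: "((\<lambda>r. pairing \<zeta> (rangle G (q r))) has_vector_derivative
      - w (loop_Ad G (\<lambda>\<theta>. inv (q s \<theta>)) \<zeta>) (lvel G q s)) (at s within {0..1})" if "s \<in> {0..1}" for s
    by (rule rangle_pairing_derivative[OF S _ \<zeta>' that]) (rule inv')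
  \<comment> \<open>Interior points only: q is known to lie in H on [0, 1], while
    \<open>vel_in_lie_algebra\<close> needs an open set of parameters.\<close>
  have zero: "((\<lambda>r. pairing \<zeta> (rangle G (q r))) has_vector_derivative 0) (at s)" if s: "s \<in> {0<..<1}" for s
  proof -
    have s': "s \<in> {0..1}" using s by auto
    have "lvel G q s \<in> lie_algebra_of G H"
      by (rule vel_in_lie_algebra(1)[OF H(1) open_greaterThanLessThan[of 0 1] smooth_family_subset[OF S(3)] s])
        (use S(2) mem in auto)
    moreover have "loop_Ad G (\<lambda>\<theta>. inv (q s \<theta>)) \<zeta> \<in> lie_algebra_of G H"
      by (rule Ad_in_lie_algebra[OF H(1) loop_subgroup(3)[OF H(1) mem[OF s']] \<zeta>])
    ultimately have "((\<lambda>r. pairing \<zeta> (rangle G (q r))) has_vector_derivative 0) (at s within {0..1})"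
      using der[OF s'] iso by simp
    then show ?thesis using at_within_Icc_at[of 0 s 1] s by simp
  qed
  have cont: "continuous_on {0..1} (\<lambda>r. pairing \<zeta> (rangle G (q r)))"
    by (rule continuous_on_vector_derivative) (rule der)
  have "((\<lambda>r. 0) has_integral pairing \<zeta> (rangle G (q r)) - pairing \<zeta> (rangle G (q 0))) {0..r}"
    by (rule fundamental_theorem_of_calculus_interior[where f = "\<lambda>r. pairing \<zeta> (rangle G (q r))"])
      (use r zero in \<open>auto intro: continuous_on_subset[OF cont]\<close>)
  then show ?thesis using has_integral_unique[OF _ has_integral_0] by fastforce
qed

lemma rangle_one [simp]: "rangle G (\<lambda>\<theta>. \<one>) = (\<lambda>\<theta>. 0)"
  by (simp add: rangle_def rlog_def frechet_derivative_const)

lemma pairing_zero [simp]: "pairing \<xi> (\<lambda>\<theta>. 0) = 0"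
  by (simp add: pairing_def)

text \<open>Isotropy concerns velocities of curves in H, not \<open>rangle\<close> of a single loop.
  It is therefore integrated along a path from the identity loop, whose \<open>rangle\<close>
  vanishes.\<close>

lemma rangle_pairing_zero:
  assumes H: "subgroup H (loop_group G)" "lie_algebra_of G H \<subseteq> loop_algebra"
    and iso: "\<And>\<xi> \<eta>. \<xi> \<in> lie_algebra_of G H \<Longrightarrow> \<eta> \<in> lie_algebra_of G H \<Longrightarrow> w \<xi> \<eta> = 0"
    and path: "path_in G H Q (\<lambda>\<theta>. \<one>) b" and \<zeta>: "\<zeta> \<in> lie_algebra_of G H"
  shows "pairing \<zeta> (rangle G b) = 0"
proof -
  have "pairing \<zeta> (rangle G b) = pairing \<zeta> (rangle G a)"
    if "path_in G H Q a b" "\<And>\<theta>. a \<theta> \<in> B_inv" for a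
    using that
  proof (induction Q arbitrary: a)
    case (Cons p Q)
    then obtain S where S: "open S" "{0..1} \<subseteq> S" "smooth_family G S p" by auto
    have p: "p 0 = a" "\<And>s. s \<in> {0..1} \<Longrightarrow> p s \<in> H" "path_in G H Q (p 1) b" using Cons.prems by auto
    have "p 1 \<theta> \<in> B_inv" for \<theta>
      by (rule B_inv_path[OF S(1,2) smooth_section[OF S(1,3)]]) (use p Cons.prems(2) in auto)
    then have "pairing \<zeta> (rangle G b) = pairing \<zeta> (rangle G (p 1))" using Cons.IH[OF p(3)] by blast
    also have "\<dots> = pairing \<zeta> (rangle G (p 0))"
      by (rule rangle_pairing_constant[OF H iso S p(2) _ \<zeta>]) (use p(1) Cons.prems(2) in auto)
    finally show ?case by (simp add: p(1))
  qed simp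
  from this[OF path] show ?thesis by (simp add: B_inv_one)
qed

lemma langle_pairing_derivative:
  assumes S: "open S" and q: "smooth_family G S q" and c: "smooth_on UNIV c" and s: "s \<in> S"
  shows "((\<lambda>s. pairing c (langle G (q s))) has_vector_derivative
           pairing c (\<lambda>\<theta>. Ad G (inv (q s \<theta>)) (vector_derivative (rvel G q s) (at \<theta>)))) (at s)"
  by (rule pairing_derivative[OF S smooth_angle(1)[OF S q] langle_derivative[OF S q] c s])

end

section \<open>The tau function of a vacuum orbit\<close>

locale vacuum_orbit = lie_cocycle G B
  for G :: "('g::{t2_space,second_countable_topology}, 'n::finite) lie_group" (structure) and B +
  fixes Lp Lm :: "(real \<Rightarrow> 'g) set" and J :: "nat \<Rightarrow> real \<Rightarrow> complex^'n"
    and ix :: "'N::finite \<Rightarrow> nat" and f :: "real \<Rightarrow> 'g" and U :: "(real^'N) set"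
    and M E :: "real^'N \<Rightarrow> real \<Rightarrow> 'g"
  assumes split: "splitting G Lp Lm"
    and vac: "vacuum_sequence G Lp J"
    and compat: "compatible G (residue_cocycle B) Lp Lm"
    and ix: "\<And>j. ix j \<ge> 1"
    and f: "f \<in> Lm"
    and U: "open U"
    and M: "smooth_family G U M" and E: "smooth_family G U E"
    and factor: "\<And>t. t \<in> U \<Longrightarrow> M t \<in> Lm \<and> E t \<in> Lp \<and>
           vacuum_frame G J ix t \<otimes>\<^bsub>loop_group G\<^esub> inv\<^bsub>loop_group G\<^esub> f
             = inv\<^bsub>loop_group G\<^esub> (M t) \<otimes>\<^bsub>loop_group G\<^esub> E t"
    and mu_unique: "\<And>t. t \<in> U \<Longrightarrow>
           \<exists>!z. mu_value G (residue_cocycle B) Lp Lm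
                  (vacuum_frame G J ix t \<otimes>\<^bsub>loop_group G\<^esub> inv\<^bsub>loop_group G\<^esub> f) z"
begin

abbreviation "V \<equiv> vacuum_frame G J ix"
abbreviation "\<tau> \<equiv> tau G w Lp Lm J ix f"

text \<open>The generator of the vacuum flow in the time direction X: V (t + s X) = V t exp (s
  \<open>JX X\<close>). General directions are kept because a logarithm of \<tau> is wanted on a
  whole neighbourhood.\<close>

definition JX :: "real^'N \<Rightarrow> real \<Rightarrow> complex^'n" where
  "JX X = (\<lambda>\<theta>. \<Sum>j\<in>UNIV. (X $ j) *\<^sub>R J (ix j) \<theta>)"

lemma sub_p: "subgroup Lp (loop_group G)" and sub_m: "subgroup Lm (loop_group G)"
  and lie_p: "lie_algebra_of G Lp \<subseteq> loop_algebra" and lie_m: "lie_algebra_of G Lm \<subseteq> loop_algebra"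
  using split by (auto simp: splitting_def lie_subgroup_def)

lemma lin_p: "\<xi> \<in> lie_algebra_of G Lp \<Longrightarrow> \<eta> \<in> lie_algebra_of G Lp \<Longrightarrow>
    (\<lambda>\<theta>. a *\<^sub>R \<xi> \<theta> + b *\<^sub>R \<eta> \<theta>) \<in> lie_algebra_of G Lp"
  and lin_m: "\<xi> \<in> lie_algebra_of G Lm \<Longrightarrow> \<eta> \<in> lie_algebra_of G Lm \<Longrightarrow>
    (\<lambda>\<theta>. a *\<^sub>R \<xi> \<theta> + b *\<^sub>R \<eta> \<theta>) \<in> lie_algebra_of G Lm"
  using split by (auto simp: splitting_def lie_subgroup_def)

lemma J_in: "J (ix j) \<in> lie_algebra_of G Lp"
  using vac ix by (simp add: vacuum_sequence_def)

lemma JX_in: "JX X \<in> lie_algebra_of G Lp"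
proof -
  have "(\<lambda>\<theta>. \<Sum>j\<in>A. (X $ j) *\<^sub>R J (ix j) \<theta>) \<in> lie_algebra_of G Lp" for A
  proof (induction A rule: infinite_finite_induct)
    case empty
    show ?case using lin_p[OF J_in J_in, of 0 _ 0] by simp
  next
    case (infinite A)
    then show ?case using lin_p[OF J_in J_in, of 0 _ 0] by simp
  next
    case (insert j A)
    from lin_p[OF J_in insert.IH, of "X $ j" j 1] show ?case using insert by simp
  qed
  then show ?thesis by (simp add: JX_def)
qed

lemma JX_loop_algebra: "JX X \<in> loop_algebra"
  using JX_in lie_p by blast

lemma JX_axis: "JX (axis j 1) = J (ix j)"
proof
  fix \<theta>
  have "JX (axis j 1) \<theta> = (\<Sum>i\<in>UNIV. if i = j then J (ix i) \<theta> else 0)"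
    unfolding JX_def by (rule sum.cong) (auto simp: axis_def)
  then show "JX (axis j 1) \<theta> = J (ix j) \<theta>" by simp
qed

lemma JX_add: "JX (X + s *\<^sub>R Y) \<theta> = JX X \<theta> + s *\<^sub>R JX Y \<theta>"
  by (simp add: JX_def scaleR_left_distrib sum.distrib scaleR_sum_right)

lemma JX_scale: "JX (s *\<^sub>R Y) \<theta> = s *\<^sub>R JX Y \<theta>"
  by (simp add: JX_def scaleR_sum_right)

lemma bracket_JX: "bracket G (JX X \<theta>) (JX Y \<theta>) = 0"
proof -
  have "loop_bracket G (J (ix i)) (J (ix j)) = (\<lambda>\<theta>. 0)" for i j
    using vac ix by (simp add: vacuum_sequence_def)
  then have J: "bracket G (J (ix i) \<theta>) (J (ix j) \<theta>) = 0" for i j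
    by (simp add: loop_bracket_def fun_eq_iff)
  have "bracket G (J (ix i) \<theta>) (JX Y \<theta>) = 0" for i
    unfolding JX_def by (simp add: linear_sum[OF linear_bracket_right] linear_scale[OF linear_bracket_right] J)
  then show ?thesis
    unfolding JX_def[of X]
    by (simp add: linear_sum[OF linear_bracket_left] linear_scale[OF linear_bracket_left])
qed

lemma V_eq: "V t \<theta> = lie_exp G (JX t \<theta>)"
  by (simp add: vacuum_frame_def loop_exp_def JX_def)

lemma V_in: "V t \<in> Lp"
proof -
  have "loop_exp G (JX t) \<in> Lp" using split JX_in by (simp add: splitting_def lie_subgroup_def)
  then show ?thesis by (simp add: vacuum_frame_def JX_def)
qed

text \<open>The vacuum sequence commutes, so the exponential of the sum factors.\<close>

lemma V_shift: "V (t + s *\<^sub>R X) \<theta> = V t \<theta> \<otimes> lie_exp G (s *\<^sub>R JX X \<theta>)"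
  unfolding V_eq JX_add
  by (rule lie_exp_add) (simp add: linear_scale[OF linear_bracket_right] bracket_JX)

lemma Ad_V: "Ad G (V t \<theta>) (JX X \<theta>) = JX X \<theta>"
  unfolding V_eq by (rule Ad_lie_exp_fixed[OF bracket_JX])

lemma carriers: "f \<in> carrier (loop_group G)" "V t \<in> carrier (loop_group G)"
  "t \<in> U \<Longrightarrow> M t \<in> carrier (loop_group G)" "t \<in> U \<Longrightarrow> E t \<in> carrier (loop_group G)"
  using loop_subgroup(1)[OF sub_m f] loop_subgroup(1)[OF sub_p V_in] smooth_familyD(1)[OF M] smooth_familyD(1)[OF E]
  by auto

lemma factor_pointwise: "t \<in> U \<Longrightarrow> V t \<theta> \<otimes> inv (f \<theta>) = inv (M t \<theta>) \<otimes> E t \<theta>"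
  using factor[of t] loop_inv[OF carriers(1)] loop_inv[OF carriers(3)] by (auto dest: fun_cong)

lemma E_eq: "t \<in> U \<Longrightarrow> E t \<theta> = M t \<theta> \<otimes> (V t \<theta> \<otimes> inv (f \<theta>))"
  using factor_pointwise by simp

section \<open>Factorization along a segment of times\<close>

context
  fixes t0 X :: "real^'N"
begin

abbreviation "seg \<equiv> (\<lambda>s. t0 + s *\<^sub>R X)"
definition "seg_times = {s. seg s \<in> U}"

lemma open_seg_times: "open seg_times"
proof -
  have "seg_times = seg -` U" by (auto simp: seg_times_def)
  then show ?thesis using U by (auto intro!: open_vimage continuous_intros)
qed

lemma seg_families:
  "smooth_family G seg_times (\<lambda>s. M (seg s))" "smooth_family G seg_times (\<lambda>s. E (seg s))" "smooth_family G seg_times (\<lambda>s. V (seg s))"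
proof -
  have sm: "smooth_on seg_times seg"
    by (intro smooth_on_add smooth_on_const open_seg_times smooth_on_bounded_linear bounded_linear_scaleR_left)
  have img: "seg ` seg_times \<subseteq> U" by (auto simp: seg_times_def)
  show M': "smooth_family G seg_times (\<lambda>s. M (seg s))" by (rule smooth_family_compose[OF open_seg_times U M sm img])
  show E': "smooth_family G seg_times (\<lambda>s. E (seg s))" by (rule smooth_family_compose[OF open_seg_times U E sm img])
  \<comment> \<open>Joint smoothness of V in the time and the angle is read off from V = M^{-1} E
    f.\<close>
  have "smooth_family G seg_times (\<lambda>s \<theta>. inv (M (seg s) \<theta>) \<otimes> E (seg s) \<theta> \<otimes> f \<theta>)"
    by (intro smooth_family_mult smooth_family_inv open_seg_times M' E' smooth_family_const carriers)
  then show "smooth_family G seg_times (\<lambda>s. V (seg s))"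
  proof (rule smooth_family_cong[OF open_seg_times, rotated])
    fix s assume "s \<in> seg_times"
    then have "seg s \<in> U" by (simp add: seg_times_def)
    show "(\<lambda>\<theta>. inv (M (seg s) \<theta>) \<otimes> E (seg s) \<theta> \<otimes> f \<theta>) = V (seg s)"
      using factor_pointwise[OF \<open>seg s \<in> U\<close>, symmetric] by (simp add: mult_assoc)
  qed
qed

lemma V_vel: 
  assumes "s \<in> seg_times"
  shows "lvel G (\<lambda>s. V (seg s)) s = JX X" and "rvel G (\<lambda>s. V (seg s)) s = JX X"
proof -
  have "(\<lambda>s. V (seg s) \<theta>) = (\<lambda>s. V t0 \<theta> \<otimes> lie_exp G (s *\<^sub>R JX X \<theta>))" for \<theta> by (simp add: V_shift)
  then show 1: "lvel G (\<lambda>s. V (seg s)) s = JX X"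
    by (simp add: lvel_def llog_const_mult llog_lie_exp)
  show "rvel G (\<lambda>s. V (seg s)) s = JX X"
    using rvel_eq[OF open_seg_times seg_families(3) assms] by (auto simp: 1 Ad_V)
qed

text \<open>The right logarithmic derivative of E = M V f^{-1}, in which f is constant and V
  contributes \<open>JX X\<close>.\<close>

lemma Ad_M_JX:
  assumes s: "s \<in> seg_times"
  shows "loop_Ad G (M (seg s)) (JX X) = (\<lambda>\<theta>. rvel G (\<lambda>s. E (seg s)) s \<theta> - rvel G (\<lambda>s. M (seg s)) s \<theta>)"
proof
  fix \<theta>
  have const: "smooth_family G seg_times (\<lambda>s \<theta>. inv (f \<theta>))"
    by (intro smooth_family_const open_seg_times loop_carrier_inv carriers)
  have Vf: "smooth_family G seg_times (\<lambda>s \<theta>. V (seg s) \<theta> \<otimes> inv (f \<theta>))"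
    by (rule smooth_family_mult[OF open_seg_times seg_families(3) const])
  have "E (seg r) = (\<lambda>\<theta>. M (seg r) \<theta> \<otimes> (V (seg r) \<theta> \<otimes> inv (f \<theta>)))" if "r \<in> seg_times" for r
    using E_eq that by (auto simp: seg_times_def)
  then have "rvel G (\<lambda>s. E (seg s)) s = rvel G (\<lambda>s \<theta>. M (seg s) \<theta> \<otimes> (V (seg s) \<theta> \<otimes> inv (f \<theta>))) s"
    by (intro vel_cong(2)[OF open_seg_times _ seg_families(2) s])
  then have "rvel G (\<lambda>s. E (seg s)) s \<theta> = rvel G (\<lambda>s. M (seg s)) s \<theta> + Ad G (M (seg s) \<theta>) (JX X \<theta>)"
    using vel_mult(2)[OF open_seg_times seg_families(1) Vf s, of \<theta>] vel_mult(2)[OF open_seg_times seg_families(3) const s, of \<theta>]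
      V_vel(2)[OF s] by simp
  then show "loop_Ad G (M (seg s)) (JX X) \<theta> = rvel G (\<lambda>s. E (seg s)) s \<theta> - rvel G (\<lambda>s. M (seg s)) s \<theta>"
    by (simp add: loop_Ad_def)
qed

lemma rvel_E_in: "s \<in> seg_times \<Longrightarrow> rvel G (\<lambda>s. E (seg s)) s \<in> lie_algebra_of G Lp"
  by (rule vel_in_lie_algebra(2)[OF sub_p open_seg_times seg_families(2)]) (use factor in \<open>auto simp: seg_times_def\<close>)

lemma rvel_M_in: "s \<in> seg_times \<Longrightarrow> (\<lambda>\<theta>. - rvel G (\<lambda>s. M (seg s)) s \<theta>) \<in> lie_algebra_of G Lm"
proof -
  assume s: "s \<in> seg_times"
  have "rvel G (\<lambda>s. M (seg s)) s \<in> lie_algebra_of G Lm"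
    by (rule vel_in_lie_algebra(2)[OF sub_m open_seg_times seg_families(1) s]) (use factor in \<open>auto simp: seg_times_def\<close>)
  from lin_m[OF this this, of "-1" 0] show ?thesis by simp
qed

text \<open>\<open>Ad_M_JX\<close> is a decomposition into the two Lie algebras, and the splitting
  makes decompositions unique.\<close>

lemma plus_part_Ad_M:
  assumes s: "s \<in> seg_times"
  shows "plus_part G Lp Lm (loop_Ad G (M (seg s)) (JX X)) = rvel G (\<lambda>s. E (seg s)) s"
proof -
  let ?\<xi> = "loop_Ad G (M (seg s)) (JX X)"
  let ?P = "\<lambda>p. fst p \<in> lie_algebra_of G Lp \<and> snd p \<in> lie_algebra_of G Lm \<and> ?\<xi> = (\<lambda>\<theta>. fst p \<theta> + snd p \<theta>)"
  have "?\<xi> \<in> loop_algebra"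
    using smooth_loop_Ad[OF carriers(3) JX_loop_algebra] s by (simp add: seg_times_def)
  then have ex1: "\<exists>!p. ?P p" using split unfolding splitting_def by blast
  let ?p = "(rvel G (\<lambda>s. E (seg s)) s, \<lambda>\<theta>. - rvel G (\<lambda>s. M (seg s)) s \<theta>)"
  have "?\<xi> = (\<lambda>\<theta>. fst ?p \<theta> + snd ?p \<theta>)" unfolding Ad_M_JX[OF s] by simp
  then have p: "?P ?p" using rvel_E_in[OF s] rvel_M_in[OF s] by (simp only: fst_conv snd_conv)
  have "(THE p. ?P p) = ?p" by (rule the1_equality[of ?P, OF ex1 p])
  then show ?thesis unfolding plus_part_def by (simp only: fst_conv)
qed

end

section \<open>The first derivative and the surfaces that compute the tau function\<close>

definition \<alpha> :: "real^'N \<Rightarrow> real^'N \<Rightarrow> complex" where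
  "\<alpha> X t = pairing (loop_Ad G f (JX X)) (langle G (E t))"

text \<open>The part of the first derivative that is independent of t. It comes from the strip V(t)
  P_-^{-1}, whose far edge is V(t) f^{-1}.\<close>

definition \<beta> :: "real^'N \<Rightarrow> complex" where
  "\<beta> X = - pairing (JX X) (rangle G (\<lambda>\<theta>. inv (f \<theta>)))"

text \<open>\<open>mu_value\<close> leaves the factors existential. Comparing two factorizations
  puts a loop such as V^{-1} fp = f^{-1} fm into both subgroups, so it is the identity.\<close>

lemma factorization_unique:
  assumes t: "t \<in> U" and mem: "fp \<in> Lp" "fm \<in> Lm" "gp \<in> Lp" "gm \<in> Lm"
    and g: "V t \<otimes>\<^bsub>loop_group G\<^esub> inv\<^bsub>loop_group G\<^esub> f = fp \<otimes>\<^bsub>loop_group G\<^esub> inv\<^bsub>loop_group G\<^esub> fm"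
      "V t \<otimes>\<^bsub>loop_group G\<^esub> inv\<^bsub>loop_group G\<^esub> f = inv\<^bsub>loop_group G\<^esub> gm \<otimes>\<^bsub>loop_group G\<^esub> gp"
  shows "fp = V t" "fm = f" "gp = E t" "gm = M t"
proof -
  have triv: "Lp \<inter> Lm = {\<lambda>\<theta>. \<one>}" using split by (simp add: splitting_def)
  have c: "fm \<in> carrier (loop_group G)" "gm \<in> carrier (loop_group G)"
    using loop_subgroup(1)[OF sub_m] mem by auto
  have 1: "V t \<theta> \<otimes> inv (f \<theta>) = fp \<theta> \<otimes> inv (fm \<theta>)" for \<theta>
    using g(1) loop_inv[OF carriers(1)] loop_inv[OF c(1)] by (auto dest: fun_cong)
  have 2: "inv (M t \<theta>) \<otimes> E t \<theta> = inv (gm \<theta>) \<otimes> gp \<theta>" for \<theta>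
    using g(2) loop_inv[OF carriers(1)] loop_inv[OF c(2)] factor_pointwise[OF t] by (auto dest: fun_cong)
  have "inv (V t \<theta>) \<otimes> fp \<theta> = inv (f \<theta>) \<otimes> fm \<theta>" for \<theta>
  proof -
    have "inv (V t \<theta>) \<otimes> (V t \<theta> \<otimes> inv (f \<theta>)) \<otimes> fm \<theta> = inv (V t \<theta>) \<otimes> (fp \<theta> \<otimes> inv (fm \<theta>)) \<otimes> fm \<theta>"
      by (simp only: 1)
    then show ?thesis by (simp add: mult_assoc)
  qed
  moreover have "(\<lambda>\<theta>. inv (V t \<theta>) \<otimes> fp \<theta>) \<in> Lp" "(\<lambda>\<theta>. inv (f \<theta>) \<otimes> fm \<theta>) \<in> Lm"
    using loop_subgroup[OF sub_p] loop_subgroup[OF sub_m] V_in f mem by auto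
  ultimately have "(\<lambda>\<theta>. inv (V t \<theta>) \<otimes> fp \<theta>) \<in> Lp \<inter> Lm" by simp
  then have one: "inv (V t \<theta>) \<otimes> fp \<theta> = \<one>" for \<theta> unfolding triv by (auto dest: fun_cong)
  show fp: "fp = V t"
  proof
    show "fp \<theta> = V t \<theta>" for \<theta> using one[of \<theta>] by (metis mult_inv(1) mult_left_cancel)
  qed
  show "fm = f"
  proof
    show "fm \<theta> = f \<theta>" for \<theta> using 1[of \<theta>] unfolding fp by (metis inv_inv mult_left_cancel)
  qed
  have "M t \<theta> \<otimes> inv (gm \<theta>) = E t \<theta> \<otimes> inv (gp \<theta>)" for \<theta>
  proof -
    have "M t \<theta> \<otimes> (inv (M t \<theta>) \<otimes> E t \<theta>) \<otimes> inv (gp \<theta>) = M t \<theta> \<otimes> (inv (gm \<theta>) \<otimes> gp \<theta>) \<otimes> inv (gp \<theta>)"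
      by (simp only: 2)
    then show ?thesis by (simp add: mult_assoc)
  qed
  moreover have "(\<lambda>\<theta>. E t \<theta> \<otimes> inv (gp \<theta>)) \<in> Lp" "(\<lambda>\<theta>. M t \<theta> \<otimes> inv (gm \<theta>)) \<in> Lm"
    using loop_subgroup[OF sub_p] loop_subgroup[OF sub_m] factor[OF t] mem by auto
  ultimately have "(\<lambda>\<theta>. M t \<theta> \<otimes> inv (gm \<theta>)) \<in> Lp \<inter> Lm" by simp
  then have one: "M t \<theta> \<otimes> inv (gm \<theta>) = \<one>" for \<theta> unfolding triv by (auto dest: fun_cong)
  show gm: "gm = M t"
  proof
    show "gm \<theta> = M t \<theta>" for \<theta>
      using one[of \<theta>] by (metis inv_inv mult_inv(2) mult_left_cancel)
  qed
  show "gp = E t"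
  proof
    show "gp \<theta> = E t \<theta>" for \<theta> using 2[of \<theta>] unfolding gm by simp
  qed
qed

text \<open>Inversion in the loop group is known to be pointwise on its carrier. The paths lie there
  at parameters in [0, 1], which is all that their simplices see.\<close>

lemma mu_boundary:
  assumes t: "t \<in> U" and P: "path_in G Lm Pm a b" "path_in G Lm Qm c d"
  shows "path_chain (Pp @ map (\<lambda>p s. V t \<otimes>\<^bsub>loop_group G\<^esub> inv\<^bsub>loop_group G\<^esub> (p s)) Pm)
          - path_chain (map (\<lambda>q s. inv\<^bsub>loop_group G\<^esub> (q s)) Qm
                        @ map (\<lambda>q s. inv\<^bsub>loop_group G\<^esub> (M t) \<otimes>\<^bsub>loop_group G\<^esub> q s) Qp) =
    path_chain Pp + path_chain (map (\<lambda>p s \<theta>. V t \<theta> \<otimes> inv (p s \<theta>)) Pm)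
       - path_chain (map (\<lambda>q s \<theta>. inv (q s \<theta>)) Qm) - path_chain (map (\<lambda>q s \<theta>. inv (M t \<theta>) \<otimes> q s \<theta>) Qp)"
proof -
  have Pm: "path_chain (map (\<lambda>p s. V t \<otimes>\<^bsub>loop_group G\<^esub> inv\<^bsub>loop_group G\<^esub> (p s)) Pm)
      = path_chain (map (\<lambda>p s \<theta>. V t \<theta> \<otimes> inv (p s \<theta>)) Pm)"
    by (rule path_chain_map_cong) (use path_in_points[OF P(1)] loop_subgroup(1)[OF sub_m] in \<open>auto simp: loop_inv\<close>)
  have Qm: "path_chain (map (\<lambda>q s. inv\<^bsub>loop_group G\<^esub> (q s)) Qm) = path_chain (map (\<lambda>q s \<theta>. inv (q s \<theta>)) Qm)"
    by (rule path_chain_map_cong) (use path_in_points[OF P(2)] loop_subgroup(1)[OF sub_m] in \<open>auto simp: loop_inv\<close>)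
  have Qp: "path_chain (map (\<lambda>q s. inv\<^bsub>loop_group G\<^esub> (M t) \<otimes>\<^bsub>loop_group G\<^esub> q s) Qp)
      = path_chain (map (\<lambda>q s \<theta>. inv (M t \<theta>) \<otimes> q s \<theta>) Qp)"
    by (rule path_chain_map_cong) (simp add: loop_inv[OF carriers(3)[OF t]])
  show ?thesis unfolding path_chain_simps Pm Qm Qp by simp
qed

lemma mu_valueE:
  assumes t: "t \<in> U" and "mu_value G w Lp Lm (V t \<otimes>\<^bsub>loop_group G\<^esub> inv\<^bsub>loop_group G\<^esub> f) z"
  obtains Pp Pm Qp Qm \<Omega> where
    "path_in G Lp Pp (\<lambda>\<theta>. \<one>) (V t)" "path_in G Lm Pm (\<lambda>\<theta>. \<one>) f"
    "path_in G Lp Qp (\<lambda>\<theta>. \<one>) (E t)" "path_in G Lm Qm (\<lambda>\<theta>. \<one>) (M t)"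
    "smooth_2chain G \<Omega>"
    "chain_boundary 2 \<Omega> = path_chain Pp + path_chain (map (\<lambda>p s \<theta>. V t \<theta> \<otimes> inv (p s \<theta>)) Pm)
       - path_chain (map (\<lambda>q s \<theta>. inv (q s \<theta>)) Qm) - path_chain (map (\<lambda>q s \<theta>. inv (M t \<theta>) \<otimes> q s \<theta>) Qp)"
    "z = exp (chain_integral G w \<Omega>)"
proof -
  obtain fp fm gp gm Pp Pm Qp Qm \<Omega> where
    mem: "fp \<in> Lp" "fm \<in> Lm" "gp \<in> Lp" "gm \<in> Lm"
    and g: "V t \<otimes>\<^bsub>loop_group G\<^esub> inv\<^bsub>loop_group G\<^esub> f = fp \<otimes>\<^bsub>loop_group G\<^esub> inv\<^bsub>loop_group G\<^esub> fm"
      "V t \<otimes>\<^bsub>loop_group G\<^esub> inv\<^bsub>loop_group G\<^esub> f = inv\<^bsub>loop_group G\<^esub> gm \<otimes>\<^bsub>loop_group G\<^esub> gp"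
    and P: "path_in G Lp Pp \<one>\<^bsub>loop_group G\<^esub> fp" "path_in G Lm Pm \<one>\<^bsub>loop_group G\<^esub> fm"
      "path_in G Lp Qp \<one>\<^bsub>loop_group G\<^esub> gp" "path_in G Lm Qm \<one>\<^bsub>loop_group G\<^esub> gm"
    and \<Omega>: "smooth_2chain G \<Omega>" "chain_boundary 2 \<Omega> =
          path_chain (Pp @ map (\<lambda>p s. fp \<otimes>\<^bsub>loop_group G\<^esub> inv\<^bsub>loop_group G\<^esub> (p s)) Pm)
          - path_chain (map (\<lambda>q s. inv\<^bsub>loop_group G\<^esub> (q s)) Qm
                        @ map (\<lambda>q s. inv\<^bsub>loop_group G\<^esub> gm \<otimes>\<^bsub>loop_group G\<^esub> q s) Qp)"
      "z = exp (chain_integral G w \<Omega>)"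
    using assms(2) unfolding mu_value_def by blast
  note eq = factorization_unique[OF t mem g]
  have bd: "chain_boundary 2 \<Omega> = path_chain Pp + path_chain (map (\<lambda>p s \<theta>. V t \<theta> \<otimes> inv (p s \<theta>)) Pm)
       - path_chain (map (\<lambda>q s \<theta>. inv (q s \<theta>)) Qm) - path_chain (map (\<lambda>q s \<theta>. inv (M t \<theta>) \<otimes> q s \<theta>) Qp)"
    using \<Omega>(2) unfolding eq by (simp only: mu_boundary[OF t P(2,4)])
  show thesis
    by (rule that[OF _ _ _ _ \<Omega>(1) bd \<Omega>(3)]) (use P in \<open>auto simp: eq\<close>)
qed

lemma mu_valueI:
  assumes t: "t \<in> U"
    and P: "path_in G Lp Pp (\<lambda>\<theta>. \<one>) (V t)" "path_in G Lm Pm (\<lambda>\<theta>. \<one>) f"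
    "path_in G Lp Qp (\<lambda>\<theta>. \<one>) (E t)" "path_in G Lm Qm (\<lambda>\<theta>. \<one>) (M t)"
    and \<Omega>: "smooth_2chain G \<Omega>"
    "chain_boundary 2 \<Omega> = path_chain Pp + path_chain (map (\<lambda>p s \<theta>. V t \<theta> \<otimes> inv (p s \<theta>)) Pm)
       - path_chain (map (\<lambda>q s \<theta>. inv (q s \<theta>)) Qm) - path_chain (map (\<lambda>q s \<theta>. inv (M t \<theta>) \<otimes> q s \<theta>) Qp)"
  shows "mu_value G w Lp Lm (V t \<otimes>\<^bsub>loop_group G\<^esub> inv\<^bsub>loop_group G\<^esub> f) (exp (chain_integral G w \<Omega>))"
proof -
  note bd = \<Omega>(2)[folded mu_boundary[OF t P(2,4)]]
  show ?thesis
    unfolding mu_value_def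
  proof (intro bexI exI conjI)
    show "chain_boundary 2 \<Omega> =
          path_chain (Pp @ map (\<lambda>p s. V t \<otimes>\<^bsub>loop_group G\<^esub> inv\<^bsub>loop_group G\<^esub> (p s)) Pm)
          - path_chain (map (\<lambda>q s. inv\<^bsub>loop_group G\<^esub> (q s)) Qm
                        @ map (\<lambda>q s. inv\<^bsub>loop_group G\<^esub> (M t) \<otimes>\<^bsub>loop_group G\<^esub> q s) Qp)" by (rule bd)
  qed (use factor[OF t] V_in f P \<Omega>(1) in auto)
qed

text \<open>By unique existence, some surface computes the value and every admissible surface
  computes the same one.\<close>

lemma tau_eq: "t \<in> U \<Longrightarrow> mu_value G w Lp Lm (V t \<otimes>\<^bsub>loop_group G\<^esub> inv\<^bsub>loop_group G\<^esub> f) z \<longleftrightarrow> z = \<tau> t"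
  unfolding tau_def mu_def using mu_unique theI'[OF mu_unique] by blast

text \<open>The path is part of the data behind a value of \<mu>, once the factor there is
  identified with E t.\<close>

lemma E_path: "t \<in> U \<Longrightarrow> \<exists>Q. path_in G Lp Q (\<lambda>\<theta>. \<one>) (E t)"
  using mu_valueE[of t "\<tau> t"] tau_eq by metis

end

text \<open>The difference quotient at 0 is n h itself, so continuity of n at 0 is what it
  takes.\<close>

lemma has_vector_derivative_scaleR_id:
  fixes n :: "real \<Rightarrow> 'b::real_normed_vector"
  assumes "isCont n 0"
  shows "((\<lambda>h. h *\<^sub>R n h) has_vector_derivative n 0) (at 0)"
  unfolding has_vector_derivative_def has_derivative_at
proof
  show "bounded_linear (\<lambda>h. h *\<^sub>R n 0)" by (rule bounded_linear_scaleR_left)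
  have "((\<lambda>h. norm (n h - n 0)) \<longlongrightarrow> 0) (at 0)"
    using assms unfolding isCont_def by (simp add: LIM_zero tendsto_norm_zero)
  then show "(\<lambda>h. norm ((0 + h) *\<^sub>R n (0 + h) - 0 *\<^sub>R n 0 - h *\<^sub>R n 0) / norm h) \<midarrow>0\<rightarrow> 0"
    by (rule Lim_transform_eventually)
      (auto simp: eventually_at_filter simp flip: scaleR_diff_right intro!: always_eventually)
qed

context lie_form
begin

lemma pairing_add_left:
  "smooth_on UNIV \<xi> \<Longrightarrow> smooth_on UNIV \<xi>' \<Longrightarrow> smooth_on UNIV \<eta> \<Longrightarrow>
   pairing (\<lambda>\<theta>. \<xi> \<theta> + \<xi>' \<theta>) \<eta> = pairing \<xi> \<eta> + pairing \<xi>' \<eta>"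
  unfolding pairing_def B_add by (subst integral_add) (auto intro: pairing_integrable simp: distrib_left)

lemma pairing_scale_left: "pairing (\<lambda>\<theta>. r *\<^sub>R \<xi> \<theta>) \<eta> = r *\<^sub>R pairing \<xi> \<eta>"
  by (simp add: pairing_def)

end

section \<open>The increment of the tau function along a segment\<close>

context vacuum_orbit
begin

lemma iso_p: "\<xi> \<in> lie_algebra_of G Lp \<Longrightarrow> \<eta> \<in> lie_algebra_of G Lp \<Longrightarrow> w \<xi> \<eta> = 0"
  using compat by (simp add: compatible_def)

lemma carrier_p: "Lp \<subseteq> carrier (loop_group G)" and carrier_m: "Lm \<subseteq> carrier (loop_group G)"
  using loop_subgroup(1)[OF sub_p] loop_subgroup(1)[OF sub_m] by auto

lemma E_B_inv:
  assumes "t \<in> U"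
  shows "E t \<theta> \<in> B_inv"
proof -
  obtain Q where "path_in G Lp Q (\<lambda>\<theta>. \<one>) (E t)" using E_path[OF assms] by blast
  \<comment> \<open>The transport of \<open>B_inv\<close> along the path is what is wanted here; the
    constant family at f fills the place of h.\<close>
  from path_in_mono[OF carrier_p this]
  show ?thesis
    by (rule rect_chain_path(1)[OF open_UNIV subset_UNIV smooth_family_const[OF open_UNIV carriers(1)]])
      (rule B_inv_one)
qed

lemma Ad_E_f:
  assumes "t \<in> U"
  shows "Ad G (E t \<theta>) (Ad G (f \<theta>) (JX X \<theta>)) = Ad G (M t \<theta>) (JX X \<theta>)"
  unfolding E_eq[OF assms] by (simp add: Ad_mult Ad_V)

text \<open>Both arguments are moved by Ad (E^{-1}), under which B is invariant. As V commutes with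
  J, this takes M J M^{-1} to f J f^{-1}.\<close>

lemma pairing_Ad_M:
  assumes t: "t \<in> U"
  shows "pairing (loop_Ad G (M t) (JX X)) (rangle G (E t)) = \<alpha> X t"
proof -
  have "B (loop_Ad G (M t) (JX X) \<theta>) (rangle G (E t) \<theta>) = B (loop_Ad G f (JX X) \<theta>) (langle G (E t) \<theta>)" for \<theta>
    unfolding rangle_eq[OF carriers(4)[OF t]] B_invD[OF E_B_inv[OF t]] loop_Ad_def Ad_E_f[OF t, symmetric] by simp
  then show ?thesis by (simp add: \<alpha>_def pairing_def)
qed

text \<open>M J M^{-1} is E' E^{-1} - M' M^{-1}. The first part pairs to zero with
  \<open>rangle\<close> of E by isotropy, so the second carries the whole pairing.\<close>

lemma pairing_rvel_M:
  assumes s: "s \<in> seg_times t0 X"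
  shows "pairing (lvel G (\<lambda>s \<theta>. inv (M (t0 + s *\<^sub>R X) \<theta>)) s) (rangle G (E (t0 + s *\<^sub>R X))) = \<alpha> X (t0 + s *\<^sub>R X)"
proof -
  let ?t = "t0 + s *\<^sub>R X"
  let ?\<rho> = "rvel G (\<lambda>s. E (t0 + s *\<^sub>R X)) s" and ?\<zeta> = "lvel G (\<lambda>s \<theta>. inv (M (t0 + s *\<^sub>R X) \<theta>)) s"
  have t: "?t \<in> U" using s by (simp add: seg_times_def)
  have \<zeta>: "?\<zeta> = (\<lambda>\<theta>. - rvel G (\<lambda>s. M (t0 + s *\<^sub>R X)) s \<theta>)"
    using vel_inv(1)[OF open_seg_times seg_families(1) s] by blast
  have eq: "loop_Ad G (M ?t) (JX X) = (\<lambda>\<theta>. ?\<rho> \<theta> + ?\<zeta> \<theta>)" unfolding Ad_M_JX[OF s] \<zeta> by simp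
  obtain Q where "path_in G Lp Q (\<lambda>\<theta>. \<one>) (E ?t)" using E_path[OF t] by blast
  from rangle_pairing_zero[OF sub_p lie_p iso_p this rvel_E_in[OF s]]
  have "pairing ?\<rho> (rangle G (E ?t)) = 0" by blast
  moreover have "smooth_on UNIV ?\<rho>" "smooth_on UNIV ?\<zeta>"
    using rvel_E_in[OF s] rvel_M_in[OF s] lie_p lie_m loop_algebra_smooth unfolding \<zeta> by blast+
  moreover have "smooth_on UNIV (rangle G (E ?t))" using smooth_on_slice[OF smooth_angle(2)[OF U E] t] by simp
  ultimately show ?thesis using pairing_Ad_M[OF t, of X] by (simp add: eq pairing_add_left)
qed

text \<open>A surface for \<open>t0\<close> becomes one for \<open>t0 + X\<close> by adding \<open>V(t) P\<^sub>-\<^sup>-\<^sup>1\<close> and subtracting \<open>M(t)\<^sup>-\<^sup>1 Q\<^sub>+\<close> and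
  the triangle \<open>M(t)\<^sup>-\<^sup>1 E(t')\<close>, where \<open>t\<close> and \<open>t'\<close> run along the segment and \<open>t'\<close> stays behind \<open>t\<close>.\<close>
lemma tau_increment:
  assumes t0: "t0 \<in> U" and seg: "{0..1} \<subseteq> seg_times t0 X"
  shows "\<tau> (t0 + X) = \<tau> t0 * exp (\<beta> X + integral {0..1} (\<lambda>s. \<alpha> X (t0 + s *\<^sub>R X)))"
proof -
  have t1: "t0 + X \<in> U" using seg by (auto simp: seg_times_def subset_iff dest: spec[of _ 1])
  define Vs where "Vs = (\<lambda>s. V (t0 + s *\<^sub>R X))"
  define Ms where "Ms = (\<lambda>s. M (t0 + s *\<^sub>R X))"
  define Es where "Es = (\<lambda>s. E (t0 + s *\<^sub>R X))"
  define iM where "iM = (\<lambda>s \<theta>. inv (Ms s \<theta>))"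
  have fam: "smooth_family G (seg_times t0 X) Vs" "smooth_family G (seg_times t0 X) Ms" "smooth_family G (seg_times t0 X) Es"
    unfolding Vs_def Ms_def Es_def by (rule seg_families)+
  have fam_iM: "smooth_family G (seg_times t0 X) iM" unfolding iM_def by (rule smooth_family_inv[OF open_seg_times fam(2)])
  have ends [simp]: "Vs 0 = V t0" "Ms 0 = M t0" "Es 0 = E t0" "Vs 1 = V (t0 + X)" "Ms 1 = M (t0 + X)" "Es 1 = E (t0 + X)"
    by (simp_all add: Vs_def Ms_def Es_def)
  have inU: "t0 + s *\<^sub>R X \<in> U" if "s \<in> {0..1}" for s using seg that by (auto simp: seg_times_def)
  obtain Pp Pm Qp Qm \<Omega> where
    P: "path_in G Lp Pp (\<lambda>\<theta>. \<one>) (V t0)" "path_in G Lm Pm (\<lambda>\<theta>. \<one>) f"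
    "path_in G Lp Qp (\<lambda>\<theta>. \<one>) (E t0)" "path_in G Lm Qm (\<lambda>\<theta>. \<one>) (M t0)"
    and \<Omega>: "smooth_2chain G \<Omega>"
    "chain_boundary 2 \<Omega> = path_chain Pp + path_chain (map (\<lambda>p s \<theta>. V t0 \<theta> \<otimes> inv (p s \<theta>)) Pm)
       - path_chain (map (\<lambda>q s \<theta>. inv (q s \<theta>)) Qm) - path_chain (map (\<lambda>q s \<theta>. inv (M t0 \<theta>) \<otimes> q s \<theta>) Qp)"
    and z: "\<tau> t0 = exp (chain_integral G w \<Omega>)"
    by (rule mu_valueE[OF t0 tau_eq[OF t0, THEN iffD2, OF refl]])
  define Pm' where "Pm' = map (\<lambda>p s \<theta>. inv (p s \<theta>)) Pm"
  have "path_in G (carrier (loop_group G)) Pm' (\<lambda>\<theta>. inv \<one>) (\<lambda>\<theta>. inv (f \<theta>))"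
    unfolding Pm'_def by (rule path_in_inv[OF path_in_mono[OF carrier_m P(2)]])
  then have Pm': "path_in G (carrier (loop_group G)) Pm' (\<lambda>\<theta>. \<one>) (\<lambda>\<theta>. inv (f \<theta>))" by simp
  note A = rect_chain_path[OF open_seg_times seg fam(1) Pm' B_inv_one]
  note C = rect_chain_path[OF open_seg_times seg fam_iM path_in_mono[OF carrier_p P(3)] B_inv_one]
  have Es_inv: "Es s \<theta> \<in> B_inv" if "s \<in> {0..1}" for s \<theta> unfolding Es_def using E_B_inv[OF inU[OF that]] .
  note D = smooth_2chain_tri(1)[OF open_seg_times seg fam_iM fam(3)]
  have D_int: "simplex_integral G w (tri_lower iM Es) =
      integral {0..1} (\<lambda>s. \<Psi> iM Es s 0 - \<Psi> iM Es s s)"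
    by (rule simplex_integral_lower[OF open_seg_times seg fam_iM fam(3)]) (rule Es_inv)
  \<comment> \<open>The rectangles over Qp and the triangle share the edge M(t)^{-1} E(t0), which
    cancels. The continuations Vs, Ms and Es of the paths remain, and the translates of Pm and Qp
    move from t0 to t0 + X.\<close>
  define \<Omega>' where "\<Omega>' = \<Omega> + rect_chain Vs Pm' - rect_chain iM Qp - frag_of (tri_lower iM Es)"
  \<comment> \<open>The factorization makes the far edge of the V-strip the diagonal of the
    triangle, so these two cancel.\<close>
  have diag: "simplex1 (\<lambda>s \<theta>. Vs s \<theta> \<otimes> inv (f \<theta>)) = simplex1 (\<lambda>s \<theta>. iM s \<theta> \<otimes> Es s \<theta>)"
    by (rule simplex1_cong) (use factor_pointwise[OF inU] in \<open>auto simp: Vs_def iM_def Ms_def Es_def\<close>)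
  have "path_in G Lp [Vs] (V t0) (V (t0 + X))" "path_in G Lm [Ms] (M t0) (M (t0 + X))" "path_in G Lp [Es] (E t0) (E (t0 + X))"
    using open_seg_times[of t0 X] seg fam factor[OF inU] V_in factor[OF t1] unfolding Vs_def Ms_def Es_def by auto
  then have paths: "path_in G Lp (Pp @ [Vs]) (\<lambda>\<theta>. \<one>) (V (t0 + X))" "path_in G Lm (Qm @ [Ms]) (\<lambda>\<theta>. \<one>) (M (t0 + X))"
    "path_in G Lp (Qp @ [Es]) (\<lambda>\<theta>. \<one>) (E (t0 + X))"
    using path_in_append P by blast+
  have "chain_boundary 2 \<Omega>' = path_chain (Pp @ [Vs]) + path_chain (map (\<lambda>p s \<theta>. V (t0 + X) \<theta> \<otimes> inv (p s \<theta>)) Pm)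
       - path_chain (map (\<lambda>q s \<theta>. inv (q s \<theta>)) (Qm @ [Ms]))
       - path_chain (map (\<lambda>q s \<theta>. inv (M (t0 + X) \<theta>) \<otimes> q s \<theta>) (Qp @ [Es]))"
    unfolding \<Omega>'_def chain_boundary_add chain_boundary_diff A(3) C(3) chain_boundary_tri \<Omega>(2) diag
    by (simp add: Pm'_def o_def iM_def)
  moreover have "smooth_2chain G \<Omega>'"
    unfolding \<Omega>'_def by (intro smooth_2chain_add smooth_2chain_diff \<Omega>(1) A(2) C(2) D)
  ultimately have "mu_value G w Lp Lm (V (t0 + X) \<otimes>\<^bsub>loop_group G\<^esub> inv\<^bsub>loop_group G\<^esub> f) (exp (chain_integral G w \<Omega>'))"
    by (intro mu_valueI[OF t1 paths(1) P(2) paths(3) paths(2)])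
  then have "\<tau> (t0 + X) = exp (chain_integral G w \<Omega>')" using tau_eq[OF t1] by simp
  moreover have "chain_integral G w \<Omega>' = chain_integral G w \<Omega> + (\<beta> X + integral {0..1} (\<lambda>s. \<alpha> X (t0 + s *\<^sub>R X)))"
  proof -
    have "integral {0..1} (\<lambda>s. pairing (lvel G Vs s) (rangle G (\<lambda>\<theta>. inv (f \<theta>)))) =
        integral {0..1} (\<lambda>s::real. pairing (JX X) (rangle G (\<lambda>\<theta>. inv (f \<theta>))))"
      by (rule integral_cong) (use V_vel(1) seg in \<open>auto simp: Vs_def subset_iff\<close>)
    then have a: "chain_integral G w (rect_chain Vs Pm') = \<beta> X"
      unfolding A(4) by (simp add: \<beta>_def)
    have c: "chain_integral G w (rect_chain iM Qp) = - integral {0..1} (\<lambda>s. \<Psi> iM Es s 0)"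
      unfolding C(4) by (simp add: \<Psi>_def[OF open_seg_times seg fam_iM fam(3)])
    have "continuous_on {0..1} (\<lambda>s. \<Psi> iM Es s 0)" "continuous_on {0..1} (\<lambda>s. \<Psi> iM Es s s)"
      using seg by (auto intro!: continuous_\<Psi>_graph[OF open_seg_times seg fam_iM fam(3)])
    then have d: "simplex_integral G w (tri_lower iM Es) =
        integral {0..1} (\<lambda>s. \<Psi> iM Es s 0) - integral {0..1} (\<lambda>s. \<Psi> iM Es s s)"
      unfolding D_int by (simp add: integral_diff integrable_continuous_interval)
    \<comment> \<open>The integrals of \<Psi> s 0, over the shared edge, cancel between c and d; the
      diagonal of the triangle is left.\<close>
    have "integral {0..1} (\<lambda>s. \<Psi> iM Es s s) = integral {0..1} (\<lambda>s. \<alpha> X (t0 + s *\<^sub>R X))"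
    proof (rule integral_cong)
      fix s :: real assume "s \<in> {0..1}"
      then have "s \<in> seg_times t0 X" using seg by blast
      from pairing_rvel_M[OF this] show "\<Psi> iM Es s s = \<alpha> X (t0 + s *\<^sub>R X)"
        unfolding \<Psi>_def[OF open_seg_times seg fam_iM fam(3)] unfolding iM_def Ms_def Es_def .
    qed
    then show ?thesis
      unfolding \<Omega>'_def chain_integral_add chain_integral_diff chain_integral_of a c d by simp
  qed
  ultimately show ?thesis by (simp add: z exp_add)
qed

lemma tau_nonzero: "t \<in> U \<Longrightarrow> \<tau> t \<noteq> 0"
proof -
  assume t: "t \<in> U"
  obtain \<Omega> where "\<tau> t = exp (chain_integral G w \<Omega>)"
    using mu_valueE[OF t tau_eq[OF t, THEN iffD2, OF refl]] by blast
  then show ?thesis by simp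
qed

lemma \<alpha>_scale: "\<alpha> (h *\<^sub>R X) t = h *\<^sub>R \<alpha> X t"
proof -
  have "loop_Ad G f (JX (h *\<^sub>R X)) = (\<lambda>\<theta>. h *\<^sub>R loop_Ad G f (JX X) \<theta>)" by (auto simp: loop_Ad_def JX_scale)
  then show ?thesis by (simp add: \<alpha>_def pairing_scale_left)
qed

lemma \<beta>_scale: "\<beta> (h *\<^sub>R X) = h *\<^sub>R \<beta> X"
proof -
  have "JX (h *\<^sub>R X) = (\<lambda>\<theta>. h *\<^sub>R JX X \<theta>)" by (auto simp: JX_scale)
  then show ?thesis by (simp add: \<beta>_def pairing_scale_left)
qed

lemma J_loop_algebra: "J (ix j) \<in> loop_algebra"
  using J_in lie_p by blast

text \<open>Joint continuity in the direction and the time, because X enters both in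
  \<Gamma>.\<close>

lemma continuous_\<alpha>: "continuous_on (UNIV \<times> U) (\<lambda>x. \<alpha> (fst x) (snd x))"
  unfolding \<alpha>_def
proof (rule continuous_on_pairing)
  have "loop_Ad G f (JX X) \<theta> = (\<Sum>j\<in>UNIV. (X $ j) *\<^sub>R loop_Ad G f (J (ix j)) \<theta>)" for X \<theta>
    by (simp add: loop_Ad_def JX_def linear_sum[OF linear_Ad])
  moreover have "continuous_on UNIV (loop_Ad G f (J (ix j)))" for j
    using smooth_on_continuous_on[OF loop_algebra_smooth[OF smooth_loop_Ad[OF carriers(1) J_loop_algebra]]] .
  then have "continuous_on T (\<lambda>x. loop_Ad G f (J (ix j)) (snd x))" for j and T :: "('a::topological_space \<times> real) set"
    by (rule continuous_on_compose2) (auto intro!: continuous_intros)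
  ultimately show "continuous_on ((UNIV \<times> U) \<times> {0..2 * pi}) (\<lambda>x. loop_Ad G f (JX (fst (fst x))) (snd x))"
    by (auto intro!: continuous_intros)
  have img: "(\<lambda>x :: ((real^'N) \<times> (real^'N)) \<times> real. (snd (fst x), snd x)) ` ((UNIV \<times> U) \<times> {0..2 * pi}) \<subseteq> U \<times> UNIV"
    by auto
  have "continuous_on ((UNIV \<times> U) \<times> {0..2 * pi}) (\<lambda>x :: ((real^'N) \<times> (real^'N)) \<times> real. (snd (fst x), snd x))"
    by (intro continuous_intros)
  from continuous_on_compose2[OF smooth_on_continuous_on[OF smooth_angle(1)[OF U E]] this img]
  show "continuous_on ((UNIV \<times> U) \<times> {0..2 * pi})
      (\<lambda>x :: ((real^'N) \<times> (real^'N)) \<times> real. langle G (E (snd (fst x))) (snd x))"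
    by (simp only: fst_conv snd_conv)
qed

lemma continuous_\<alpha>_compose:
  assumes "continuous_on T a" and "continuous_on T b" and "b ` T \<subseteq> U"
  shows "continuous_on T (\<lambda>x. \<alpha> (a x) (b x))"
proof -
  have "(\<lambda>x. (a x, b x)) ` T \<subseteq> UNIV \<times> U" using assms(3) by auto
  from continuous_on_compose2[OF continuous_\<alpha> continuous_on_Pair[OF assms(1,2)] this]
  show ?thesis by (simp only: fst_conv snd_conv)
qed

lemma continuous_\<beta>: "continuous_on T \<beta>"
  unfolding \<beta>_def
proof (intro continuous_on_minus continuous_on_pairing)
  have "continuous_on UNIV (J (ix j))" for j
    using smooth_on_continuous_on[OF loop_algebra_smooth[OF J_loop_algebra]] .
  then have "continuous_on T (\<lambda>x. J (ix j) (snd x))" for j and T :: "('a::topological_space \<times> real) set"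
    by (rule continuous_on_compose2) (auto intro!: continuous_intros)
  then show "continuous_on (T \<times> {0..2 * pi}) (\<lambda>x. JX (fst x) (snd x))"
    unfolding JX_def by (auto intro!: continuous_intros)
  have "smooth_on UNIV (rangle G (\<lambda>\<theta>. inv (f \<theta>)))"
    using smooth_on_slice[OF smooth_angle(2)[OF open_UNIV smooth_family_const[OF open_UNIV loop_carrier_inv[OF carriers(1)]]], of "0 :: real"]
    by simp
  from smooth_on_continuous_on[OF this]
  show "continuous_on (T \<times> {0..2 * pi}) (\<lambda>x. rangle G (\<lambda>\<theta>. inv (f \<theta>)) (snd x))"
    by (rule continuous_on_compose2) (auto intro!: continuous_intros)
qed

text \<open>An explicit logarithm of \<tau>(t0 + X) / \<tau>(t0), by \<open>tau_increment\<close>;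
  its regularity can be read off the formula.\<close>

definition \<Gamma> :: "real^'N \<Rightarrow> real^'N \<Rightarrow> complex" where
  "\<Gamma> t0 X = \<beta> X + integral {0..1} (\<lambda>s. \<alpha> X (t0 + s *\<^sub>R X))"

section \<open>Local logarithms of the tau function\<close>

context
  fixes t0 :: "real^'N" and r :: real
  assumes ball: "ball t0 r \<subseteq> U" and r: "r > 0"
begin

lemma seg_in_ball: "X \<in> ball 0 r \<Longrightarrow> s \<in> {0..1} \<Longrightarrow> t0 + s *\<^sub>R X \<in> U"
proof -
  assume X: "X \<in> ball 0 r" and s: "s \<in> {0..1}"
  have "norm (s *\<^sub>R X) \<le> 1 * norm X" using s by (simp add: mult_left_le_one_le)
  then have "t0 + s *\<^sub>R X \<in> ball t0 r" using X by (simp add: dist_norm)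
  then show ?thesis using ball by blast
qed

lemma tau_eq_exp_\<Gamma>: "X \<in> ball 0 r \<Longrightarrow> \<tau> (t0 + X) = \<tau> t0 * exp (\<Gamma> t0 X)"
  unfolding \<Gamma>_def
  by (rule tau_increment) (use seg_in_ball[of X] seg_in_ball[of X 0] in \<open>auto simp: seg_times_def\<close>)

lemma continuous_\<Gamma>: "continuous_on (ball 0 r) (\<Gamma> t0)"
  unfolding \<Gamma>_def
proof (intro continuous_on_add continuous_\<beta>)
  have "continuous_on (ball 0 r \<times> cbox 0 1) (\<lambda>x. \<alpha> (fst x) (t0 + snd x *\<^sub>R fst x))"
    by (rule continuous_\<alpha>_compose) (use seg_in_ball in \<open>auto intro!: continuous_intros\<close>)
  then have "continuous_on (ball 0 r) (\<lambda>X. integral (cbox 0 1) (\<lambda>s. \<alpha> X (t0 + s *\<^sub>R X)))"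
    by (intro integral_continuous_on_param) (simp add: case_prod_unfold)
  then show "continuous_on (ball 0 r) (\<lambda>X. integral {0..1} (\<lambda>s. \<alpha> X (t0 + s *\<^sub>R X)))" by simp
qed

text \<open>\<alpha> and \<beta> are homogeneous in the direction, so along a line \<Gamma> is h
  times a continuous function n of h, and n 0 is the derivative.\<close>

lemma \<Gamma>_derivative: "((\<lambda>h. \<Gamma> t0 (h *\<^sub>R axis j 1)) has_vector_derivative \<beta> (axis j 1) + \<alpha> (axis j 1) t0) (at 0)"
proof -
  let ?e = "axis j 1 :: real^'N"
  define n where "n = (\<lambda>h. \<beta> ?e + integral {0..1} (\<lambda>s. \<alpha> ?e (t0 + (s * h) *\<^sub>R ?e)))"
  have inU: "t0 + (s * h) *\<^sub>R ?e \<in> U" if "h \<in> {-r<..<r}" "s \<in> {0..1}" for h s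
    using seg_in_ball[of "h *\<^sub>R ?e" s] that by (simp add: abs_less_iff)
  have "continuous_on ({-r<..<r} \<times> cbox 0 1) (\<lambda>x. \<alpha> ?e (t0 + (snd x * fst x) *\<^sub>R ?e))"
    by (rule continuous_\<alpha>_compose) (use inU in \<open>auto intro!: continuous_intros\<close>)
  then have "continuous_on {-r<..<r} (\<lambda>h. integral (cbox 0 1) (\<lambda>s. \<alpha> ?e (t0 + (s * h) *\<^sub>R ?e)))"
    by (intro integral_continuous_on_param) (simp add: case_prod_unfold)
  then have "continuous_on {-r<..<r} n" unfolding n_def by (intro continuous_intros) simp
  then have "isCont n 0" using r by (simp add: continuous_on_eq_continuous_at)
  from has_vector_derivative_scaleR_id[OF this]
  have "((\<lambda>h. h *\<^sub>R n h) has_vector_derivative \<beta> ?e + \<alpha> ?e t0) (at 0)" by (simp add: n_def)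
  moreover have "h *\<^sub>R n h = \<Gamma> t0 (h *\<^sub>R ?e)" for h
    by (simp add: n_def \<Gamma>_def \<beta>_scale \<alpha>_scale scaleR_add_right)
  ultimately show ?thesis by simp
qed

end

text \<open>Any branch differs from l t + \<Gamma> by a continuous function d with d 0 = 0 and
  values in 2 pi \<i> times the integers. So d vanishes near 0, and l inherits the derivative of
  \<Gamma>.\<close>

lemma log_branch_derivative:
  assumes W: "open W" "W \<subseteq> U" and l: "log_branch_on W \<tau> l" and t: "t \<in> W"
  shows "has_partial_derivative l j (\<beta> (axis j 1) + \<alpha> (axis j 1) t) t"
proof -
  let ?e = "axis j 1 :: real^'N"
  have lc: "continuous_on W l" "\<And>t. t \<in> W \<Longrightarrow> exp (l t) = \<tau> t" using l by (auto simp: log_branch_on_def)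
  obtain r where r: "r > 0" "ball t r \<subseteq> W" using W t open_contains_ball by blast
  then have rU: "ball t r \<subseteq> U" using W by blast
  define d where "d = (\<lambda>h. l (t + h *\<^sub>R ?e) - l t - \<Gamma> t (h *\<^sub>R ?e))"
  have mem: "h *\<^sub>R ?e \<in> ball 0 r" "t + h *\<^sub>R ?e \<in> ball t r" if "h \<in> {-r<..<r}" for h
    using that by (auto simp: abs_less_iff dist_norm)
  have dexp: "exp (d h) = 1" if h: "h \<in> {-r<..<r}" for h
  proof -
    have "exp (l (t + h *\<^sub>R ?e)) = exp (l t) * exp (\<Gamma> t (h *\<^sub>R ?e))"
      using tau_eq_exp_\<Gamma>[OF rU r(1) mem(1)[OF h]] lc(2) mem(2)[OF h] r(2) t by auto
    then show ?thesis by (simp add: d_def exp_diff)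
  qed
  have "continuous_on {-r<..<r} (\<lambda>h. l (t + h *\<^sub>R ?e))"
    by (rule continuous_on_compose2[OF lc(1)]) (use mem(2) r(2) in \<open>auto intro!: continuous_intros\<close>)
  moreover have "continuous_on {-r<..<r} (\<lambda>h. \<Gamma> t (h *\<^sub>R ?e))"
    by (rule continuous_on_compose2[OF continuous_\<Gamma>[OF rU r(1)]]) (use mem(1) in \<open>auto intro!: continuous_intros\<close>)
  ultimately have "continuous_on {-r<..<r} d" unfolding d_def by (intro continuous_intros)
  then have d_cont: "isCont d 0" using r(1) by (simp add: continuous_on_eq_continuous_at)
  have d0: "d 0 = 0" using \<beta>_scale[of 0 0] \<alpha>_scale[of 0 0] by (simp add: d_def \<Gamma>_def)
  \<comment> \<open>The bound 1 is below 2 pi, the smallest nonzero modulus that d could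
    take.\<close>
  obtain e where e: "e > 0" "\<And>h. \<bar>h\<bar> < e \<Longrightarrow> norm (d h) < 1"
  proof -
    have "\<exists>e>0. \<forall>h. dist h 0 < e \<longrightarrow> dist (d h) (d 0) < 1"
      using d_cont unfolding continuous_at_eps_delta by (simp add: dist_norm)
    then show thesis using that by (auto simp: dist_norm d0)
  qed
  have dz: "d h = 0" if h: "h \<in> {- min e r<..<min e r}" for h
  proof -
    have "exp (d h) = 1" using dexp h by auto
    then obtain n :: int where n: "Re (d h) = 0" "Im (d h) = of_int (2 * n) * pi" unfolding exp_eq_1 by blast
    have "\<bar>h\<bar> < e" using h by auto
    then have "\<bar>Im (d h)\<bar> < 1" using e(2)[of h] abs_Im_le_cmod[of "d h"] by linarith
    then have "\<bar>of_int (2 * n) * pi\<bar> < 1" using n by simp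
    then have lt: "real_of_int \<bar>n\<bar> * (2 * pi) < 1" by (simp add: abs_mult)
    have "n = 0"
    proof (rule ccontr)
      assume "n \<noteq> 0"
      then have "1 \<le> real_of_int \<bar>n\<bar>" by simp
      then have "1 * (2 * pi) \<le> real_of_int \<bar>n\<bar> * (2 * pi)" by (intro mult_right_mono) auto
      then show False using lt pi_gt3 by linarith
    qed
    then show ?thesis using n by (simp add: complex_eq_iff)
  qed
  have "((\<lambda>h. l t + \<Gamma> t (h *\<^sub>R ?e)) has_vector_derivative 0 + (\<beta> ?e + \<alpha> ?e t)) (at 0)"
    by (intro has_vector_derivative_add has_vector_derivative_const \<Gamma>_derivative[OF rU r(1)])
  then have "((\<lambda>h. l (t + h *\<^sub>R ?e)) has_vector_derivative 0 + (\<beta> ?e + \<alpha> ?e t)) (at 0)"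
    by (rule has_vector_derivative_transform_within_open[of _ _ _ "{- min e r<..<min e r}"])
      (use dz e r in \<open>auto simp: d_def algebra_simps\<close>)
  then show ?thesis by (simp add: has_partial_derivative_def)
qed

lemma log_branch_exists:
  assumes t: "t \<in> U"
  shows "\<exists>W l. open W \<and> t \<in> W \<and> W \<subseteq> U \<and> log_branch_on W \<tau> l"
proof -
  obtain r where r: "r > 0" "ball t r \<subseteq> U" using U t open_contains_ball by blast
  \<comment> \<open>\<open>Ln\<close> is evaluated at the single nonzero number \<tau> t, so its
    branch cut does not interfere with continuity.\<close>
  define l where "l = (\<lambda>t'. Ln (\<tau> t) + \<Gamma> t (t' - t))"
  have "continuous_on (ball t r) (\<lambda>t'. \<Gamma> t (t' - t))"
    by (rule continuous_on_compose2[OF continuous_\<Gamma>[OF r(2,1)]])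
      (auto intro!: continuous_intros simp: dist_norm norm_minus_commute)
  then have "continuous_on (ball t r) l" unfolding l_def by (intro continuous_intros)
  moreover have "exp (l t') = \<tau> t'" if "t' \<in> ball t r" for t'
    using tau_eq_exp_\<Gamma>[OF r(2,1), of "t' - t"] that tau_nonzero[OF t]
    by (simp add: l_def exp_add dist_norm norm_minus_commute)
  ultimately show ?thesis using r unfolding log_branch_on_def by (intro exI[of _ "ball t r"] exI[of _ l]) auto
qed

text \<open>By \<open>langle_derivative\<close> the varying factor changes by Ad (E^{-1}) of the
  angular derivative of E' E^{-1}, which is the plus part of M J M^{-1}. Invariance of B moves Ad
  (E^{-1}) across and turns f J f^{-1} into M J M^{-1}.\<close>

lemma \<alpha>_derivative:
  assumes t: "t \<in> U"
  shows "has_partial_derivative (\<alpha> (axis j 1)) k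
     (loop_pairing B (-1) (loop_Ad G (M t) (J (ix j)))
        (dlambda (plus_part G Lp Lm (loop_Ad G (M t) (J (ix k)))))) t"
proof -
  let ?j = "axis j 1 :: real^'N" and ?k = "axis k 1 :: real^'N"
  let ?E = "\<lambda>s. E (t + s *\<^sub>R ?k)"
  have 0: "0 \<in> seg_times t ?k" using t by (simp add: seg_times_def)
  let ?\<rho> = "rvel G ?E 0"
  have c: "smooth_on UNIV (loop_Ad G f (JX ?j))"
    by (rule loop_algebra_smooth[OF smooth_loop_Ad[OF carriers(1) JX_loop_algebra]])
  have "B (loop_Ad G f (JX ?j) \<theta>) (Ad G (inv (E t \<theta>)) Y) = B (loop_Ad G (M t) (JX ?j) \<theta>) Y" for \<theta> Y
    using B_invD[OF B_inv_inv[OF E_B_inv[OF t]]] Ad_E_f[OF t] by (simp add: loop_Ad_def)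
  then have "pairing (loop_Ad G f (JX ?j)) (\<lambda>\<theta>. Ad G (inv (?E 0 \<theta>)) (vector_derivative ?\<rho> (at \<theta>))) =
      pairing (loop_Ad G (M t) (JX ?j)) (\<lambda>\<theta>. vector_derivative ?\<rho> (at \<theta>))"
    by (simp add: pairing_def)
  also have "\<dots> = loop_pairing B (-1) (loop_Ad G (M t) (J (ix j)))
        (dlambda (plus_part G Lp Lm (loop_Ad G (M t) (J (ix k)))))"
    using plus_part_Ad_M[OF 0] by (simp add: loop_pairing_dlambda JX_axis)
  finally show ?thesis
    using langle_pairing_derivative[OF open_seg_times seg_families(2) c 0]
    by (simp add: has_partial_derivative_def \<alpha>_def)
qed

end

text \<open>A logarithm of \<tau> is determined only up to its branch, so the formula is claimed for
  every continuous branch; the existence of local branches keeps this from being vacuous.\<close>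

theorem theorem4p4:
  fixes G :: "('g::{t2_space,second_countable_topology}, 'n::finite) lie_group"
    and B :: "complex^'n \<Rightarrow> complex^'n \<Rightarrow> complex"
    and Lp Lm :: "(real \<Rightarrow> 'g) set"
    and J :: "nat \<Rightarrow> real \<Rightarrow> complex^'n"
    and ix :: "'N::finite \<Rightarrow> nat"
    and f :: "real \<Rightarrow> 'g"
    and U :: "(real^'N) set"
    and M E :: "real^'N \<Rightarrow> real \<Rightarrow> 'g"
  assumes "complex_lie_group G"
    and "invariant_form G B"
    and "splitting G Lp Lm"
    and "vacuum_sequence G Lp J"
    and "two_cocycle G (residue_cocycle B)"
    and "compatible G (residue_cocycle B) Lp Lm"
    and "integral_class G (residue_cocycle B)"
    and "bij_betw ix UNIV {1..CARD('N)}"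
    and "f \<in> Lm"
    and "open U" and "0 \<in> U"
    and "smooth_family G U M" and "smooth_family G U E"
    and "\<And>t. t \<in> U \<Longrightarrow> M t \<in> Lm \<and> E t \<in> Lp \<and>
           vacuum_frame G J ix t \<otimes>\<^bsub>loop_group G\<^esub> inv\<^bsub>loop_group G\<^esub> f
             = inv\<^bsub>loop_group G\<^esub> (M t) \<otimes>\<^bsub>loop_group G\<^esub> E t"
    and "\<And>t. t \<in> U \<Longrightarrow>
           vacuum_frame G J ix t \<otimes>\<^bsub>loop_group G\<^esub> inv\<^bsub>loop_group G\<^esub> f \<in> big_cell G Lp Lm"
    and "\<And>t. t \<in> U \<Longrightarrow>
           \<exists>!z. mu_value G (residue_cocycle B) Lp Lm
                  (vacuum_frame G J ix t \<otimes>\<^bsub>loop_group G\<^esub> inv\<^bsub>loop_group G\<^esub> f) z"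
  shows "(\<forall>t\<in>U. \<exists>W l. open W \<and> t \<in> W \<and> W \<subseteq> U \<and>
            log_branch_on W (tau G (residue_cocycle B) Lp Lm J ix f) l) \<and>
         (\<forall>W l. open W \<and> W \<subseteq> U \<and>
            log_branch_on W (tau G (residue_cocycle B) Lp Lm J ix f) l \<longrightarrow>
            (\<exists>l'. (\<forall>t\<in>W. \<forall>j. has_partial_derivative l j (l' j t) t) \<and>
                  (\<forall>t\<in>W. \<forall>j k. has_partial_derivative (l' j) k
                     (loop_pairing B (-1)
                        (loop_Ad G (M t) (J (ix j)))
                        (dlambda (plus_part G Lp Lm (loop_Ad G (M t) (J (ix k)))))) t)))"
proof -
  have ix: "ix j \<ge> 1" for j using bij_betwE[OF assms(8)] by auto
  interpret vacuum_orbit G B Lp Lm J ix f U M E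
    by unfold_locales (fact assms ix)+
  show ?thesis
  proof (intro conjI ballI allI impI)
    show "\<exists>W l. open W \<and> t \<in> W \<and> W \<subseteq> U \<and> log_branch_on W \<tau> l" if "t \<in> U" for t
      by (rule log_branch_exists[OF that])
    fix W l assume W: "open W \<and> W \<subseteq> U \<and> log_branch_on W \<tau> l"
    \<comment> \<open>The constant \<beta> makes l' the gradient of every branch, and it disappears
      on differentiating once more.\<close>
    define l' where "l' = (\<lambda>j t. \<beta> (axis j 1) + \<alpha> (axis j 1) t)"
    have "has_partial_derivative l j (l' j t) t" if "t \<in> W" for t j
      unfolding l'_def using log_branch_derivative W that by blast
    moreover have "has_partial_derivative (l' j) k
        (loop_pairing B (-1) (loop_Ad G (M t) (J (ix j)))
          (dlambda (plus_part G Lp Lm (loop_Ad G (M t) (J (ix k)))))) t" if "t \<in> W" for t j k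
    proof -
      have "t \<in> U" using W that by blast
      from has_vector_derivative_add[OF has_vector_derivative_const \<alpha>_derivative[OF this, unfolded has_partial_derivative_def]]
      show ?thesis by (simp add: l'_def has_partial_derivative_def)
    qed
    ultimately show "\<exists>l'. (\<forall>t\<in>W. \<forall>j. has_partial_derivative l j (l' j t) t) \<and>
        (\<forall>t\<in>W. \<forall>j k. has_partial_derivative (l' j) k
           (loop_pairing B (-1) (loop_Ad G (M t) (J (ix j)))
              (dlambda (plus_part G Lp Lm (loop_Ad G (M t) (J (ix k)))))) t)" by blast
  qed
qed

end
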